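(* Let $\mu_1,\mu_2$ be an Angelesco system on $[a_1,b_1]$, $[a_2,b_2]$. (a) Suppose $b_1<a_2$ and choose $r\in(b_1,a_2)$. For $n\ge1$ define $w_n$ on $[a_1,r]$ by $w_n(x)=q_n(x)^{1/n}$, and the external field $Q_n$ by $Q_n(x)=-\frac1n\log q_n(x)$. Assume that for large enough $n$ the extremal support of $w_n=q_n^{1/n}$ is $[a_1,b_n^*]$, where $\lim_{n\to\infty}b_n^*=b^*$. Then, uniformly for $x_{j,2n}$ ($1\le j\le n$) in compact subsets of $(a_1,b^* )$, as $n\to\infty$, $$\lambda_{j,2n}^{(1)}\le\bigl(1+o(1)\bigr)\,\lambda_{[n/2]}(x_{j,2n};\mu_1),$$ where $[n/2]$ is the integer part of $n/2$. (b) If, in addition to the assumptions of (a), $J_1$ is a closed subinterval of $(a_1,b^* )$ and $\mu_1$ is absolutely continuous in an open neighborhood of $J_1$, while $\mu_1'$ is bounded above by a positive constant there, then for some $C_2>0$, independent of $j$ and $n$, $$\lambda_{j,2n}^{(1)}\le\frac{C_2}{n}$$ whenever $1\le j\le n$ and $x_{j,2n}\in J_1$.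
   Context: Setting: $-\infty<a_1<b_1\le a_2<b_2<\infty$, and $\mu_1,\mu_2$ are finite positive Borel measures with infinite support, $\mathrm{supp}(\mu_j)\subset[a_j,b_j]$ (an Angelesco system). For $n\ge1$, $P_{n,n}$ is the (unique) monic polynomial of degree $2n$ with $\int P_{n,n}(x)x^k\,d\mu_j(x)=0$ for $0\le k\le n-1$ and $j=1,2$. It is known that $P_{n,n}$ has $n$ simple zeros in $(a_1,b_1)$ and $n$ simple zeros in $(a_2,b_2)$; they are denoted in increasing order $x_{1,2n}<\dots<x_{n,2n}$ (in $(a_1,b_1)$) and $x_{n+1,2n}<\dots<x_{2n,2n}$ (in $(a_2,b_2)$). Put $q_n(x)=(-1)^n\prod_{j=n+1}^{2n}(x-x_{j,2n})=\prod_{j=n+1}^{2n}(x_{j,2n}-x)$, which is positive on $(-\infty,a_2]$. The quadrature weights are $\lambda_{k,2n}^{(j)}=\int \ell_{k,2n}(x)\,d\mu_j(x)$, $1\le k\le 2n$, $j=1,2$, where $\ell_{k,2n}$ is the polynomial of degree at most $2n-1$ with $\ell_{k,2n}(x_{i,2n})=\delta_{i,k}$. Consequently $\sum_{k=1}^{2n}\lambda_{k,2n}^{(j)}P(x_{k,2n})=\int P\,d\mu_j$ for every polynomial $P$ of degree at most $3n-1$. Extremal support (Saff--Totik convention): for a weight $w=e^{-Q}$, $Q$ continuous on a compact interval $I$, the extremal (equilibrium) measure is the unique probability measure $\nu$ on $I$ minimizing $\iint\log\frac{1}{|x-y|}\,d\nu(x)\,d\nu(y)+2\int Q\,d\nu$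 over all probability measures on $I$; the extremal support of $w$ is the support of this measure. Here $I=[a_1,r]$. The Christoffel function of a measure $\mu$ is $\lambda_m(x;\mu)=\bigl(\sum_{k=0}^{m-1}p_k^2(x;\mu)\bigr)^{-1}$, where $p_k(\cdot;\mu)$ is the orthonormal polynomial of degree $k$ for $\mu$. $\mu_1'$ is the density of the absolutely continuous part of $\mu_1$ with respect to Lebesgue measure. The uniformity in (a) means: for every compact $K\subset(a_1,b^* )$ there is a sequence $\varepsilon_n\to0$ such that $\lambda_{j,2n}^{(1)}\le(1+\varepsilon_n)\lambda_{[n/2]}(x_{j,2n};\mu_1)$ for all large $n$ and all $1\le j\le n$ with $x_{j,2n}\in K$. *)

theory Defs
  imports "HOL-Probability.Probability" "HOL-Computational_Algebra.Polynomial"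
begin

definition msupport :: "real measure \<Rightarrow> real set" where
  "msupport \<mu> = {x. \<forall>e>0. emeasure \<mu> (ball x e) > 0}"

text \<open>Families such as the intervals and the measures are indexed by natural numbers, of which only
  the indices 1 and 2 are used.\<close>

definition angelesco_system ::
    "(nat \<Rightarrow> real) \<Rightarrow> (nat \<Rightarrow> real) \<Rightarrow> (nat \<Rightarrow> real measure) \<Rightarrow> bool" where
  "angelesco_system a b \<mu> \<longleftrightarrow>
     a 1 < b 1 \<and> b 1 \<le> a 2 \<and> a 2 < b 2 \<and>
     (\<forall>j\<in>{1,2}. finite_measure (\<mu> j) \<and> sets (\<mu> j) = sets borel \<and>
        infinite (msupport (\<mu> j)) \<and> msupport (\<mu> j) \<subseteq> {a j..b j})"


subsection \<open>Multiple orthogonal polynomials and quadrature weights\<close>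

definition multi_orthogonal_poly :: "(nat \<Rightarrow> real measure) \<Rightarrow> nat \<Rightarrow> real poly" where
  "multi_orthogonal_poly \<mu> n = (THE P. degree P = 2 * n \<and> lead_coeff P = 1 \<and>
     (\<forall>j\<in>{1,2}. \<forall>k<n. (LINT x|\<mu> j. poly P x * x ^ k) = 0))"

text \<open>For an Angelesco system all \<open>2 * n\<close> zeros are real and simple, and those in the first
  interval precede those in the second, so the sorted list of all real zeros enumerates them in the
  required way; the index \<open>k\<close> runs through \<open>1, \<dots>, 2 * n\<close>.\<close>

definition mop_zero :: "(nat \<Rightarrow> real measure) \<Rightarrow> nat \<Rightarrow> nat \<Rightarrow> real" where
  "mop_zero \<mu> n k =
     sorted_list_of_set {x. poly (multi_orthogonal_poly \<mu> n) x = 0} ! (k - 1)"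

definition q_fun :: "(nat \<Rightarrow> real measure) \<Rightarrow> nat \<Rightarrow> real \<Rightarrow> real" where
  "q_fun \<mu> n x = (- 1) ^ n * (\<Prod>j = n + 1..2 * n. (x - mop_zero \<mu> n j))"

definition fundamental_poly :: "(nat \<Rightarrow> real measure) \<Rightarrow> nat \<Rightarrow> nat \<Rightarrow> real poly" where
  "fundamental_poly \<mu> n k = (THE p. degree p \<le> 2 * n - 1 \<and>
     (\<forall>i\<in>{1..2 * n}. poly p (mop_zero \<mu> n i) = (if i = k then 1 else 0)))"

definition quad_weight :: "(nat \<Rightarrow> real measure) \<Rightarrow> nat \<Rightarrow> nat \<Rightarrow> nat \<Rightarrow> real" where
  "quad_weight \<mu> j n k = (LINT x|\<mu> j. poly (fundamental_poly \<mu> n k) x)"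


subsection \<open>Christoffel functions\<close>

definition orthonormal_polys :: "real measure \<Rightarrow> nat \<Rightarrow> real poly" where
  "orthonormal_polys \<mu> = (THE p. (\<forall>k. degree (p k) = k \<and> lead_coeff (p k) > 0) \<and>
     (\<forall>j k. (LINT x|\<mu>. poly (p j) x * poly (p k) x) = (if j = k then 1 else 0)))"

definition christoffel :: "real measure \<Rightarrow> nat \<Rightarrow> real \<Rightarrow> real" where
  "christoffel \<mu> m x = inverse (\<Sum>k<m. (poly (orthonormal_polys \<mu> k) x)\<^sup>2)"


subsection \<open>Extremal measures in an external field\<close>

text \<open>The Bochner integral of a non-integrable function is 0, whereas an infinite logarithmic energy
  has to count as infinite; hence an integral with values in the extended reals. It is meaningful
  whenever the positive or the negative part has a finite integral, which is the case for the
  logarithmic kernel and a measure on a bounded set.\<close>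

definition ereal_integral :: "'a measure \<Rightarrow> ('a \<Rightarrow> ereal) \<Rightarrow> ereal" where
  "ereal_integral M f =
     enn2ereal (\<integral>\<^sup>+ x. e2ennreal (f x) \<partial>M) - enn2ereal (\<integral>\<^sup>+ x. e2ennreal (- f x) \<partial>M)"

definition log_kernel :: "real \<Rightarrow> real \<Rightarrow> ereal" where
  "log_kernel x y = (if x = y then \<infinity> else ereal (ln (1 / \<bar>x - y\<bar>)))"

text \<open>The external field \<open>Q\<close> of a weight \<open>w = exp (- Q)\<close>.\<close>

definition external_field :: "(real \<Rightarrow> real) \<Rightarrow> real \<Rightarrow> real" where
  "external_field w x = - ln (w x)"

definition weighted_energy :: "real set \<Rightarrow> (real \<Rightarrow> real) \<Rightarrow> real measure \<Rightarrow> ereal" where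
  "weighted_energy I w \<nu> =
     ereal_integral (\<nu> \<Otimes>\<^sub>M \<nu>) (\<lambda>(x, y). log_kernel x y) +
     ereal (2 * (LINT x:I|\<nu>. external_field w x))"

definition prob_measures_on :: "real set \<Rightarrow> real measure set" where
  "prob_measures_on I = {\<nu>. prob_space \<nu> \<and> sets \<nu> = sets borel \<and> emeasure \<nu> I = 1}"

definition is_extremal_measure :: "real set \<Rightarrow> (real \<Rightarrow> real) \<Rightarrow> real measure \<Rightarrow> bool" where
  "is_extremal_measure I w \<nu> \<longleftrightarrow> \<nu> \<in> prob_measures_on I \<and>
     (\<forall>\<nu>'\<in>prob_measures_on I. weighted_energy I w \<nu> \<le> weighted_energy I w \<nu>')"

text \<open>The extremal measure of a continuous positive weight on a nondegenerate compact interval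
  exists and is unique, so that the following relation determines \<open>S\<close>.\<close>

definition has_extremal_support :: "real set \<Rightarrow> (real \<Rightarrow> real) \<Rightarrow> real set \<Rightarrow> bool" where
  "has_extremal_support I w S \<longleftrightarrow> (\<exists>\<nu>. is_extremal_measure I w \<nu> \<and> msupport \<nu> = S)"

definition weight_fun :: "(nat \<Rightarrow> real measure) \<Rightarrow> nat \<Rightarrow> real \<Rightarrow> real" where
  "weight_fun \<mu> n x = q_fun \<mu> n x powr (1 / real n)"

lemma external_field_weight_fun:
  "q_fun \<mu> n x > 0 \<Longrightarrow> external_field (weight_fun \<mu> n) x = - (1 / real n) * ln (q_fun \<mu> n x)"
  by (simp add: external_field_def weight_fun_def ln_powr)


subsection \<open>Density of the absolutely continuous part\<close>

text \<open>Lebesgue decomposition: the singular part is the restriction of \<open>\<mu>\<close> to a Lebesgue null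
  set. This determines \<open>f\<close> up to a Lebesgue null set.\<close>

definition is_ac_density :: "real measure \<Rightarrow> (real \<Rightarrow> real) \<Rightarrow> bool" where
  "is_ac_density \<mu> f \<longleftrightarrow> f \<in> borel_measurable borel \<and> (\<forall>x. f x \<ge> 0) \<and>
     (\<exists>N. N \<in> sets borel \<and> N \<in> null_sets lborel \<and>
       (\<forall>A\<in>sets borel. emeasure \<mu> A =
          (\<integral>\<^sup>+ x\<in>A. ennreal (f x) \<partial>lborel) + emeasure \<mu> (A \<inter> N)))"

definition abs_continuous_on :: "real measure \<Rightarrow> real set \<Rightarrow> bool" where
  "abs_continuous_on \<mu> U \<longleftrightarrow>
     absolutely_continuous (restrict_space lborel U) (restrict_space \<mu> U)"

end

theory Submission
  imports Defs
begin

text \<open>Multiplication by \<open>q\<^sub>n\<close> removes the zeros in the second interval from the quadrature formula: the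
  weights \<open>\<lambda>\<^sub>j q\<^sub>n(x\<^sub>j)\<close>, \<open>j \<le> n\<close>, are the positive weights of a quadrature formula for \<open>q\<^sub>n d\<mu>\<^sub>1\<close>
  that is exact up to degree \<open>2 n - 1\<close>. Hence \<open>\<lambda>\<^sub>j q\<^sub>n(x\<^sub>j) R(x\<^sub>j) \<le> \<integral> q\<^sub>n R d\<mu>\<^sub>1\<close> for every polynomial \<open>R\<close>
  of degree at most \<open>2 n - 1\<close> that is nonnegative at the nodes (\<open>quad_weight_bound\<close>). Take
  \<open>R = S\<^sup>2 T\<^sup>2\<close>, where \<open>S\<close> has degree less than \<open>n div 2\<close>, \<open>S(x\<^sub>j) = 1\<close>, and \<open>\<integral> S\<^sup>2 d\<mu>\<^sub>1\<close> is the
  Christoffel function at \<open>x\<^sub>j\<close>. Part (a) follows if some \<open>T\<close> of degree at most \<open>n div 2\<close>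
  satisfies \<open>T\<^sup>2 q\<^sub>n \<le> (1 + o(1)) T(x\<^sub>j)\<^sup>2 q\<^sub>n(x\<^sub>j)\<close> on the first interval: the weighted polynomial
  must peak at \<open>x\<^sub>j\<close>.

  Such a \<open>T\<close> comes from the extremal measure \<open>\<sigma>\<close>. Write \<open>p = (ln q\<^sub>n) / n\<close>. The function
  \<open>\<integral> ln \<bar>x - t\<bar> d\<sigma>(t) + p(x)\<close> is at most a constant \<open>\<Phi>\<close> on the whole interval and at least \<open>\<Phi>\<close> on the
  support, in the sense of means over subintervals (\<open>mean_potential_upper\<close>,
  \<open>mean_potential_lower\<close>). Open a gap of fixed length \<open>\<delta>\<close> around \<open>x\<^sub>j\<close> inside the support and move the mass
  that \<open>\<sigma>\<close> has in the gap to the two ends of the gap, keeping its centre of mass. As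
  \<open>ln \<bar>x - t\<bar>\<close> is concave in \<open>t\<close> on either side of \<open>x\<close>, this does not raise the function outside the gap. Its
  mean over the gap does not fall. In the gap the function is now strictly concave, with a bound
  for the curvature that comes from the zeros of \<open>q\<^sub>n\<close>. So its maximum exceeds its mean, and with
  it \<open>\<Phi>\<close>, by a fixed amount. By moving the gap the maximum is placed at \<open>x\<^sub>j\<close> (\<open>balanced_position\<close>).

  It remains to replace the measure by zeros with integer multiplicities. Outside the gap there is a fixed
  margin, and a fine but fixed grid together with the rounding of \<open>n\<close> times the masses does no
  harm once \<open>n\<close> is large. In the gap no margin is available near \<open>x\<^sub>j\<close>, but rounding only changes the
  slope at \<open>x\<^sub>j\<close> by a bounded amount, while the concavity is of order \<open>n\<close>. So the maximum exceeds the
  value at \<open>x\<^sub>j\<close> by a factor of at most \<open>exp (C / n)\<close> (\<open>peak_poly_peaks\<close>).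

  All estimates have to be uniform in \<open>n\<close>, although \<open>\<sigma>\<close> changes with \<open>n\<close>. Two facts provide this: the
  energy of \<open>\<sigma>\<close> is bounded, so that short intervals have small mass (\<open>interval_mass\<close>), and
  the mass of an interval in the support is bounded below in terms of its length (\<open>mass_lower_bound\<close>).

  For part (b), testing with a multiple of \<open>sin (N \<phi>) / sin \<phi>\<close>, a polynomial in \<open>sin \<phi>\<close>, bounds the
  Christoffel function by a multiple of \<open>1 / m\<close> (\<open>christoffel_upper_bound\<close>); the finitely many small
  \<open>n\<close> are absorbed into the constant.\<close>

section \<open>Measures with infinite support in an interval\<close>

text \<open>The complement of the support is covered by null balls, and by the Lindeloef property countably
  many of them suffice.\<close>
lemma null_outside_msupport:
  assumes "sets \<mu> = sets borel"
  shows "- msupport \<mu> \<in> null_sets \<mu>"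
proof -
  define F where "F = {ball x e | x e. e > 0 \<and> emeasure \<mu> (ball x e) = 0}"
  have "\<And>S. S \<in> F \<Longrightarrow> open S" by (auto simp: F_def)
  then obtain F' where F': "F' \<subseteq> F" "countable F'" "\<Union>F' = \<Union>F"
    using Lindelof by metis
  have "\<Union>(id ` F') \<in> null_sets \<mu>"
  proof (rule null_sets_UN')
    show "countable F'" by fact
    show "id S \<in> null_sets \<mu>" if "S \<in> F'" for S
      using that F'(1) assms by (auto simp: F_def null_sets_def)
  qed
  moreover have "\<Union>F = - msupport \<mu>"
  proof (intro equalityI subsetI)
    fix y assume "y \<in> \<Union>F"
    then obtain x e where xe: "e > 0" "emeasure \<mu> (ball x e) = 0" "y \<in> ball x e"
      by (auto simp: F_def)
    obtain d where d: "d > 0" "ball y d \<subseteq> ball x e"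
      using xe(3) open_ball openE by metis
    have "emeasure \<mu> (ball y d) \<le> emeasure \<mu> (ball x e)"
      using d assms by (intro emeasure_mono) auto
    with xe d(1) show "y \<in> - msupport \<mu>" by (auto simp: msupport_def intro!: exI[of _ d])
  next
    fix y assume "y \<in> - msupport \<mu>"
    then obtain e where "e > 0" "emeasure \<mu> (ball y e) = 0"
      by (auto simp: msupport_def not_less)
    then show "y \<in> \<Union>F" by (auto simp: F_def intro!: exI[of _ "ball y e"])
  qed
  ultimately show ?thesis using F' by simp
qed

lemma continuous_poly: "continuous_on A (poly p)" for p :: "real poly"
  by (intro continuous_intros)

text \<open>The conditions on one measure of an Angelesco system; infinite support makes the squared norm
  of every nonzero polynomial positive.\<close>
locale interval_measure = finite_measure \<mu> for \<mu> :: "real measure" +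
  fixes a b :: real
  assumes sets_borel: "sets \<mu> = sets borel"
    and support_subset: "msupport \<mu> \<subseteq> {a..b}"
    and support_infinite: "infinite (msupport \<mu>)"
begin

lemma AE_interval: "AE x in \<mu>. x \<in> {a..b}"
  using null_outside_msupport[OF sets_borel] support_subset
  by (auto intro!: AE_I'[of "- msupport \<mu>"])

lemma measurable_continuous: "continuous_on UNIV (f :: real \<Rightarrow> real) \<Longrightarrow> f \<in> borel_measurable \<mu>"
  using borel_measurable_continuous_onI sets_borel by (simp cong: measurable_cong_sets)

lemma integrable_continuous:
  assumes "continuous_on UNIV (f :: real \<Rightarrow> real)"
  shows "integrable \<mu> f"
proof -
  have "compact (f ` {a..b})"
    using assms continuous_on_subset by (intro compact_continuous_image) blast+
  then obtain B where "\<And>x. x \<in> {a..b} \<Longrightarrow> norm (f x) \<le> B"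
    using compact_imp_bounded bounded_iff by (metis imageI)
  then show ?thesis
    using AE_interval measurable_continuous[OF assms]
    by (intro integrable_const_bound[of _ B]) auto
qed

lemma integrable_poly [simp]: "integrable \<mu> (poly p)"
  by (intro integrable_continuous continuous_poly)

lemma integrable_poly_mult [simp]: "integrable \<mu> (\<lambda>x. poly p x * poly q x)"
  using integrable_poly[of "p * q"] by (simp add: poly_mult[abs_def])

lemma integral_poly_pos:
  assumes "p \<noteq> 0" "\<And>x. x \<in> {a..b} \<Longrightarrow> poly p x \<ge> 0"
  shows "(LINT x|\<mu>. poly p x) > 0"
proof -
  have ae: "AE x in \<mu>. 0 \<le> poly p x" using AE_interval assms(2) by auto
  have "(LINT x|\<mu>. poly p x) \<noteq> 0"
  proof
    assume "(LINT x|\<mu>. poly p x) = 0"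
    then have "AE x in \<mu>. poly p x = 0"
      using integral_nonneg_eq_0_iff_AE[OF integrable_poly ae] by simp
    then have "emeasure \<mu> (- {x. poly p x = 0}) = 0"
      by (subst (asm) AE_iff_null)
        (auto simp: sets_borel sets_eq_imp_space_eq[OF sets_borel] Collect_neg_eq[symmetric]
          null_sets_def continuous_poly intro!: borel_open open_Collect_neq)
    then have null: "emeasure \<mu> (- {x. poly p x = 0}) = 0" .
    have "msupport \<mu> \<subseteq> {x. poly p x = 0}"
    proof (intro subsetI CollectI, rule ccontr)
      fix x assume x: "x \<in> msupport \<mu>" "poly p x \<noteq> 0"
      have op: "open (- {x. poly p x = 0})"
        by (auto intro!: open_Collect_neq continuous_poly simp: Collect_neg_eq[symmetric])
      from op obtain e where e: "e > 0" "ball x e \<subseteq> - {x. poly p x = 0}"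
        using x(2) openE by (metis ComplI mem_Collect_eq)
      have "emeasure \<mu> (ball x e) \<le> emeasure \<mu> (- {x. poly p x = 0})"
        using e op by (intro emeasure_mono) (auto simp: sets_borel)
      then show False using x(1) e(1) null by (auto simp: msupport_def)
    qed
    then show False
      using support_infinite poly_roots_finite[OF assms(1)] finite_subset by blast
  qed
  moreover have "(LINT x|\<mu>. poly p x) \<ge> 0" by (rule integral_nonneg_AE[OF ae])
  ultimately show ?thesis by simp
qed

end

text \<open>The set \<open>Z\<close> consists of the points of odd multiplicity. Removing one zero after the other
  from \<open>P\<close> avoids multiplicities: a zero that is met again leaves \<open>Z\<close>.\<close>
lemma polynomial_sign_changes:
  fixes P :: "real poly"
  assumes "P \<noteq> 0" "a < b"
  shows "\<exists>Z. finite Z \<and> Z \<subseteq> {a<..<b} \<and> (\<Prod>z\<in>Z. [:-z, 1:]) dvd P \<and>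
    ((\<forall>x\<in>{a..b}. poly (P * (\<Prod>z\<in>Z. [:-z, 1:])) x \<ge> 0) \<or>
     (\<forall>x\<in>{a..b}. poly (P * (\<Prod>z\<in>Z. [:-z, 1:])) x \<le> 0))"
  using assms(1)
proof (induction "degree P" arbitrary: P rule: less_induct)
  case less
  show ?case
  proof (cases "\<exists>z\<in>{a<..<b}. poly P z = 0")
    case False
    have "(\<forall>x\<in>{a..b}. poly P x \<ge> 0) \<or> (\<forall>x\<in>{a..b}. poly P x \<le> 0)"
    proof (rule ccontr)
      assume "\<not> ?thesis"
      then obtain u v where uv: "u \<in> {a..b}" "v \<in> {a..b}" "poly P u < 0" "poly P v > 0"
        by (auto simp: not_le)
      then have "u \<noteq> v" by auto
      have "\<exists>z. min u v < z \<and> z < max u v \<and> poly P z = 0"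
      proof (cases "u < v")
        case True
        then show ?thesis using poly_IVT_pos[of u v P] uv by auto
      next
        case False
        then show ?thesis using poly_IVT_neg[of v u P] uv \<open>u \<noteq> v\<close> by auto
      qed
      then show False using \<open>\<not> (\<exists>z\<in>{a<..<b}. poly P z = 0)\<close> uv by (auto simp: min_def max_def split: if_splits)
    qed
    then show ?thesis by (intro exI[of _ "{}"]) auto
  next
    case True
    then obtain z where z: "z \<in> {a<..<b}" "poly P z = 0" by auto
    then obtain P1 where P1: "P = [:-z, 1:] * P1" by (auto simp: poly_eq_0_iff_dvd)
    with less.prems have "P1 \<noteq> 0" by auto
    then have "degree P = Suc (degree P1)"
      unfolding P1 by (subst degree_mult_eq) auto
    then have "degree P1 < degree P" by simp
    from less.hyps[OF this \<open>P1 \<noteq> 0\<close>] obtain Z where Z: "finite Z" "Z \<subseteq> {a<..<b}"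
      "(\<Prod>z\<in>Z. [:-z, 1:]) dvd P1"
      "(\<forall>x\<in>{a..b}. poly (P1 * (\<Prod>z\<in>Z. [:-z, 1:])) x \<ge> 0) \<or>
       (\<forall>x\<in>{a..b}. poly (P1 * (\<Prod>z\<in>Z. [:-z, 1:])) x \<le> 0)" by blast
    show ?thesis
    proof (cases "z \<in> Z")
      case False
      have eq: "poly (P * (\<Prod>z\<in>insert z Z. [:-z, 1:])) x = (x - z)\<^sup>2 * poly (P1 * (\<Prod>z\<in>Z. [:-z, 1:])) x" for x
        using Z(1) False by (simp add: P1 power2_eq_square algebra_simps)
      have "(\<Prod>z\<in>insert z Z. [:-z, 1:]) dvd P"
        unfolding P1 prod.insert[OF Z(1) False] by (intro mult_dvd_mono dvd_refl Z(3))
      then show ?thesis using Z z(1) eq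
        by (intro exI[of _ "insert z Z"]) (auto simp: mult_nonneg_nonpos)
    next
      case True
      have W: "(\<Prod>z\<in>Z. [:-z, 1:]) = [:-z, 1:] * (\<Prod>z\<in>Z - {z}. [:-z, 1:])"
        using Z(1) True by (rule prod.remove)
      then have eq: "P * (\<Prod>z\<in>Z - {z}. [:-z, 1:]) = P1 * (\<Prod>z\<in>Z. [:-z, 1:])"
        by (simp only: P1 W mult_ac)
      have "(\<Prod>z\<in>Z - {z}. [:-z, 1:]) dvd P"
        using Z(3) unfolding W P1 by (meson dvd_mult dvd_mult_right)
      then show ?thesis using Z eq by (intro exI[of _ "Z - {z}"]) auto
    qed
  qed
qed

text \<open>Gaussian elimination: an equation in which the last unknown occurs is solved for it.\<close>
lemma homogeneous_system_nontrivial_solution: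
  fixes A :: "nat \<Rightarrow> nat \<Rightarrow> real"
  shows "\<exists>c. (\<exists>i\<le>N. c i \<noteq> 0) \<and> (\<forall>k<N. (\<Sum>i\<le>N. A k i * c i) = 0)"
proof (induction N arbitrary: A)
  case 0
  show ?case by (intro exI[of _ "\<lambda>_. 1"]) auto
next
  case (Suc N)
  show ?case
  proof (cases "\<forall>k<Suc N. A k (Suc N) = 0")
    case True
    then show ?thesis
      by (intro exI[of _ "\<lambda>i. if i = Suc N then 1 else 0"]) auto
  next
    case False
    then obtain m where m: "m \<le> N" "A m (Suc N) \<noteq> 0" by (auto simp: less_Suc_eq_le)
    \<comment> \<open>the remaining equations, renumbered around the omitted equation \<open>m\<close>\<close>
    define s where "s k = (if k < m then k else Suc k)" for k
    define B where "B k i = A (s k) i - A (s k) (Suc N) / A m (Suc N) * A m i" for k i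
    obtain c where c: "\<exists>i\<le>N. c i \<noteq> 0" "\<And>k. k < N \<Longrightarrow> (\<Sum>i\<le>N. B k i * c i) = 0"
      using Suc.IH[of B] by blast
    define d where "d = c(Suc N := - (\<Sum>i\<le>N. A m i * c i) / A m (Suc N))"
    have d: "(\<Sum>i\<le>Suc N. A k i * d i) = (\<Sum>i\<le>N. A k i * c i) - A k (Suc N) / A m (Suc N) * (\<Sum>i\<le>N. A m i * c i)" for k
      by (simp add: d_def)
    have "(\<Sum>i\<le>Suc N. A k i * d i) = 0" if "k < Suc N" for k
    proof (cases "k = m")
      case True
      then show ?thesis using m(2) by (subst d) simp
    next
      case False
      define k' where "k' = (if k < m then k else k - 1)"
      have k': "k' < N" "s k' = k" using False that m(1) by (auto simp: k'_def s_def)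
      have "(\<Sum>i\<le>N. B k' i * c i) = (\<Sum>i\<le>N. A k i * c i) - A k (Suc N) / A m (Suc N) * (\<Sum>i\<le>N. A m i * c i)"
        by (simp add: B_def k'(2) algebra_simps sum_subtractf sum_distrib_left)
      then show ?thesis using c(2)[OF k'(1)] by (simp only: d)
    qed
    moreover obtain i where "i \<le> N" "c i \<noteq> 0" using c(1) by blast
    then have "\<exists>i\<le>Suc N. d i \<noteq> 0" by (intro exI[of _ i]) (auto simp: d_def)
    ultimately show ?thesis by blast
  qed
qed

section \<open>Zeros of the multiple orthogonal polynomials and quadrature\<close>

lemma poly_eq_0_of_many_roots:
  fixes p :: "real poly"
  assumes "finite Z" "\<And>z. z \<in> Z \<Longrightarrow> poly p z = 0" "degree p < card Z"
  shows "p = 0"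
proof (rule ccontr)
  assume "p \<noteq> 0"
  have "card Z \<le> card {x. poly p x = 0}"
    using assms(2) poly_roots_finite[OF \<open>p \<noteq> 0\<close>] by (intro card_mono) auto
  also have "\<dots> \<le> degree p" using \<open>p \<noteq> 0\<close> by (rule card_poly_roots_bound)
  finally show False using assms(3) by simp
qed

lemma degree_prod_linear: "finite Z \<Longrightarrow> degree (\<Prod>z\<in>Z. [:- f z, 1:]) = card Z"
  for f :: "'b \<Rightarrow> real"
  by (subst degree_prod_eq_sum_degree) auto

lemma sorted_list_of_set_Un_less:
  fixes A B :: "'a::linorder set"
  assumes "finite A" "finite B" "\<And>x y. x \<in> A \<Longrightarrow> y \<in> B \<Longrightarrow> x < y"
  shows "sorted_list_of_set (A \<union> B) = sorted_list_of_set A @ sorted_list_of_set B"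
  using assms by (intro sorted_distinct_set_unique) (auto simp: sorted_append less_imp_le)

context interval_measure begin

lemma integral_mult_eq_0:
  assumes "\<And>k. k < n \<Longrightarrow> (LINT x|\<mu>. poly P x * x ^ k) = 0" "degree W < n"
  shows "(LINT x|\<mu>. poly (P * W) x) = 0"
proof -
  have int: "integrable \<mu> (\<lambda>x. poly P x * x ^ k)" for k
    using integrable_poly[of "P * monom 1 k"] by (simp add: poly_monom poly_mult[abs_def])
  have "(LINT x|\<mu>. poly (P * W) x) = (LINT x|\<mu>. (\<Sum>k\<le>degree W. coeff W k * (poly P x * x ^ k)))"
    by (intro Bochner_Integration.integral_cong)
      (auto simp: poly_altdef[of W] sum_distrib_left algebra_simps)
  also have "\<dots> = (\<Sum>k\<le>degree W. coeff W k * (LINT x|\<mu>. poly P x * x ^ k))"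
    using int by (subst Bochner_Integration.integral_sum) auto
  also have "\<dots> = 0" using assms by (intro sum.neutral) auto
  finally show ?thesis .
qed

text \<open>With fewer than \<open>n\<close> sign changes, the product of \<open>P\<close> and the polynomial that changes sign
  at the same points would have a nonzero integral, in contradiction to orthogonality.\<close>
lemma orthogonal_poly_zeros:
  assumes "a < b" "P \<noteq> 0" "\<And>k. k < n \<Longrightarrow> (LINT x|\<mu>. poly P x * x ^ k) = 0"
  shows "\<exists>Z. finite Z \<and> Z \<subseteq> {a<..<b} \<and> n \<le> card Z \<and> (\<forall>z\<in>Z. poly P z = 0)"
proof -
  obtain Z where Z: "finite Z" "Z \<subseteq> {a<..<b}" "(\<Prod>z\<in>Z. [:-z, 1:]) dvd P"
    "(\<forall>x\<in>{a..b}. poly (P * (\<Prod>z\<in>Z. [:-z, 1:])) x \<ge> 0) \<or>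
     (\<forall>x\<in>{a..b}. poly (P * (\<Prod>z\<in>Z. [:-z, 1:])) x \<le> 0)"
    using polynomial_sign_changes[OF assms(2,1)] by blast
  define W where "W = (\<Prod>z\<in>Z. [:-z, 1:])"
  have W: "W \<noteq> 0" "degree W = card Z" using degree_prod_linear[OF Z(1), of id] Z(1) by (auto simp: W_def)
  have "n \<le> card Z"
  proof (rule ccontr)
    assume "\<not> n \<le> card Z"
    then have 0: "(LINT x|\<mu>. poly (P * W) x) = 0"
      using W(2) by (intro integral_mult_eq_0[OF assms(3)]) auto
    have nz: "P * W \<noteq> 0" "- (P * W) \<noteq> 0" using W(1) assms(2) by auto
    from Z(4) show False
    proof
      assume "\<forall>x\<in>{a..b}. poly (P * (\<Prod>z\<in>Z. [:-z, 1:])) x \<ge> 0"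
      then show False using integral_poly_pos[OF nz(1)] 0 by (auto simp: W_def)
    next
      assume "\<forall>x\<in>{a..b}. poly (P * (\<Prod>z\<in>Z. [:-z, 1:])) x \<le> 0"
      then have "(LINT x|\<mu>. poly (- (P * W)) x) > 0"
        by (intro integral_poly_pos[OF nz(2)]) (auto simp: W_def)
      also have "(LINT x|\<mu>. poly (- (P * W)) x) = - (LINT x|\<mu>. poly (P * W) x)"
        by (simp del: poly_mult)
      finally show False using 0 by simp
    qed
  qed
  moreover have "\<forall>z\<in>Z. poly P z = 0"
  proof
    fix z assume "z \<in> Z"
    then have "[:-z, 1:] dvd W" using Z(1) by (auto simp: W_def intro: dvd_prodI)
    then have "[:-z, 1:] dvd P" using Z(3) W_def dvd_trans by blast
    then show "poly P z = 0" by (simp add: poly_eq_0_iff_dvd)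
  qed
  ultimately show ?thesis using Z by blast
qed

end

locale angelesco =
  fixes a b :: "nat \<Rightarrow> real" and \<mu> :: "nat \<Rightarrow> real measure"
  assumes system: "angelesco_system a b \<mu>"
begin

lemma intervals: "a 1 < b 1" "b 1 \<le> a 2" "a 2 < b 2"
  using system by (auto simp: angelesco_system_def)

lemma interval_measure:
  assumes "j \<in> {1, 2}"
  shows "interval_measure (\<mu> j) (a j) (b j)"
  using system assms unfolding angelesco_system_def interval_measure_def interval_measure_axioms_def
  by blast

definition orthogonal :: "nat \<Rightarrow> real poly \<Rightarrow> bool" where
  "orthogonal n P \<longleftrightarrow> (\<forall>j\<in>{1,2}. \<forall>k<n. (LINT x|\<mu> j. poly P x * x ^ k) = 0)"

text \<open>Orthogonality gives \<open>n\<close> zeros in each of the two intervals, and the degree leaves room for no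
  others. Every nonzero solution of the homogeneous orthogonality conditions has exact degree
  \<open>2 n\<close>, which is the source of uniqueness.\<close>
lemma orthogonal_zeros:
  assumes "P \<noteq> 0" "degree P \<le> 2 * n" "orthogonal n P"
  shows "degree P = 2 * n" "\<exists>Z1 Z2. Z1 \<subseteq> {a 1<..<b 1} \<and> Z2 \<subseteq> {a 2<..<b 2} \<and>
    finite Z1 \<and> finite Z2 \<and> card Z1 = n \<and> card Z2 = n \<and> {x. poly P x = 0} = Z1 \<union> Z2"
proof -
  have 1: "interval_measure (\<mu> 1) (a 1) (b 1)" and 2: "interval_measure (\<mu> 2) (a 2) (b 2)"
    using interval_measure by auto
  obtain Z1 where Z1: "finite Z1" "Z1 \<subseteq> {a 1<..<b 1}" "n \<le> card Z1" "\<forall>z\<in>Z1. poly P z = 0"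
    using interval_measure.orthogonal_poly_zeros[OF 1 intervals(1) assms(1), of n] assms(3)
    by (auto simp: orthogonal_def)
  obtain Z2 where Z2: "finite Z2" "Z2 \<subseteq> {a 2<..<b 2}" "n \<le> card Z2" "\<forall>z\<in>Z2. poly P z = 0"
    using interval_measure.orthogonal_poly_zeros[OF 2 intervals(3) assms(1), of n] assms(3)
    by (auto simp: orthogonal_def)
  have disj: "Z1 \<inter> Z2 = {}" using Z1(2) Z2(2) intervals(2) by fastforce
  have card: "card (Z1 \<union> Z2) = card Z1 + card Z2"
    using Z1(1) Z2(1) disj by (rule card_Un_disjoint)
  have fin: "finite {x. poly P x = 0}" using assms(1) by (rule poly_roots_finite)
  have sub: "Z1 \<union> Z2 \<subseteq> {x. poly P x = 0}" using Z1(4) Z2(4) by auto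
  have le: "card {x. poly P x = 0} \<le> degree P" using assms(1) by (rule card_poly_roots_bound)
  have le2: "card (Z1 \<union> Z2) \<le> card {x. poly P x = 0}" using fin sub by (rule card_mono)
  show "degree P = 2 * n" using le le2 card Z1(3) Z2(3) assms(2) by linarith
  have "Z1 \<union> Z2 = {x. poly P x = 0}"
    using fin sub by (rule card_subset_eq) (use le le2 card Z1(3) Z2(3) assms(2) in linarith)
  moreover have "card Z1 = n" "card Z2 = n"
    using le le2 card Z1(3) Z2(3) assms(2) by linarith+
  ultimately show "\<exists>Z1 Z2. Z1 \<subseteq> {a 1<..<b 1} \<and> Z2 \<subseteq> {a 2<..<b 2} \<and>
    finite Z1 \<and> finite Z2 \<and> card Z1 = n \<and> card Z2 = n \<and> {x. poly P x = 0} = Z1 \<union> Z2"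
    using Z1 Z2 by metis
qed

lemma orthogonal_exists: "\<exists>P. P \<noteq> 0 \<and> degree P \<le> 2 * n \<and> orthogonal n P"
proof -
  define A where "A k i = (if k < n then LINT x|\<mu> 1. x ^ i * x ^ k else LINT x|\<mu> 2. x ^ i * x ^ (k - n))"
    for k i :: nat
  obtain c where c: "\<exists>i\<le>2 * n. c i \<noteq> 0" "\<And>k. k < 2 * n \<Longrightarrow> (\<Sum>i\<le>2 * n. A k i * c i) = 0"
    using homogeneous_system_nontrivial_solution[of "2 * n" A] by blast
  define P where "P = (\<Sum>i\<le>2 * n. monom (c i) i)"
  have coeff: "coeff P i = (if i \<le> 2 * n then c i else 0)" for i
    by (simp add: P_def coeff_sum if_distrib sum.delta cong: if_cong)
  have int: "(LINT x|\<mu> j. poly P x * x ^ k) = (\<Sum>i\<le>2 * n. (LINT x|\<mu> j. x ^ i * x ^ k) * c i)"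
    if "j \<in> {1,2}" for j k
  proof -
    interpret interval_measure "\<mu> j" "a j" "b j" using that by (rule interval_measure)
    have "(LINT x|\<mu> j. poly P x * x ^ k) = (LINT x|\<mu> j. (\<Sum>i\<le>2 * n. (x ^ i * x ^ k) * c i))"
      by (intro Bochner_Integration.integral_cong)
        (auto simp: P_def poly_sum poly_monom sum_distrib_left sum_distrib_right mult_ac)
    also have "\<dots> = (\<Sum>i\<le>2 * n. (LINT x|\<mu> j. x ^ i * x ^ k) * c i)"
      by (subst Bochner_Integration.integral_sum) (auto intro!: integrable_continuous continuous_intros)
    finally show ?thesis .
  qed
  have "P \<noteq> 0" using c(1) coeff by (metis coeff_0)
  moreover have "degree P \<le> 2 * n" using coeff by (intro degree_le) auto
  moreover have "orthogonal n P"
    unfolding orthogonal_def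
  proof (intro ballI allI impI)
    fix j k :: nat assume j: "j \<in> {1,2}" and k: "k < n"
    define k' where "k' = (if j = 1 then k else k + n)"
    have "A k' i = (LINT x|\<mu> j. x ^ i * x ^ k)" for i
      using j k by (auto simp: A_def k'_def)
    moreover have "k' < 2 * n" using k by (auto simp: k'_def)
    ultimately show "(LINT x|\<mu> j. poly P x * x ^ k) = 0"
      using c(2)[of k'] int[OF j] by simp
  qed
  ultimately show ?thesis by blast
qed

lemma orthogonal_linear:
  assumes "orthogonal n P" "orthogonal n Q"
  shows "orthogonal n (smult c P + smult d Q)"
  unfolding orthogonal_def
proof (intro ballI allI impI)
  fix j k :: nat assume j: "j \<in> {1,2}" and k: "k < n"
  interpret interval_measure "\<mu> j" "a j" "b j" using j by (rule interval_measure)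
  have int: "integrable (\<mu> j) (\<lambda>x. poly P x * x ^ k)" for P
    by (intro integrable_continuous continuous_intros)
  have "(LINT x|\<mu> j. poly (smult c P + smult d Q) x * x ^ k) =
    (LINT x|\<mu> j. c * (poly P x * x ^ k) + d * (poly Q x * x ^ k))"
    by (simp add: algebra_simps)
  also have "\<dots> = c * (LINT x|\<mu> j. poly P x * x ^ k) + d * (LINT x|\<mu> j. poly Q x * x ^ k)"
    using int by simp
  also have "(LINT x|\<mu> j. poly P x * x ^ k) = 0" using assms(1) j k unfolding orthogonal_def by blast
  also have "(LINT x|\<mu> j. poly Q x * x ^ k) = 0" using assms(2) j k unfolding orthogonal_def by blast
  finally show "(LINT x|\<mu> j. poly (smult c P + smult d Q) x * x ^ k) = 0" by simp
qed

lemma multi_orthogonal_poly: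
  "degree (multi_orthogonal_poly \<mu> n) = 2 * n" "lead_coeff (multi_orthogonal_poly \<mu> n) = 1"
  "orthogonal n (multi_orthogonal_poly \<mu> n)"
proof -
  obtain P0 where P0: "P0 \<noteq> 0" "degree P0 \<le> 2 * n" "orthogonal n P0" using orthogonal_exists by blast
  define P where "P = smult (1 / lead_coeff P0) P0"
  have "lead_coeff P0 \<noteq> 0" using P0(1) by simp
  then have P: "degree P = 2 * n" "lead_coeff P = 1" "orthogonal n P"
    using orthogonal_zeros(1)[OF P0] P0 orthogonal_linear[OF P0(3) P0(3), of "1 / lead_coeff P0" 0]
    by (auto simp: P_def)
  have "Q = P" if Q: "degree Q = 2 * n" "lead_coeff Q = 1" "orthogonal n Q" for Q
  proof (rule ccontr)
    assume "Q \<noteq> P"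
    then have nz: "smult 1 Q + smult (-1) P \<noteq> 0" by auto
    have orth: "orthogonal n (smult 1 Q + smult (-1) P)"
      using Q(3) P(3) by (rule orthogonal_linear)
    have deg: "degree (smult 1 Q + smult (-1) P) \<le> 2 * n"
      using P(1) Q(1) by (intro degree_add_le) auto
    from orthogonal_zeros(1)[OF nz deg orth]
    have "coeff (smult 1 Q + smult (-1) P) (2 * n) \<noteq> 0"
      using nz by (metis leading_coeff_0_iff)
    then show False using P Q by auto
  qed
  then have "\<exists>!P. degree P = 2 * n \<and> lead_coeff P = 1 \<and> orthogonal n P" using P by blast
  from theI'[OF this]
  show "degree (multi_orthogonal_poly \<mu> n) = 2 * n" "lead_coeff (multi_orthogonal_poly \<mu> n) = 1"
    "orthogonal n (multi_orthogonal_poly \<mu> n)"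
    by (auto simp: multi_orthogonal_poly_def orthogonal_def)
qed

lemma mop_zeros:
  shows mop_zero_first: "\<And>k. k \<in> {1..n} \<Longrightarrow> mop_zero \<mu> n k \<in> {a 1<..<b 1}"
    and mop_zero_second: "\<And>k. k \<in> {n + 1..2 * n} \<Longrightarrow> mop_zero \<mu> n k \<in> {a 2<..<b 2}"
    and inj_on_mop_zero: "inj_on (mop_zero \<mu> n) {1..2 * n}"
    and poly_mop_zero: "\<And>k. k \<in> {1..2 * n} \<Longrightarrow> poly (multi_orthogonal_poly \<mu> n) (mop_zero \<mu> n k) = 0"
proof -
  let ?P = "multi_orthogonal_poly \<mu> n"
  have "?P \<noteq> 0" using multi_orthogonal_poly(2)[of n] by auto
  from orthogonal_zeros(2)[OF this _ multi_orthogonal_poly(3)] multi_orthogonal_poly(1)[of n]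
  obtain Z1 Z2 where Z: "Z1 \<subseteq> {a 1<..<b 1}" "Z2 \<subseteq> {a 2<..<b 2}" "finite Z1" "finite Z2"
    "card Z1 = n" "card Z2 = n" "{x. poly ?P x = 0} = Z1 \<union> Z2" by auto
  have disj: "x < y" if "x \<in> Z1" "y \<in> Z2" for x y using that Z(1,2) intervals(2) by fastforce
  define xs where "xs = sorted_list_of_set (Z1 \<union> Z2)"
  have xs: "xs = sorted_list_of_set Z1 @ sorted_list_of_set Z2"
    unfolding xs_def using Z(3,4) disj by (rule sorted_list_of_set_Un_less)
  have len: "length xs = 2 * n" using Z by (simp add: xs)
  have zero: "mop_zero \<mu> n k = xs ! (k - 1)" for k by (simp add: mop_zero_def xs_def Z(7))
  show "mop_zero \<mu> n k \<in> {a 1<..<b 1}" if "k \<in> {1..n}" for k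
  proof -
    have "mop_zero \<mu> n k = sorted_list_of_set Z1 ! (k - 1)"
      using that Z(5) by (auto simp: zero xs nth_append)
    also have "\<dots> \<in> set (sorted_list_of_set Z1)" using that Z(3,5) by (intro nth_mem) auto
    finally show ?thesis using Z(1,3) by auto
  qed
  show "mop_zero \<mu> n k \<in> {a 2<..<b 2}" if "k \<in> {n + 1..2 * n}" for k
  proof -
    have "mop_zero \<mu> n k = sorted_list_of_set Z2 ! (k - 1 - n)"
      using that Z(5) by (auto simp add: zero xs nth_append)
    also have "\<dots> \<in> set (sorted_list_of_set Z2)" using that Z(4,6) by (intro nth_mem) auto
    finally show ?thesis using Z(2,4) by auto
  qed
  have "distinct xs" by (simp add: xs_def)
  then show "inj_on (mop_zero \<mu> n) {1..2 * n}"
    by (auto simp: inj_on_def zero nth_eq_iff_index_eq len)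
  show "poly ?P (mop_zero \<mu> n k) = 0" if "k \<in> {1..2 * n}" for k
  proof -
    have "mop_zero \<mu> n k \<in> set xs" unfolding zero using that len by (intro nth_mem) auto
    then show ?thesis using Z by (auto simp: xs_def)
  qed
qed

lemma poly_eq_0_if_vanishes_at_mop_zeros:
  assumes "degree p < 2 * n" "\<And>i. i \<in> {1..2 * n} \<Longrightarrow> poly p (mop_zero \<mu> n i) = 0"
  shows "p = 0"
  using assms inj_on_mop_zero
  by (intro poly_eq_0_of_many_roots[of "mop_zero \<mu> n ` {1..2 * n}"]) (auto simp: card_image)

lemma fundamental_poly:
  assumes "n \<ge> 1" "k \<in> {1..2 * n}"
  shows "degree (fundamental_poly \<mu> n k) \<le> 2 * n - 1"
    "\<And>i. i \<in> {1..2 * n} \<Longrightarrow> poly (fundamental_poly \<mu> n k) (mop_zero \<mu> n i) = (if i = k then 1 else 0)"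
proof -
  let ?x = "mop_zero \<mu> n" and ?I = "{1..2 * n}"
  define W where "W = (\<Prod>i\<in>?I - {k}. [:- ?x i, 1:])"
  have W0: "poly W (?x i) = 0 \<longleftrightarrow> i \<noteq> k" if "i \<in> ?I" for i
  proof -
    have "?x i = ?x k' \<longleftrightarrow> i = k'" if "k' \<in> ?I" for k'
      using that \<open>i \<in> ?I\<close> inj_on_mop_zero[of n] by (intro inj_on_eq_iff)
    then show ?thesis using that assms(2) by (auto simp: W_def poly_prod)
  qed
  define L where "L = smult (1 / poly W (?x k)) W"
  have "degree W = 2 * n - 1" unfolding W_def using assms(2) by (subst degree_prod_linear) auto
  then have L1: "degree L \<le> 2 * n - 1" by (simp add: L_def)
  have L2: "\<forall>i\<in>?I. poly L (?x i) = (if i = k then 1 else 0)"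
    using W0 W0[OF assms(2)] by (auto simp: L_def)
  note L = L1 L2
  have "L' = L" if "degree L' \<le> 2 * n - 1 \<and> (\<forall>i\<in>?I. poly L' (?x i) = (if i = k then 1 else 0))" for L'
  proof -
    have "degree (L' - L) \<le> 2 * n - 1" using that L by (intro degree_diff_le) auto
    then have "L' - L = 0" using that L assms
      by (intro poly_eq_0_if_vanishes_at_mop_zeros[of _ n]) auto
    then show ?thesis by simp
  qed
  then have "\<exists>!p. degree p \<le> 2 * n - 1 \<and> (\<forall>i\<in>?I. poly p (?x i) = (if i = k then 1 else 0))"
    using L by blast
  from theI'[OF this] show "degree (fundamental_poly \<mu> n k) \<le> 2 * n - 1"
    "\<And>i. i \<in> ?I \<Longrightarrow> poly (fundamental_poly \<mu> n k) (?x i) = (if i = k then 1 else 0)"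
    by (auto simp: fundamental_poly_def)
qed

text \<open>Division by the multiple orthogonal polynomial leaves a quotient of degree less than \<open>n\<close>, whose
  contribution vanishes by orthogonality, and a remainder that is interpolated exactly.\<close>
lemma quadrature:
  assumes "n \<ge> 1" "j \<in> {1,2}" "degree P \<le> 3 * n - 1"
  shows "(LINT x|\<mu> j. poly P x) = (\<Sum>k\<in>{1..2 * n}. quad_weight \<mu> j n k * poly P (mop_zero \<mu> n k))"
proof -
  interpret interval_measure "\<mu> j" "a j" "b j" using assms(2) by (rule interval_measure)
  let ?M = "multi_orthogonal_poly \<mu> n" and ?x = "mop_zero \<mu> n" and ?I = "{1..2 * n}"
  have M0: "?M \<noteq> 0" using multi_orthogonal_poly(2)[of n] by auto
  define A where "A = P div ?M"
  define B where "B = P mod ?M"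
  have P: "P = ?M * A + B" by (simp add: A_def B_def)
  have degB: "degree B < 2 * n"
    using degree_mod_less[OF M0, of P] multi_orthogonal_poly(1)[of n] assms(1) by (auto simp: B_def)
  have degA: "degree A < n"
  proof (cases "A = 0")
    case False
    have "degree (?M * A) = 2 * n + degree A"
      using False M0 multi_orthogonal_poly(1)[of n] by (simp add: degree_mult_eq)
    moreover have "?M * A = P - B" by (simp add: P)
    then have "degree (?M * A) \<le> 3 * n - 1" using assms(1,3) degB by (auto intro!: degree_diff_le)
    ultimately show ?thesis using assms(1) by linarith
  qed (use assms(1) in auto)
  have "(LINT x|\<mu> j. poly P x) = (LINT x|\<mu> j. poly (?M * A) x + poly B x)"
    by (subst P) (simp only: poly_add[abs_def])
  also have "\<dots> = (LINT x|\<mu> j. poly (?M * A) x) + (LINT x|\<mu> j. poly B x)"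
    by (intro Bochner_Integration.integral_add integrable_poly)
  also have "(LINT x|\<mu> j. poly (?M * A) x) = 0"
    using multi_orthogonal_poly(3)[of n] assms(2) degA
    by (intro integral_mult_eq_0[of n]) (auto simp: orthogonal_def)
  also have "B = (\<Sum>k\<in>?I. smult (poly B (?x k)) (fundamental_poly \<mu> n k))" (is "_ = ?C")
  proof -
    have "degree (B - ?C) \<le> 2 * n - 1"
      using degB fundamental_poly(1)[OF assms(1)]
      by (intro degree_diff_le degree_sum_le) (auto intro: order_trans[OF degree_smult_le])
    moreover have "poly (B - ?C) (?x i) = 0" if "i \<in> ?I" for i
      using that assms(1) by (simp add: poly_sum fundamental_poly(2) if_distrib sum.delta' cong: if_cong)
    ultimately have "B - ?C = 0" using assms(1)
      by (intro poly_eq_0_if_vanishes_at_mop_zeros[of _ n]) auto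
    then show ?thesis by simp
  qed
  also have "(LINT x|\<mu> j. poly ?C x) = (\<Sum>k\<in>?I. poly B (?x k) * quad_weight \<mu> j n k)"
    by (simp add: poly_sum[abs_def] quad_weight_def poly_sum)
  also have "\<dots> = (\<Sum>k\<in>?I. quad_weight \<mu> j n k * poly P (?x k))"
    by (intro sum.cong) (auto simp: P poly_mop_zero)
  finally show ?thesis by simp
qed

lemma q_fun_eq: "q_fun \<mu> n x = (\<Prod>j\<in>{n + 1..2 * n}. mop_zero \<mu> n j - x)"
  using prod_uminus[of "\<lambda>j. x - mop_zero \<mu> n j" "{n + 1..2 * n}"] by (simp add: q_fun_def)

end

context angelesco begin

text \<open>Testing with \<open>q\<^sub>n W\<^sup>2\<close>, where \<open>W\<close> vanishes at all but one of the first \<open>n\<close> nodes, shows that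
  the weights at these nodes are nonnegative. Then a single term of the quadrature sum is at most the
  whole sum.\<close>
lemma quad_weight_bound:
  assumes "n \<ge> 1" "j \<in> {1..n}" "degree R \<le> 2 * n - 1"
    and nonneg: "\<And>i. i \<in> {1..n} \<Longrightarrow> poly R (mop_zero \<mu> n i) \<ge> 0"
  shows "quad_weight \<mu> 1 n j * q_fun \<mu> n (mop_zero \<mu> n j) * poly R (mop_zero \<mu> n j)
    \<le> (LINT x|\<mu> 1. q_fun \<mu> n x * poly R x)"
proof -
  interpret interval_measure "\<mu> 1" "a 1" "b 1" by (rule interval_measure) simp
  let ?x = "mop_zero \<mu> n"
  define Q where "Q = smult ((-1) ^ n) (\<Prod>i\<in>{n + 1..2 * n}. [:- ?x i, 1:])"
  have Q: "poly Q x = q_fun \<mu> n x" for x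
    by (simp add: Q_def q_fun_def poly_prod)
  have degQ: "degree Q \<le> n" by (simp add: Q_def degree_prod_linear)
  have Qpos: "q_fun \<mu> n x > 0" if "x \<le> a 2" for x
    unfolding q_fun_eq using that mop_zero_second[of _ n]
    by (intro prod_pos) (meson diff_gt_0_iff_gt greaterThanLessThan_iff le_less_trans)
  have Qzero: "q_fun \<mu> n (?x i) = 0" if "i \<in> {n + 1..2 * n}" for i
    unfolding q_fun_eq using that by (intro prod_zero) auto
  have split: "(LINT x|\<mu> 1. q_fun \<mu> n x * poly R x) =
      (\<Sum>k\<in>{1..n}. quad_weight \<mu> 1 n k * q_fun \<mu> n (?x k) * poly R (?x k))"
    if "degree R \<le> 2 * n - 1" for R
  proof -
    have "degree (Q * R) \<le> 3 * n - 1"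
      using degree_mult_le[of Q R] degQ that assms(1) by linarith
    from quadrature[OF assms(1) _ this, of 1]
    have "(LINT x|\<mu> 1. q_fun \<mu> n x * poly R x) =
      (\<Sum>k\<in>{1..2 * n}. quad_weight \<mu> 1 n k * q_fun \<mu> n (?x k) * poly R (?x k))"
      by (simp add: Q mult_ac)
    also have "\<dots> = (\<Sum>k\<in>{1..n}. quad_weight \<mu> 1 n k * q_fun \<mu> n (?x k) * poly R (?x k))"
      by (intro sum.mono_neutral_right) (auto simp: Qzero)
    finally show ?thesis .
  qed
  have pos: "quad_weight \<mu> 1 n k * q_fun \<mu> n (?x k) \<ge> 0" if k: "k \<in> {1..n}" for k
  proof -
    define W where "W = (\<Prod>i\<in>{1..n} - {k}. [:- ?x i, 1:])"
    have W0: "poly W (?x i) = 0 \<longleftrightarrow> i \<noteq> k" if "i \<in> {1..n}" for i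
    proof -
      have "?x i = ?x k' \<longleftrightarrow> i = k'" if "k' \<in> {1..n}" for k'
        using that \<open>i \<in> {1..n}\<close> inj_on_mop_zero[of n] by (intro inj_on_eq_iff) auto
      then show ?thesis using that k by (auto simp: W_def poly_prod)
    qed
    have "degree W \<le> n - 1" using k by (simp add: W_def degree_prod_linear)
    then have deg: "degree (W * W) \<le> 2 * n - 1"
      using degree_mult_le[of W W] assms(1) by linarith
    have "0 \<le> (LINT x|\<mu> 1. q_fun \<mu> n x * poly (W * W) x)"
    proof (intro integral_nonneg_AE eventually_mono[OF AE_interval])
      fix x assume "x \<in> {a 1..b 1}"
      then have "0 < q_fun \<mu> n x" using intervals(2) by (intro Qpos) auto
      then show "0 \<le> q_fun \<mu> n x * poly (W * W) x" by (simp add: less_imp_le)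
    qed
    also have "\<dots> = (\<Sum>i\<in>{1..n}. quad_weight \<mu> 1 n i * q_fun \<mu> n (?x i) * poly (W * W) (?x i))"
      using deg by (rule split)
    also have "\<dots> = (\<Sum>i\<in>{k}. quad_weight \<mu> 1 n i * q_fun \<mu> n (?x i) * poly (W * W) (?x i))"
      using k W0 by (intro sum.mono_neutral_right) auto
    finally have "0 \<le> (quad_weight \<mu> 1 n k * q_fun \<mu> n (?x k)) * (poly W (?x k))\<^sup>2"
      by (simp add: power2_eq_square)
    moreover have "(poly W (?x k))\<^sup>2 > 0" using W0[OF k] by auto
    ultimately show ?thesis by (simp add: zero_le_mult_iff)
  qed
  have "quad_weight \<mu> 1 n j * q_fun \<mu> n (?x j) * poly R (?x j)
    \<le> (\<Sum>k\<in>{1..n}. quad_weight \<mu> 1 n k * q_fun \<mu> n (?x k) * poly R (?x k))"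
    using assms(2) pos nonneg by (intro member_le_sum) auto
  then show ?thesis using split[OF assms(3)] by simp
qed

lemma q_fun_pos: "x < a 2 \<Longrightarrow> q_fun \<mu> n x > 0"
  unfolding q_fun_eq using mop_zero_second[of _ n]
  by (intro prod_pos) (meson diff_gt_0_iff_gt greaterThanLessThan_iff less_trans)

end

section \<open>Orthonormal polynomials and the extremal property of Christoffel functions\<close>

lemma expand_in_graded_family:
  fixes p :: "nat \<Rightarrow> real poly"
  assumes "\<And>i. i < m \<Longrightarrow> degree (p i) = i \<and> p i \<noteq> 0" "r = 0 \<or> degree r < m"
  shows "\<exists>c. r = (\<Sum>i<m. smult (c i) (p i))"
  using assms
proof (induction m arbitrary: r)
  case 0
  then show ?case by auto
next
  case (Suc m)
  define e where "e = coeff r m / coeff (p m) m"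
  have pm: "degree (p m) = m" "coeff (p m) m \<noteq> 0"
    using Suc.prems(1)[of m] leading_coeff_0_iff[of "p m"] by auto
  have "coeff (r - smult e (p m)) i = 0" if "i \<ge> m" for i
  proof (cases "i = m")
    case True
    then show ?thesis using pm by (simp add: e_def)
  next
    case False
    then have "degree r < i" "degree (p m) < i" using that Suc.prems(2) pm(1) by auto
    then show ?thesis by (simp add: coeff_eq_0)
  qed
  then have "r - smult e (p m) = 0 \<or> degree (r - smult e (p m)) < m"
    by (metis leading_coeff_0_iff not_le)
  then obtain c where c: "r - smult e (p m) = (\<Sum>i<m. smult (c i) (p i))"
    using Suc.IH[of "r - smult e (p m)"] Suc.prems(1) by auto
  have "r = (\<Sum>i<Suc m. smult ((c(m := e)) i) (p i))"
    using c by (simp add: algebra_simps)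
  then show ?case by blast
qed

context interval_measure begin

definition inner :: "real poly \<Rightarrow> real poly \<Rightarrow> real" where
  "inner p q = (LINT x|\<mu>. poly p x * poly q x)"

lemma inner_commute: "inner p q = inner q p" by (simp add: inner_def mult.commute)

lemma inner_add_left: "inner (p + q) r = inner p r + inner q r"
  by (simp add: inner_def algebra_simps)

lemma inner_diff_left: "inner (p - q) r = inner p r - inner q r"
  by (simp add: inner_def algebra_simps)

lemma inner_smult_left: "inner (smult c p) r = c * inner p r"
  by (simp add: inner_def mult.assoc)

lemma inner_sum_left: "inner (\<Sum>i\<in>A. f i) r = (\<Sum>i\<in>A. inner (f i) r)"
  by (induction A rule: infinite_finite_induct) (auto simp: inner_add_left, auto simp: inner_def)

lemma inner_pos: "p \<noteq> 0 \<Longrightarrow> inner p p > 0"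
  using integral_poly_pos[of "p * p"] by (simp add: inner_def)

lemma inner_self_eq_0: "inner p p = 0 \<Longrightarrow> p = 0"
  using inner_pos[of p] by force

text \<open>Orthogonality to all polynomials of lower degree determines one member of the orthonormal
  sequence without reference to the others, so that existence and uniqueness can be shown for each degree
  separately.\<close>
definition is_orthonormal_poly :: "nat \<Rightarrow> real poly \<Rightarrow> bool" where
  "is_orthonormal_poly k p \<longleftrightarrow> degree p = k \<and> lead_coeff p > 0 \<and> inner p p = 1 \<and>
     (\<forall>r. r \<noteq> 0 \<longrightarrow> degree r < k \<longrightarrow> inner p r = 0)"

lemma orthonormal_poly_exists: "\<exists>p. is_orthonormal_poly k p"
proof (induction k rule: less_induct)
  case (less k)
  then obtain p where p: "\<And>i. i < k \<Longrightarrow> is_orthonormal_poly i (p i)" by metis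
  have pp: "inner (p i) (p j) = (if i = j then 1 else 0)" if "i < k" "j < k" for i j
  proof (cases i j rule: linorder_cases)
    case less
    have "p i \<noteq> 0" using p[OF that(1)] by (auto simp: is_orthonormal_poly_def)
    then have "inner (p j) (p i) = 0" using p[OF that(1)] p[OF that(2)] less
      by (auto simp: is_orthonormal_poly_def)
    then show ?thesis using less by (simp add: inner_commute)
  next
    case equal
    then show ?thesis using p[OF that(1)] by (simp add: is_orthonormal_poly_def)
  next
    case greater
    have "p j \<noteq> 0" using p[OF that(2)] by (auto simp: is_orthonormal_poly_def)
    then show ?thesis using p[OF that(1)] p[OF that(2)] greater
      by (auto simp: is_orthonormal_poly_def)
  qed
  define v where "v = monom 1 k - (\<Sum>i<k. smult (inner (monom 1 k) (p i)) (p i))"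
  have coeff_v: "coeff v i = (if i = k then 1 else 0)" if "i \<ge> k" for i
  proof -
    have "coeff (p j) i = 0" if "j < k" for j
      using p[OF that] \<open>i \<ge> k\<close> that by (auto simp: is_orthonormal_poly_def intro!: coeff_eq_0)
    then show ?thesis by (simp add: v_def coeff_sum)
  qed
  have degv: "degree v = k" "lead_coeff v = 1"
  proof -
    have "degree v \<le> k" using coeff_v by (intro degree_le) auto
    moreover have "degree v \<ge> k" using coeff_v[of k] by (intro le_degree) auto
    ultimately show "degree v = k" by simp
    then show "lead_coeff v = 1" using coeff_v by simp
  qed
  have vp: "inner v (p j) = 0" if "j < k" for j
  proof -
    have "inner v (p j) = inner (monom 1 k) (p j) -
      (\<Sum>i<k. inner (monom 1 k) (p i) * inner (p i) (p j))"
      unfolding v_def inner_diff_left inner_sum_left inner_smult_left ..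
    also have "(\<Sum>i<k. inner (monom 1 k) (p i) * inner (p i) (p j)) =
      (\<Sum>i<k. if i = j then inner (monom 1 k) (p i) else 0)"
      using that by (intro sum.cong refl) (simp add: pp)
    finally show ?thesis using that by simp
  qed
  have gp: "degree (p i) = i \<and> p i \<noteq> 0" if "i < k" for i
    using p[OF that] by (auto simp: is_orthonormal_poly_def)
  have "v \<noteq> 0" using degv by auto
  define c where "c = 1 / sqrt (inner v v)"
  have c: "c > 0" "c * c * inner v v = 1"
    using inner_pos[OF \<open>v \<noteq> 0\<close>] by (auto simp: c_def)
  have "is_orthonormal_poly k (smult c v)"
    unfolding is_orthonormal_poly_def
  proof (intro conjI allI impI)
    show "degree (smult c v) = k" "lead_coeff (smult c v) > 0" using c degv by auto
    show "inner (smult c v) (smult c v) = 1"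
      unfolding inner_smult_left using c(2) inner_commute[of v "smult c v"]
      unfolding inner_smult_left by simp
    show "inner (smult c v) r = 0" if r: "r \<noteq> 0" "degree r < k" for r
    proof -
      obtain d where d: "r = (\<Sum>i<k. smult (d i) (p i))"
        using expand_in_graded_family[of k p r] gp r by blast
      have "inner r v = (\<Sum>i<k. d i * inner v (p i))"
        unfolding d inner_sum_left inner_smult_left by (simp add: inner_commute[of v])
      also have "\<dots> = 0" using vp by simp
      finally show ?thesis unfolding inner_smult_left by (simp add: inner_commute)
    qed
  qed
  then show ?case by blast
qed

lemma orthonormal_poly_unique:
  assumes "is_orthonormal_poly k p" "is_orthonormal_poly k q"
  shows "p = q"
proof -
  define c where "c = lead_coeff p / lead_coeff q"
  have c: "c > 0" using assms by (auto simp: c_def is_orthonormal_poly_def)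
  have co: "coeff (p - smult c q) i = 0" if "i \<ge> k" for i
  proof (cases "i = k")
    case True
    have "coeff p k = c * coeff q k" using assms by (auto simp: is_orthonormal_poly_def c_def)
    with True show ?thesis by simp
  next
    case False
    then show ?thesis using assms that by (auto simp: is_orthonormal_poly_def coeff_eq_0)
  qed
  have eq: "p = smult c q"
  proof (rule ccontr)
    assume "p \<noteq> smult c q"
    then have nz: "p - smult c q \<noteq> 0" by simp
    then have deg: "degree (p - smult c q) < k"
      using co[of "degree (p - smult c q)"] by (meson leading_coeff_0_iff not_le)
    have "inner p (p - smult c q) = 0" "inner q (p - smult c q) = 0"
      using assms nz deg by (auto simp: is_orthonormal_poly_def)
    then have "inner (p - smult c q) (p - smult c q) = 0"
      unfolding inner_diff_left[of p "smult c q"] inner_smult_left by simp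
    then show False using inner_self_eq_0 nz by blast
  qed
  have "1 = inner p p" using assms by (simp add: is_orthonormal_poly_def)
  also have "\<dots> = c * (c * inner q q)"
    unfolding eq inner_smult_left using inner_commute[of q "smult c q"]
    unfolding inner_smult_left by simp
  finally have "c * c = 1" using assms by (simp add: is_orthonormal_poly_def)
  then have "c = 1" using c square_eq_1_iff[of c] by auto
  with eq show ?thesis by simp
qed

lemma orthonormal_polys:
  "is_orthonormal_poly k (orthonormal_polys \<mu> k)"
proof -
  let ?P = "\<lambda>p. (\<forall>k. degree (p k) = k \<and> lead_coeff (p k) > 0) \<and>
     (\<forall>j k. inner (p j) (p k) = (if j = k then 1 else 0))"
  obtain p where p: "\<And>k. is_orthonormal_poly k (p k)" using orthonormal_poly_exists by metis
  have nz: "p k \<noteq> 0" for k using p[of k] by (auto simp: is_orthonormal_poly_def)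
  have "inner (p j) (p k) = (if j = k then 1 else 0)" for j k
  proof (cases j k rule: linorder_cases)
    case less
    then have "inner (p k) (p j) = 0" using p[of j] p[of k] nz[of j] by (auto simp: is_orthonormal_poly_def)
    then show ?thesis using less by (simp add: inner_commute)
  next
    case equal
    then show ?thesis using p[of j] by (simp add: is_orthonormal_poly_def)
  next
    case greater
    then show ?thesis using p[of j] p[of k] nz[of k] by (auto simp: is_orthonormal_poly_def)
  qed
  moreover have "degree (p k) = k \<and> lead_coeff (p k) > 0" for k
    using p[of k] unfolding is_orthonormal_poly_def by blast
  ultimately have Pp: "?P p" by blast
  have uniq: "q = p" if q: "?P q" for q
  proof
    fix k
    have deg: "degree (q i) = i" and lead: "lead_coeff (q i) > 0" for i using q by blast+
    have ip: "inner (q i) (q j) = (if i = j then 1 else 0)" for i j using q by blast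
    have nz: "q i \<noteq> 0" for i using lead[of i] by auto
    have "is_orthonormal_poly k (q k)"
      unfolding is_orthonormal_poly_def
    proof (intro conjI allI impI)
      show "inner (q k) r = 0" if r: "r \<noteq> 0" "degree r < k" for r
      proof -
        obtain d where d: "r = (\<Sum>i<k. smult (d i) (q i))"
          using expand_in_graded_family[of k q r] deg nz r by blast
        have "inner r (q k) = (\<Sum>i<k. d i * inner (q i) (q k))"
          unfolding d inner_sum_left inner_smult_left ..
        also have "\<dots> = 0" by (intro sum.neutral) (auto simp: ip)
        finally show ?thesis by (simp add: inner_commute)
      qed
    qed (rule deg, rule lead, simp add: ip)
    then show "q k = p k" using p orthonormal_poly_unique by blast
  qed
  have "\<exists>!p. ?P p" by (rule ex1I[of ?P, OF Pp uniq])
  from theI'[OF this] have P: "?P (orthonormal_polys \<mu>)"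
    unfolding orthonormal_polys_def inner_def .
  from uniq[OF P] have "orthonormal_polys \<mu> = p" .
  then show ?thesis using p by simp
qed

lemma inner_orthonormal_polys:
  "inner (orthonormal_polys \<mu> j) (orthonormal_polys \<mu> k) = (if j = k then 1 else 0)"
proof -
  have nz: "orthonormal_polys \<mu> k \<noteq> 0" for k
    using orthonormal_polys[of k] by (auto simp: is_orthonormal_poly_def)
  show ?thesis
  proof (cases j k rule: linorder_cases)
    case less
    then have "inner (orthonormal_polys \<mu> k) (orthonormal_polys \<mu> j) = 0"
      using orthonormal_polys[of j] orthonormal_polys[of k] nz by (auto simp: is_orthonormal_poly_def)
    then show ?thesis using less by (simp add: inner_commute)
  next
    case equal
    then show ?thesis using orthonormal_polys[of j] by (simp add: is_orthonormal_poly_def)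
  next
    case greater
    then show ?thesis
      using orthonormal_polys[of j] orthonormal_polys[of k] nz by (auto simp: is_orthonormal_poly_def)
  qed
qed

lemma inner_orthonormal_expansion:
  "inner (\<Sum>k<m. smult (c k) (orthonormal_polys \<mu> k)) (\<Sum>k<m. smult (c k) (orthonormal_polys \<mu> k)) = (\<Sum>k<m. (c k)\<^sup>2)"
proof -
  let ?p = "orthonormal_polys \<mu>"
  let ?S = "\<Sum>k<m. smult (c k) (?p k)"
  have "inner ?S (?p j) = (if j < m then c j else 0)" for j
    unfolding inner_sum_left inner_smult_left inner_orthonormal_polys by (simp add: if_distrib cong: if_cong)
  then have "inner (?p j) ?S = (if j < m then c j else 0)" for j using inner_commute by metis
  then have "inner ?S ?S = (\<Sum>k<m. c k * (if k < m then c k else 0))"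
    by (subst inner_sum_left) (simp add: inner_smult_left)
  then show ?thesis by (simp add: power2_eq_square)
qed

lemma sum_orthonormal_polys_pos:
  assumes "m \<ge> 1"
  shows "(\<Sum>k<m. (poly (orthonormal_polys \<mu> k) x)\<^sup>2) > 0"
proof -
  have "degree (orthonormal_polys \<mu> 0) = 0" "lead_coeff (orthonormal_polys \<mu> 0) > 0"
    using orthonormal_polys[of 0] by (auto simp: is_orthonormal_poly_def)
  then have "poly (orthonormal_polys \<mu> 0) x > 0" by (auto elim!: degree_eq_zeroE)
  then have "0 < (poly (orthonormal_polys \<mu> 0) x)\<^sup>2" by simp
  also have "\<dots> \<le> (\<Sum>k<m. (poly (orthonormal_polys \<mu> k) x)\<^sup>2)"
    using assms by (intro member_le_sum) auto
  finally show ?thesis .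
qed

text \<open>The minimiser is the normalised reproducing kernel of the polynomials of degree less than
  \<open>m\<close>.\<close>
lemma christoffel_attained:
  assumes "m \<ge> 1"
  shows "\<exists>S. degree S < m \<and> poly S x = 1 \<and> (LINT t|\<mu>. (poly S t)\<^sup>2) = christoffel \<mu> m x"
proof -
  let ?p = "orthonormal_polys \<mu>"
  define s where "s = (\<Sum>k<m. (poly (?p k) x)\<^sup>2)"
  have s: "s > 0" using sum_orthonormal_polys_pos[OF assms] by (simp add: s_def)
  define S where "S = (\<Sum>k<m. smult (poly (?p k) x / s) (?p k))"
  have "poly S x = (\<Sum>k<m. (poly (?p k) x)\<^sup>2) / s"
    by (simp add: S_def poly_sum power2_eq_square sum_divide_distrib)
  then have 1: "poly S x = 1" using s by (simp add: s_def)
  have "degree S \<le> m - 1" unfolding S_def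
    using orthonormal_polys assms
    by (intro degree_sum_le) (auto simp: is_orthonormal_poly_def intro!: order_trans[OF degree_smult_le])
  then have 2: "degree S < m" using assms by linarith
  have "(LINT t|\<mu>. (poly S t)\<^sup>2) = inner S S" by (simp add: inner_def power2_eq_square)
  also have "\<dots> = (\<Sum>k<m. (poly (?p k) x / s)\<^sup>2)" unfolding S_def by (rule inner_orthonormal_expansion)
  also have "\<dots> = (\<Sum>k<m. (poly (?p k) x)\<^sup>2) / s\<^sup>2" by (simp add: power_divide sum_divide_distrib)
  also have "\<dots> = inverse s" using s unfolding s_def[symmetric] by (simp add: power2_eq_square field_simps)
  also have "\<dots> = christoffel \<mu> m x" by (simp add: christoffel_def s_def)
  finally show ?thesis using 1 2 by blast
qed

lemma christoffel_le:
  assumes "m \<ge> 1" "degree S < m" "poly S x = 1"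
  shows "christoffel \<mu> m x \<le> (LINT t|\<mu>. (poly S t)\<^sup>2)"
proof -
  let ?p = "orthonormal_polys \<mu>"
  define s where "s = (\<Sum>k<m. (poly (?p k) x)\<^sup>2)"
  have s: "s > 0" using sum_orthonormal_polys_pos[OF assms(1)] by (simp add: s_def)
  have "?p i \<noteq> 0 \<and> degree (?p i) = i" for i using orthonormal_polys[of i] by (auto simp: is_orthonormal_poly_def)
  then obtain c where c: "S = (\<Sum>k<m. smult (c k) (?p k))"
    using expand_in_graded_family[of m ?p S] assms(2) by auto
  have "1 = (\<Sum>k<m. c k * poly (?p k) x)" using assms(3) by (subst (asm) c) (simp add: poly_sum)
  then have "1 \<le> (\<Sum>k<m. (c k)\<^sup>2) * s"
    using Cauchy_Schwarz_ineq_sum[of c "\<lambda>k. poly (?p k) x" "{..<m}"] by (simp add: s_def)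
  also have "(\<Sum>k<m. (c k)\<^sup>2) = inner S S" unfolding c by (rule inner_orthonormal_expansion[symmetric])
  finally have "inverse s \<le> inner S S" using s by (simp add: field_simps)
  then show ?thesis by (simp add: christoffel_def s_def inner_def power2_eq_square)
qed

end

section \<open>Christoffel functions of a measure with bounded density\<close>

text \<open>The polynomial with value \<open>sin ((2 k + 1) \<phi>) / sin \<phi>\<close> at \<open>sin \<phi>\<close>. It is a Dirichlet kernel
  centred at \<open>0\<close>, in a variable that runs through \<open>[-1, 1]\<close>.\<close>
fun sine_quotient :: "nat \<Rightarrow> real poly" where
  "sine_quotient 0 = 1"
| "sine_quotient (Suc 0) = [:3, 0, -4:]"
| "sine_quotient (Suc (Suc k)) = [:2, 0, -4:] * sine_quotient (Suc k) - sine_quotient k"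

lemma sine_quotient_sin: "sin \<phi> * poly (sine_quotient k) (sin \<phi>) = sin (real (2 * k + 1) * \<phi>)"
proof (induction k rule: sine_quotient.induct)
  case 1
  then show ?case by simp
next
  case 2
  have "sin (3 * \<phi>) = sin (2 * \<phi> + \<phi>)" by simp
  also have "\<dots> = sin (2 * \<phi>) * cos \<phi> + cos (2 * \<phi>) * sin \<phi>" by (rule sin_add)
  also have "\<dots> = 2 * sin \<phi> * (1 - (sin \<phi>)\<^sup>2) + (1 - 2 * (sin \<phi>)\<^sup>2) * sin \<phi>"
    by (simp add: sin_double cos_double_sin power2_eq_square[symmetric] cos_squared_eq[symmetric])
  finally show ?case by (simp add: power2_eq_square algebra_simps)
next
  case (3 k)
  have c: "2 * cos (2 * \<phi>) = 2 - 4 * (sin \<phi>)\<^sup>2" by (simp add: cos_double_sin)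
  have a: "real (2 * Suc (Suc k) + 1) * \<phi> = real (2 * Suc k + 1) * \<phi> + 2 * \<phi>"
    "real (2 * k + 1) * \<phi> = real (2 * Suc k + 1) * \<phi> - 2 * \<phi>"
    by (simp_all add: algebra_simps)
  have "sin (real (2 * Suc (Suc k) + 1) * \<phi>) + sin (real (2 * k + 1) * \<phi>) =
    2 * cos (2 * \<phi>) * sin (real (2 * Suc k + 1) * \<phi>)"
    unfolding a sin_add sin_diff by simp
  then have "sin (real (2 * Suc (Suc k) + 1) * \<phi>) =
    (2 - 4 * (sin \<phi>)\<^sup>2) * (sin \<phi> * poly (sine_quotient (Suc k)) (sin \<phi>)) - sin \<phi> * poly (sine_quotient k) (sin \<phi>)"
    unfolding 3 c by simp
  then show ?case by (simp add: power2_eq_square algebra_simps)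
qed

lemma degree_sine_quotient: "degree (sine_quotient k) \<le> 2 * k"
proof (induction k rule: sine_quotient.induct)
  case (3 k)
  have "degree ([:2, 0, -4:] * sine_quotient (Suc k)) \<le> degree [:2, 0, -4::real:] + degree (sine_quotient (Suc k))"
    by (rule degree_mult_le)
  then show ?case using 3 by (auto intro!: degree_diff_le)
qed auto

lemma sine_quotient_0: "poly (sine_quotient k) 0 = real (2 * k + 1)"
  by (induction k rule: sine_quotient.induct) auto

lemma abs_sin_multiple_le: "\<bar>sin (real n * \<phi>)\<bar> \<le> real n * \<bar>sin \<phi>\<bar>"
proof (induction n)
  case (Suc n)
  have "\<bar>sin (real (Suc n) * \<phi>)\<bar> = \<bar>sin (real n * \<phi>) * cos \<phi> + cos (real n * \<phi>) * sin \<phi>\<bar>"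
    by (simp add: algebra_simps sin_add)
  also have "\<dots> \<le> \<bar>sin (real n * \<phi>)\<bar> * \<bar>cos \<phi>\<bar> + \<bar>cos (real n * \<phi>)\<bar> * \<bar>sin \<phi>\<bar>"
    by (metis abs_mult abs_triangle_ineq)
  also have "\<dots> \<le> \<bar>sin (real n * \<phi>)\<bar> * 1 + 1 * \<bar>sin \<phi>\<bar>"
    by (intro add_mono mult_mono) auto
  finally show ?case using Suc by (simp add: algebra_simps)
qed auto

lemma sine_quotient_bounds:
  assumes "\<bar>u\<bar> \<le> 1"
  shows "\<bar>u * poly (sine_quotient k) u\<bar> \<le> 1" "\<bar>poly (sine_quotient k) u\<bar> \<le> real (2 * k + 1)"
proof -
  have eq: "u * poly (sine_quotient k) u = sin (real (2 * k + 1) * arcsin u)"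
    using sine_quotient_sin[of "arcsin u" k] assms by simp
  then show "\<bar>u * poly (sine_quotient k) u\<bar> \<le> 1" by (simp del: of_nat_add of_nat_mult)
  show "\<bar>poly (sine_quotient k) u\<bar> \<le> real (2 * k + 1)"
  proof (cases "u = 0")
    case True
    then show ?thesis by (simp add: sine_quotient_0)
  next
    case False
    have "\<bar>u * poly (sine_quotient k) u\<bar> \<le> real (2 * k + 1) * \<bar>u\<bar>"
      unfolding eq using abs_sin_multiple_le[of "2 * k + 1" "arcsin u"] assms by simp
    then have "\<bar>u\<bar> * \<bar>poly (sine_quotient k) u\<bar> \<le> \<bar>u\<bar> * real (2 * k + 1)"
      by (simp add: abs_mult mult.commute)
    then show ?thesis using False by (simp del: of_nat_add of_nat_mult)
  qed
qed

lemma nn_integral_truncated_inverse_square: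
  fixes \<epsilon> :: real
  assumes "\<epsilon> > 0"
  shows "(\<integral>\<^sup>+ x. ennreal (min 1 (\<epsilon>\<^sup>2 / (x - c)\<^sup>2)) \<partial>lborel) \<le> ennreal (4 * \<epsilon>)"
proof -
  let ?f = "\<lambda>x. ennreal (min 1 (\<epsilon>\<^sup>2 / (x - c)\<^sup>2))"
  have right: "(\<integral>\<^sup>+ x. ennreal (\<epsilon>\<^sup>2 / (x - c)\<^sup>2) * indicator {c + \<epsilon>..} x \<partial>lborel) = ennreal (0 - (- \<epsilon>\<^sup>2 / (c + \<epsilon> - c)))"
  proof (rule nn_integral_FTC_atLeast)
    show "(\<lambda>x. \<epsilon>\<^sup>2 / (x - c)\<^sup>2) \<in> borel_measurable borel" by measurable
    show "((\<lambda>x. - \<epsilon>\<^sup>2 / (x - c)) has_real_derivative \<epsilon>\<^sup>2 / (x - c)\<^sup>2) (at x)" if "c + \<epsilon> \<le> x" for x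
      using that assms by (auto intro!: derivative_eq_intros simp: power2_eq_square)
    show "0 \<le> \<epsilon>\<^sup>2 / (x - c)\<^sup>2" for x by simp
    show "((\<lambda>x. - \<epsilon>\<^sup>2 / (x - c)) \<longlongrightarrow> 0) at_top"
    proof -
      have "filterlim (\<lambda>x. x - c) at_top at_top"
        unfolding filterlim_at_top
        by (intro allI, rule_tac c = "Z + c" in eventually_at_top_linorderI) auto
      then have "filterlim (\<lambda>x::real. x - c) at_infinity at_top"
        by (auto intro: filterlim_at_top_imp_at_infinity)
      then show ?thesis by (intro tendsto_divide_0[OF tendsto_const])
    qed
  qed
  have "(\<integral>\<^sup>+ x. ?f x \<partial>lborel) \<le> (\<integral>\<^sup>+ x. indicator {c - \<epsilon>..c + \<epsilon>} x +
      (ennreal (\<epsilon>\<^sup>2 / (x - c)\<^sup>2) * indicator {c + \<epsilon>..} x + ennreal (\<epsilon>\<^sup>2 / (x - c)\<^sup>2) * indicator {..c - \<epsilon>} x) \<partial>lborel)"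
  proof (intro nn_integral_mono)
    fix x
    consider "x \<in> {c - \<epsilon>..c + \<epsilon>}" | "x > c + \<epsilon>" | "x < c - \<epsilon>" by fastforce
    then show "?f x \<le> indicator {c - \<epsilon>..c + \<epsilon>} x +
      (ennreal (\<epsilon>\<^sup>2 / (x - c)\<^sup>2) * indicator {c + \<epsilon>..} x + ennreal (\<epsilon>\<^sup>2 / (x - c)\<^sup>2) * indicator {..c - \<epsilon>} x)"
    proof cases
      case 1
      have "?f x \<le> 1" by (simp add: ennreal_le_1)
      then show ?thesis using 1 by (simp add: add_increasing2)
    next
      case 2
      have "?f x \<le> ennreal (\<epsilon>\<^sup>2 / (x - c)\<^sup>2)" by (intro ennreal_leI) simp
      then show ?thesis using 2 assms by simp
    next
      case 3
      have "?f x \<le> ennreal (\<epsilon>\<^sup>2 / (x - c)\<^sup>2)" by (intro ennreal_leI) simp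
      then show ?thesis using 3 assms by simp
    qed
  qed
  also have "\<dots> = emeasure lborel {c - \<epsilon>..c + \<epsilon>} +
     ((\<integral>\<^sup>+ x. ennreal (\<epsilon>\<^sup>2 / (x - c)\<^sup>2) * indicator {c + \<epsilon>..} x \<partial>lborel) +
      (\<integral>\<^sup>+ x. ennreal (\<epsilon>\<^sup>2 / (x - c)\<^sup>2) * indicator {..c - \<epsilon>} x \<partial>lborel))"
    by (subst nn_integral_add, simp, simp, subst nn_integral_add) auto
  also have "(\<integral>\<^sup>+ x. ennreal (\<epsilon>\<^sup>2 / (x - c)\<^sup>2) * indicator {..c - \<epsilon>} x \<partial>lborel) =
    (\<integral>\<^sup>+ x. ennreal (\<epsilon>\<^sup>2 / (x - c)\<^sup>2) * indicator {c + \<epsilon>..} x \<partial>lborel)"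
    by (subst nn_integral_real_affine[where c = "-1" and t = "2 * c"])
      (auto intro!: nn_integral_cong simp: indicator_def power2_commute)
  also have "(\<integral>\<^sup>+ x. ennreal (\<epsilon>\<^sup>2 / (x - c)\<^sup>2) * indicator {c + \<epsilon>..} x \<partial>lborel) = ennreal \<epsilon>"
    unfolding right by (simp add: power2_eq_square)
  also have "emeasure lborel {c - \<epsilon>..c + \<epsilon>} + (ennreal \<epsilon> + ennreal \<epsilon>) = ennreal (4 * \<epsilon>)"
    using assms by (simp add: ennreal_plus[symmetric] del: ennreal_plus)
  finally show ?thesis .
qed

context interval_measure begin

text \<open>The test polynomial is a translated and normalised Dirichlet kernel of degree about \<open>m\<close>. Its
  square is at most \<open>min 1 (\<epsilon>\<^sup>2 / (t - x)\<^sup>2)\<close> with \<open>\<epsilon>\<close> of order \<open>1 / m\<close>. Near \<open>x\<close> the density bound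
  makes its integral \<open>O(\<epsilon>)\<close>, and at a fixed distance from \<open>x\<close> it is \<open>O(\<epsilon>\<^sup>2)\<close>, whatever the measure
  is there.\<close>
lemma christoffel_upper_bound:
  assumes "open U" "{c..d} \<subseteq> U" "abs_continuous_on \<mu> U" "is_ac_density \<mu> f"
    and M: "M > 0" "AE x in lborel. x \<in> U \<longrightarrow> f x \<le> M" and cd: "a \<le> c" "d \<le> b" "a < b"
  shows "\<exists>C>0. \<forall>m\<ge>1. \<forall>x\<in>{c..d}. christoffel \<mu> m x \<le> C / real m"
proof -
  have fm: "f \<in> borel_measurable borel" and f0: "\<And>x. f x \<ge> 0" using assms(4) by (auto simp: is_ac_density_def)
  obtain N where N: "N \<in> sets borel" "N \<in> null_sets lborel"
    "\<And>A. A \<in> sets borel \<Longrightarrow> emeasure \<mu> A = (\<integral>\<^sup>+ x\<in>A. ennreal (f x) \<partial>lborel) + emeasure \<mu> (A \<inter> N)"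
    using assms(4) by (auto simp: is_ac_density_def)
  have space: "space \<mu> = UNIV" using sets_eq_imp_space_eq[OF sets_borel] by simp
  have UN: "emeasure \<mu> (U \<inter> N) = 0"
  proof -
    have "U \<inter> N \<in> null_sets (restrict_space lborel U)"
      using N(1,2) assms(1) by (subst null_sets_restrict_space) (auto intro!: null_set_Int1)
    then have "U \<inter> N \<in> null_sets (restrict_space \<mu> U)"
      using assms(3) by (auto simp: abs_continuous_on_def absolutely_continuous_def)
    then have "U \<inter> N \<in> null_sets \<mu>"
      using assms(1) sets_borel by (subst (asm) null_sets_restrict_space) auto
    then show ?thesis by auto
  qed
  have on_U: "emeasure \<mu> A = (\<integral>\<^sup>+ x\<in>A. ennreal (f x) \<partial>lborel)" if "A \<in> sets borel" "A \<subseteq> U" for A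
  proof -
    have "emeasure \<mu> (A \<inter> N) \<le> emeasure \<mu> (U \<inter> N)"
      using that N(1) assms(1) sets_borel by (intro emeasure_mono) auto
    then show ?thesis using N(3)[OF that(1)] UN by simp
  qed
  have U [measurable]: "U \<in> sets borel" using assms(1) by simp
  have density_eq: "density \<mu> (indicator U) = density lborel (\<lambda>x. ennreal (f x) * indicator U x)"
  proof (rule measure_eqI)
    show "sets (density \<mu> (indicator U)) = sets (density lborel (\<lambda>x. ennreal (f x) * indicator U x))"
      using sets_borel by simp
    fix A assume "A \<in> sets (density \<mu> (indicator U))"
    then have A [measurable]: "A \<in> sets borel" using sets_borel by simp
    have "emeasure (density \<mu> (indicator U)) A = (\<integral>\<^sup>+ x. indicator U x * indicator A x \<partial>\<mu>)"
      using sets_borel by (intro emeasure_density) (auto cong: measurable_cong_sets)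
    also have "\<dots> = (\<integral>\<^sup>+ x. indicator (U \<inter> A) x \<partial>\<mu>)"
      by (intro nn_integral_cong) (simp add: indicator_inter_arith)
    also have "\<dots> = emeasure \<mu> (U \<inter> A)" using sets_borel by (intro nn_integral_indicator) auto
    also have "\<dots> = (\<integral>\<^sup>+ x\<in>U \<inter> A. ennreal (f x) \<partial>lborel)" by (intro on_U) auto
    also have "\<dots> = emeasure (density lborel (\<lambda>x. ennreal (f x) * indicator U x)) A"
      using fm by (subst emeasure_density) (auto simp: indicator_inter_arith mult.assoc)
    finally show "emeasure (density \<mu> (indicator U)) A = emeasure (density lborel (\<lambda>x. ennreal (f x) * indicator U x)) A" .
  qed
  have dom_int: "(\<integral>\<^sup>+ x\<in>U. g x \<partial>\<mu>) \<le> ennreal M * (\<integral>\<^sup>+ x. g x \<partial>lborel)" if [measurable]: "g \<in> borel_measurable borel" for g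
  proof -
    have gm: "g \<in> borel_measurable \<mu>" using that sets_borel by (simp cong: measurable_cong_sets)
    have "(\<integral>\<^sup>+ x\<in>U. g x \<partial>\<mu>) = (\<integral>\<^sup>+ x. indicator U x * g x \<partial>\<mu>)"
      by (intro nn_integral_cong) (simp add: mult.commute)
    also have "\<dots> = (\<integral>\<^sup>+ x. g x \<partial>density \<mu> (indicator U))"
      using gm sets_borel by (intro nn_integral_density[symmetric]) (auto cong: measurable_cong_sets)
    also have "\<dots> = (\<integral>\<^sup>+ x. (ennreal (f x) * indicator U x) * g x \<partial>lborel)"
      unfolding density_eq using fm by (intro nn_integral_density) auto
    also have "\<dots> \<le> (\<integral>\<^sup>+ x. ennreal M * g x \<partial>lborel)"
      using M(2) by (intro nn_integral_mono_AE) (auto split: split_indicator intro!: mult_right_mono ennreal_leI elim!: eventually_mono)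
    also have "\<dots> = ennreal M * (\<integral>\<^sup>+ x. g x \<partial>lborel)"
      by (intro nn_integral_cmult) auto
    finally show ?thesis .
  qed
  obtain \<rho> where \<rho>0: "\<rho> > 0" "(\<Union>x\<in>{c..d}. ball x \<rho>) \<subseteq> U"
    using compact_subset_open_imp_ball_epsilon_subset[OF compact_Icc assms(1,2)] by blast
  then have \<rho>: "\<rho> > 0" "\<And>x. x \<in> {c..d} \<Longrightarrow> ball x \<rho> \<subseteq> U" by blast+
  define L where "L = b - a"
  have L: "L > 0" using cd by (simp add: L_def)
  define C where "C = 4 * (M * (4 * L) + measure \<mu> UNIV * (L\<^sup>2 / \<rho>\<^sup>2))"
  have "C > 0" using M(1) L by (auto simp: C_def intro!: add_pos_nonneg)
  moreover have "christoffel \<mu> m x \<le> C / real m" if m: "m \<ge> 1" and x: "x \<in> {c..d}" for m x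
  proof -
    define k where "k = (m - 1) div 2"
    define K where "K = real (2 * k + 1)"
    have K: "K \<ge> 1" "real m \<le> 2 * K" using m by (auto simp: K_def k_def)
    \<comment> \<open>with the scaling \<open>L\<close>, points of the interval are mapped to \<open>[-1, 1]\<close> and \<open>x\<close> to \<open>0\<close>\<close>
    define S where "S = smult (1 / K) (pcompose (sine_quotient k) [:- x / L, 1 / L:])"
    have S: "poly S t = poly (sine_quotient k) ((t - x) / L) / K" for t
      by (simp add: S_def poly_pcompose diff_divide_distrib)
    have "poly S x = 1" using K by (simp add: S sine_quotient_0 K_def)
    moreover have "degree S < m"
    proof -
      have "degree S \<le> degree (sine_quotient k)"
        using degree_pcompose_le[of "sine_quotient k" "[:- x / L, 1 / L:]"] L by (simp add: S_def)
      then have "degree S \<le> 2 * k" using degree_sine_quotient[of k] by simp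
      also have "\<dots> < m" using m by (auto simp: k_def)
      finally show ?thesis .
    qed
    ultimately have "christoffel \<mu> m x \<le> (LINT t|\<mu>. (poly S t)\<^sup>2)" using m by (intro christoffel_le)
    also have "\<dots> \<le> C / real m"
    proof -
      define \<epsilon> where "\<epsilon> = L / K"
      have \<epsilon>: "\<epsilon> > 0" using L K by (simp add: \<epsilon>_def)
      have bound: "(poly S t)\<^sup>2 \<le> min 1 (\<epsilon>\<^sup>2 / (t - x)\<^sup>2)" if "t \<in> {a..b}" "t \<noteq> x" for t
      proof -
        define u where "u = (t - x) / L"
        have "\<bar>t - x\<bar> \<le> L" using that x cd by (auto simp: L_def)
        then have u: "\<bar>u\<bar> \<le> 1" using L by (simp add: u_def)
        have "u \<noteq> 0" using that L by (simp add: u_def)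
        have "\<bar>poly (sine_quotient k) u\<bar> \<le> K" unfolding K_def by (rule sine_quotient_bounds(2)[OF u])
        then have "\<bar>poly S t\<bar> \<le> 1" using K by (simp add: S u_def[symmetric])
        then have 1: "(poly S t)\<^sup>2 \<le> 1" by (simp add: abs_square_le_1)
        have "\<bar>u * poly S t\<bar> \<le> 1 / K" using sine_quotient_bounds(1)[OF u, of k] K
          by (simp add: S u_def[symmetric] abs_mult divide_right_mono)
        then have "(u * poly S t)\<^sup>2 \<le> (1 / K)\<^sup>2" by (metis abs_le_square_iff abs_of_nonneg K(1) divide_nonneg_nonneg le_numeral_extra(4) order_trans zero_le_one)
        then have "(poly S t)\<^sup>2 \<le> (1 / K)\<^sup>2 / u\<^sup>2" using \<open>u \<noteq> 0\<close>
          by (simp add: pos_le_divide_eq power_mult_distrib mult.commute)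
        also have "\<dots> = \<epsilon>\<^sup>2 / (t - x)\<^sup>2" using L K by (simp add: u_def \<epsilon>_def power_divide)
        finally show ?thesis using 1 by simp
      qed

      have Cm: "M * (4 * \<epsilon>) + measure \<mu> UNIV * (\<epsilon>\<^sup>2 / \<rho>\<^sup>2) \<le> C / real m"
      proof -
        have "1 / K \<le> 2 / real m" using K m by (simp add: field_simps)
        have "\<epsilon>\<^sup>2 \<le> L\<^sup>2 / K" using K L by (simp add: \<epsilon>_def power_divide power2_eq_square field_simps mult_left_mono)
        then have "measure \<mu> UNIV * (\<epsilon>\<^sup>2 / \<rho>\<^sup>2) \<le> measure \<mu> UNIV * ((L\<^sup>2 / K) / \<rho>\<^sup>2)"
          by (intro mult_left_mono divide_right_mono) auto
        then have "M * (4 * \<epsilon>) + measure \<mu> UNIV * (\<epsilon>\<^sup>2 / \<rho>\<^sup>2) \<le>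
            M * (4 * \<epsilon>) + measure \<mu> UNIV * ((L\<^sup>2 / K) / \<rho>\<^sup>2)"
          by simp
        also have "\<dots> = (C / 4) * (1 / K)"
          using K \<rho>(1) by (simp add: C_def \<epsilon>_def field_simps)
        also have "\<dots> \<le> (C / 4) * (2 / real m)" using \<open>C > 0\<close> \<open>1 / K \<le> 2 / real m\<close> by (intro mult_left_mono) auto
        also have "\<dots> \<le> C / real m" using \<open>C > 0\<close> m by (simp add: field_simps)
        finally show ?thesis .
      qed
      have Sm: "(\<lambda>t. (poly S t)\<^sup>2) \<in> borel_measurable \<mu>"
        by (intro measurable_continuous continuous_intros)
      have Ums: "U \<in> sets \<mu>" using assms(1) sets_borel by simp
      have x0: "emeasure \<mu> {x} = 0"
      proof -
        have "x \<in> U" using x assms(2) by auto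
        then have "emeasure \<mu> {x} = (\<integral>\<^sup>+ t\<in>{x}. ennreal (f t) \<partial>lborel)" by (intro on_U) auto
        also have "\<dots> = 0" by (intro nn_integral_null_set) (auto simp: null_sets_def)
        finally show ?thesis .
      qed
      have "(\<integral>\<^sup>+ t. ennreal ((poly S t)\<^sup>2) \<partial>\<mu>) \<le>
        (\<integral>\<^sup>+ t. ennreal (min 1 (\<epsilon>\<^sup>2 / (t - x)\<^sup>2)) * indicator U t + ennreal (\<epsilon>\<^sup>2 / \<rho>\<^sup>2) \<partial>\<mu>)"
      proof (intro nn_integral_mono_AE)
        have "AE t in \<mu>. t \<noteq> x" using x0 sets_borel by (intro AE_I[of _ _ "{x}"]) (auto simp: space)
        then show "AE t in \<mu>. ennreal ((poly S t)\<^sup>2) \<le> ennreal (min 1 (\<epsilon>\<^sup>2 / (t - x)\<^sup>2)) * indicator U t + ennreal (\<epsilon>\<^sup>2 / \<rho>\<^sup>2)"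
          using AE_interval
        proof eventually_elim
          case (elim t)
          show ?case
          proof (cases "t \<in> U")
            case True
            then show ?thesis using bound[of t] elim
              by (simp add: add_increasing2 ennreal_leI)
          next
            case False
            then have "t \<notin> ball x \<rho>" using \<rho>(2)[OF x] by blast
            then have "\<bar>t - x\<bar> \<ge> \<rho>" by (simp add: dist_real_def abs_minus_commute)
            then have "\<rho>\<^sup>2 \<le> (t - x)\<^sup>2" using \<rho>(1) by (metis abs_le_square_iff abs_of_pos)
            then have "\<epsilon>\<^sup>2 / (t - x)\<^sup>2 \<le> \<epsilon>\<^sup>2 / \<rho>\<^sup>2" using \<rho>(1) by (intro frac_le) auto
            then show ?thesis using bound[of t] elim False by (auto intro!: ennreal_leI)
          qed
        qed
      qed
      also have "\<dots> = (\<integral>\<^sup>+ t\<in>U. ennreal (min 1 (\<epsilon>\<^sup>2 / (t - x)\<^sup>2)) \<partial>\<mu>) + ennreal (\<epsilon>\<^sup>2 / \<rho>\<^sup>2) * emeasure \<mu> (space \<mu>)"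
        using sets_borel Ums
        by (subst nn_integral_add) (auto cong: measurable_cong_sets)
      also have "\<dots> \<le> ennreal M * ennreal (4 * \<epsilon>) + ennreal (\<epsilon>\<^sup>2 / \<rho>\<^sup>2) * ennreal (measure \<mu> UNIV)"
      proof (intro add_mono order_refl)
        have "(\<integral>\<^sup>+ t\<in>U. ennreal (min 1 (\<epsilon>\<^sup>2 / (t - x)\<^sup>2)) \<partial>\<mu>) \<le> ennreal M * (\<integral>\<^sup>+ t. ennreal (min 1 (\<epsilon>\<^sup>2 / (t - x)\<^sup>2)) \<partial>lborel)"
          by (intro dom_int) measurable
        also have "\<dots> \<le> ennreal M * ennreal (4 * \<epsilon>)"
          by (intro mult_left_mono nn_integral_truncated_inverse_square \<epsilon>) auto
        finally show "(\<integral>\<^sup>+ t\<in>U. ennreal (min 1 (\<epsilon>\<^sup>2 / (t - x)\<^sup>2)) \<partial>\<mu>) \<le> ennreal M * ennreal (4 * \<epsilon>)" .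
        show "ennreal (\<epsilon>\<^sup>2 / \<rho>\<^sup>2) * emeasure \<mu> (space \<mu>) \<le> ennreal (\<epsilon>\<^sup>2 / \<rho>\<^sup>2) * ennreal (measure \<mu> UNIV)"
          by (simp add: space emeasure_eq_measure)
      qed
      also have "\<dots> = ennreal (M * (4 * \<epsilon>) + measure \<mu> UNIV * (\<epsilon>\<^sup>2 / \<rho>\<^sup>2))"
        using M(1) \<epsilon> \<rho> by (simp add: ennreal_mult[symmetric] ennreal_plus[symmetric] mult.commute del: ennreal_plus)
      also have "\<dots> \<le> ennreal (C / real m)" using Cm by (rule ennreal_leI)
      finally have "ennreal (LINT t|\<mu>. (poly S t)\<^sup>2) \<le> ennreal (C / real m)"
        by (subst nn_integral_eq_integral[symmetric]) (auto intro!: integrable_continuous continuous_intros)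
      then show ?thesis using \<open>C > 0\<close> m by (subst (asm) ennreal_le_iff) auto
    qed
    finally show ?thesis .
  qed
  ultimately show ?thesis by blast
qed

end

section \<open>Logarithmic means over intervals\<close>

text \<open>At \<open>0\<close> the value is \<open>0\<close>, the limit, because of the factor \<open>z\<close>.\<close>
definition xlnx :: "real \<Rightarrow> real" where
  "xlnx z = z * ln \<bar>z\<bar>"

text \<open>The mean of \<open>ln \<bar>x - t\<bar>\<close> over \<open>x\<close> in \<open>{c..d}\<close>, in closed form. It serves as a
  regularisation of the logarithm that is continuous in \<open>t\<close>.\<close>
definition log_mean :: "real \<Rightarrow> real \<Rightarrow> real \<Rightarrow> real" where
  "log_mean c d t = (xlnx (d - t) - xlnx (c - t)) / (d - c) - 1"

lemma xlnx_minus [simp]: "xlnx (- z) = - xlnx z" by (simp add: xlnx_def)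

lemma xlnx_0 [simp]: "xlnx 0 = 0" by (simp add: xlnx_def)

lemma abs_xlnx_le:
  assumes "\<bar>z\<bar> \<le> 1"
  shows "\<bar>xlnx z\<bar> \<le> 2 * sqrt \<bar>z\<bar>"
proof (cases "z = 0")
  case False
  have "ln (1 / sqrt \<bar>z\<bar>) \<le> 1 / sqrt \<bar>z\<bar> - 1"
    using False by (intro ln_le_minus_one) auto
  then have "- ln \<bar>z\<bar> \<le> 2 / sqrt \<bar>z\<bar>"
    using False by (simp add: ln_div ln_sqrt)
  then have "\<bar>z\<bar> * (- ln \<bar>z\<bar>) \<le> \<bar>z\<bar> * (2 / sqrt \<bar>z\<bar>)" by (intro mult_left_mono) auto
  also have "\<dots> = 2 * (\<bar>z\<bar> / sqrt \<bar>z\<bar>)" by simp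
  also have "\<bar>z\<bar> / sqrt \<bar>z\<bar> = sqrt \<bar>z\<bar>" by (rule real_div_sqrt) auto
  finally show ?thesis using False assms by (simp add: xlnx_def abs_mult)
qed simp

lemma isCont_xlnx: "isCont xlnx z"
proof (cases "z = 0")
  case True
  have "((\<lambda>z. 2 * sqrt \<bar>z\<bar>) \<longlongrightarrow> 2 * sqrt \<bar>0 :: real\<bar>) (at 0)"
    by (intro tendsto_intros)
  then have lim: "((\<lambda>z::real. 2 * sqrt \<bar>z\<bar>) \<longlongrightarrow> 0) (at 0)" by simp
  have "eventually (\<lambda>z::real. norm (xlnx z) \<le> 2 * sqrt \<bar>z\<bar>) (at 0)"
    unfolding eventually_at by (intro exI[of _ 1]) (auto simp: dist_real_def intro!: abs_xlnx_le)
  from Lim_null_comparison[OF this lim] show ?thesis by (simp add: True isCont_def)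
next
  case False
  then show ?thesis unfolding xlnx_def by (intro continuous_intros) auto
qed

lemma continuous_on_xlnx [continuous_intros]:
  "continuous_on A f \<Longrightarrow> continuous_on A (\<lambda>x. xlnx (f x))"
  using isCont_xlnx continuous_at_imp_continuous_on[of UNIV xlnx]
  by (auto intro: continuous_on_compose2)

lemma continuous_on_log_mean: "continuous_on A (log_mean c d)"
  unfolding log_mean_def[abs_def] divide_inverse by (intro continuous_intros)

lemma has_integral_ln_abs:
  assumes "c < d"
  shows "((\<lambda>x. ln \<bar>x - t\<bar>) has_integral ((d - c) * log_mean c d t)) {c..d}"
proof -
  have "((\<lambda>x. ln \<bar>x - t\<bar>) has_integral
    ((xlnx (d - t) - (d - t)) - (xlnx (c - t) - (c - t)))) {c..d}"
  proof (rule fundamental_theorem_of_calculus_interior_strong[of "{t}"])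
    show "continuous_on {c..d} (\<lambda>x. xlnx (x - t) - (x - t))" by (intro continuous_intros)
    fix x assume "x \<in> {c<..<d} - {t}"
    then have x: "x \<noteq> t" by auto
    have "((\<lambda>x. (x - t) * ln \<bar>x - t\<bar> - (x - t)) has_real_derivative ln \<bar>x - t\<bar>) (at x)"
    proof (cases "x < t")
      case True
      have "((\<lambda>x. (x - t) * ln (t - x) - (x - t)) has_real_derivative
          1 * ln (t - x) + (-1 / (t - x)) * (x - t) - 1) (at x)"
        using True by (auto intro!: derivative_eq_intros)
      also have "1 * ln (t - x) + (-1 / (t - x)) * (x - t) - 1 = ln (t - x)"
        using True by (simp add: divide_simps)
      finally have "((\<lambda>x. (x - t) * ln (t - x) - (x - t)) has_real_derivative ln (t - x)) (at x)" .
      moreover have "eventually (\<lambda>y. y \<in> {..<t}) (nhds x)" using True by (intro eventually_nhds_in_open) auto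
      then have "eventually (\<lambda>y. (y - t) * ln (t - y) - (y - t) = (y - t) * ln \<bar>y - t\<bar> - (y - t)) (nhds x)"
        by eventually_elim auto
      ultimately show ?thesis using True by (subst (asm) DERIV_cong_ev[OF refl _ refl]) auto
    next
      case False
      with x have "x > t" by simp
      have "((\<lambda>x. (x - t) * ln (x - t) - (x - t)) has_real_derivative
          1 * ln (x - t) + (1 / (x - t)) * (x - t) - 1) (at x)"
        using \<open>x > t\<close> by (auto intro!: derivative_eq_intros)
      also have "1 * ln (x - t) + (1 / (x - t)) * (x - t) - 1 = ln (x - t)"
        using \<open>x > t\<close> by simp
      finally have "((\<lambda>x. (x - t) * ln (x - t) - (x - t)) has_real_derivative ln (x - t)) (at x)" .
      moreover have "eventually (\<lambda>y. y \<in> {t<..}) (nhds x)" using \<open>x > t\<close> by (intro eventually_nhds_in_open) auto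
      then have "eventually (\<lambda>y. (y - t) * ln (y - t) - (y - t) = (y - t) * ln \<bar>y - t\<bar> - (y - t)) (nhds x)"
        by eventually_elim auto
      ultimately show ?thesis using \<open>x > t\<close> by (subst (asm) DERIV_cong_ev[OF refl _ refl]) auto
    qed
    then show "((\<lambda>x. xlnx (x - t) - (x - t)) has_vector_derivative ln \<bar>x - t\<bar>) (at x)"
      by (simp add: xlnx_def has_real_derivative_iff_has_vector_derivative)
  qed (use assms in auto)
  also have "(xlnx (d - t) - (d - t)) - (xlnx (c - t) - (c - t)) = (d - c) * log_mean c d t"
    using assms by (simp add: log_mean_def field_simps)
  finally show ?thesis .
qed

lemma log_mean_upper:
  assumes "c < d" "\<And>x. x \<in> {c..d} \<Longrightarrow> x \<noteq> t \<Longrightarrow> ln \<bar>x - t\<bar> \<le> M"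
  shows "log_mean c d t \<le> M"
proof -
  have "((\<lambda>x. if x = t then M else ln \<bar>x - t\<bar>) has_integral ((d - c) * log_mean c d t)) {c..d}"
    by (rule has_integral_spike_finite[OF _ _ has_integral_ln_abs[OF assms(1)], of "{t}"]) auto
  moreover have "((\<lambda>_. M) has_integral ((d - c) * M)) {c..d}"
    using has_integral_const_real[of M c d] assms(1) by simp
  ultimately have "(d - c) * log_mean c d t \<le> (d - c) * M"
    by (rule has_integral_le) (use assms(2) in auto)
  then show ?thesis using assms(1) by simp
qed

lemma log_mean_lower:
  assumes "c < d" "\<And>x. x \<in> {c..d} \<Longrightarrow> x \<noteq> t \<Longrightarrow> ln \<bar>x - t\<bar> \<ge> M"
  shows "log_mean c d t \<ge> M"
proof -
  have a: "((\<lambda>x. if x = t then M else ln \<bar>x - t\<bar>) has_integral ((d - c) * log_mean c d t)) {c..d}"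
    by (rule has_integral_spike_finite[OF _ _ has_integral_ln_abs[OF assms(1)], of "{t}"]) auto
  have b: "((\<lambda>_. M) has_integral ((d - c) * M)) {c..d}"
    using has_integral_const_real[of M c d] assms(1) by simp
  have "(d - c) * M \<le> (d - c) * log_mean c d t"
    by (rule has_integral_le[OF b a]) (use assms(2) in auto)
  then show ?thesis using assms(1) by simp
qed

lemma xlnx_tangent: "z \<ge> 0 \<Longrightarrow> h > 0 \<Longrightarrow> xlnx z \<ge> z * ln h + z - h"
proof (cases "z = 0")
  case False
  assume z: "z \<ge> 0" "h > 0"
  with False have "ln (h / z) \<le> h / z - 1" by (intro ln_le_minus_one) auto
  then have "z * ln (h / z) \<le> z * (h / z - 1)" using z by (intro mult_left_mono) auto
  then show ?thesis using z False by (simp add: xlnx_def ln_div algebra_simps)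
qed auto

lemma log_mean_ge:
  assumes "h > 0"
  shows "log_mean c (c + h) t \<ge> ln h - 2"
proof -
  have *: "xlnx (h + z) - xlnx z \<ge> h * ln h - h" if "z \<ge> 0" for z
  proof (cases "z = 0")
    case False
    have a: "z * ln z \<le> z * ln (h + z)" using that False assms by (intro mult_left_mono) auto
    have b: "h * ln h \<le> h * ln (h + z)" using that assms by (intro mult_left_mono) auto
    have "xlnx (h + z) - xlnx z = h * ln (h + z) + z * ln (h + z) - z * ln z"
      using that assms by (simp add: xlnx_def distrib_right)
    then show ?thesis using a b assms by linarith
  qed (use assms in \<open>auto simp: xlnx_def\<close>)
  have "xlnx (c + h - t) - xlnx (c - t) \<ge> h * ln h - h"
  proof -
    consider "t \<le> c" | "c < t" "t < c + h" | "t \<ge> c + h" by linarith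
    then show ?thesis
    proof cases
      case 1
      have e: "h + (c - t) = c + h - t" by simp
      show ?thesis using 1 *[of "c - t"] unfolding e by simp
    next
      case 2
      then have "xlnx (c + h - t) \<ge> (c + h - t) * ln h + (c + h - t) - h" "xlnx (t - c) \<ge> (t - c) * ln h + (t - c) - h"
        using assms by (intro xlnx_tangent; simp)+
      moreover have "xlnx (c - t) = - xlnx (t - c)" using xlnx_minus[of "t - c"] by simp
      moreover have "(c + h - t) * ln h + (t - c) * ln h = h * ln h" by (simp add: algebra_simps)
      ultimately show ?thesis by linarith
    next
      case 3
      have e: "h + (t - c - h) = t - c" by simp
      have "xlnx (c - t) = - xlnx (t - c)" using xlnx_minus[of "t - c"] by simp
      moreover have e2: "c + h - t = - (t - c - h)" by simp
      have "xlnx (c + h - t) = - xlnx (t - c - h)" unfolding e2 by (rule xlnx_minus)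
      ultimately show ?thesis using 3 *[of "t - c - h"] unfolding e by simp
    qed
  qed
  then have "(h * ln h - h) / h \<le> (xlnx (c + h - t) - xlnx (c - t)) / h"
    using assms by (intro divide_right_mono) auto
  then show ?thesis using assms by (simp add: log_mean_def diff_divide_distrib)
qed

lemma log_mean_ends:
  assumes "\<alpha> < \<beta>"
  shows "log_mean \<alpha> \<beta> \<alpha> = ln (\<beta> - \<alpha>) - 1" "log_mean \<alpha> \<beta> \<beta> = ln (\<beta> - \<alpha>) - 1"
proof -
  show "log_mean \<alpha> \<beta> \<alpha> = ln (\<beta> - \<alpha>) - 1" using assms by (simp add: log_mean_def xlnx_def)
  have "xlnx (\<alpha> - \<beta>) = - xlnx (\<beta> - \<alpha>)" using xlnx_minus[of "\<beta> - \<alpha>"] by simp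
  then show "log_mean \<alpha> \<beta> \<beta> = ln (\<beta> - \<alpha>) - 1" using assms by (simp add: log_mean_def xlnx_def)
qed

text \<open>The mean over an interval of the logarithmic distance is largest, among the points of the
  interval, at its ends. This is why moving mass to the ends of a gap does not lower the mean over the
  gap.\<close>
lemma log_mean_le_ends:
  assumes "\<alpha> < \<beta>" "t \<in> {\<alpha>..\<beta>}"
  shows "log_mean \<alpha> \<beta> t \<le> ln (\<beta> - \<alpha>) - 1"
proof -
  have *: "xlnx z \<le> z * ln (\<beta> - \<alpha>)" if "0 \<le> z" "z \<le> \<beta> - \<alpha>" for z
    using that by (cases "z = 0") (auto simp: xlnx_def intro!: mult_left_mono)
  have "xlnx (\<beta> - t) + xlnx (t - \<alpha>) \<le> (\<beta> - t) * ln (\<beta> - \<alpha>) + (t - \<alpha>) * ln (\<beta> - \<alpha>)"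
    using assms by (intro add_mono *) auto
  then have "xlnx (\<beta> - t) - xlnx (\<alpha> - t) \<le> (\<beta> - \<alpha>) * ln (\<beta> - \<alpha>)"
    using xlnx_minus[of "t - \<alpha>"] by (simp add: algebra_simps)
  then have "(xlnx (\<beta> - t) - xlnx (\<alpha> - t)) / (\<beta> - \<alpha>) \<le> ln (\<beta> - \<alpha>)"
    using assms by (simp add: pos_divide_le_eq mult.commute)
  then show ?thesis by (simp add: log_mean_def)
qed

lemma log_mean_translate: "log_mean (c + v) (d + v) (t + v) = log_mean c d t"
  by (simp add: log_mean_def)

text \<open>The logarithm is concave on either side of \<open>t\<close>.\<close>
lemma second_difference_log_mean:
  assumes "\<eta> > 0" "t < c \<or> t > c + 3 * \<eta>"
  shows "log_mean c (c + \<eta>) t - 2 * log_mean (c + \<eta>) (c + 2 * \<eta>) t + log_mean (c + 2 * \<eta>) (c + 3 * \<eta>) t \<le> 0"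
proof -
  have e1: "log_mean (c + \<eta>) (c + 2 * \<eta>) t = log_mean c (c + \<eta>) (t - \<eta>)"
    using log_mean_translate[of c \<eta> "c + \<eta>" "t - \<eta>"] by (simp add: algebra_simps)
  have e2: "log_mean (c + 2 * \<eta>) (c + 3 * \<eta>) t = log_mean c (c + \<eta>) (t - 2 * \<eta>)"
    using log_mean_translate[of c "2 * \<eta>" "c + \<eta>" "t - 2 * \<eta>"] by (simp add: algebra_simps)
  have i: "((\<lambda>x. ln \<bar>x - t\<bar>) has_integral \<eta> * log_mean c (c + \<eta>) t) {c..c + \<eta>}" for t
    using has_integral_ln_abs[of c "c + \<eta>" t] assms by simp
  have "((\<lambda>x. ln \<bar>x - t\<bar> - 2 * ln \<bar>x - (t - \<eta>)\<bar> + ln \<bar>x - (t - 2 * \<eta>)\<bar>) has_integral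
    (\<eta> * log_mean c (c + \<eta>) t - 2 * (\<eta> * log_mean c (c + \<eta>) (t - \<eta>)) + \<eta> * log_mean c (c + \<eta>) (t - 2 * \<eta>))) {c..c + \<eta>}"
    by (intro has_integral_add has_integral_diff has_integral_mult_right i)
  then have "\<eta> * log_mean c (c + \<eta>) t - 2 * (\<eta> * log_mean c (c + \<eta>) (t - \<eta>)) + \<eta> * log_mean c (c + \<eta>) (t - 2 * \<eta>) \<le> 0"
  proof (rule has_integral_le[OF _ has_integral_0])
    fix x assume x: "x \<in> {c..c + \<eta>}"
    define s where "s = \<bar>x - t\<bar>"
    define u where "u = \<bar>x - (t - \<eta>)\<bar>"
    define v where "v = \<bar>x - (t - 2 * \<eta>)\<bar>"
    have pos: "s > 0" "u > 0" "v > 0" using assms x by (auto simp: s_def u_def v_def)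
    have "s * v = \<bar>(x - t) * (x - (t - 2 * \<eta>))\<bar>" by (simp add: s_def v_def abs_mult)
    also have "(x - t) * (x - (t - 2 * \<eta>)) = (x - (t - \<eta>))\<^sup>2 - \<eta>\<^sup>2" by (simp add: power2_eq_square algebra_simps)
    also have "\<bar>\<dots>\<bar> \<le> u\<^sup>2"
    proof -
      have "\<eta> \<le> u" using assms x by (auto simp: u_def)
      then have "\<eta>\<^sup>2 \<le> u\<^sup>2" using assms by (intro power_mono) auto
      then show ?thesis by (simp add: u_def)
    qed
    finally have "ln (s * v) \<le> ln (u\<^sup>2)" using pos by (subst ln_le_cancel_iff) auto
    then show "ln \<bar>x - t\<bar> - 2 * ln \<bar>x - (t - \<eta>)\<bar> + ln \<bar>x - (t - 2 * \<eta>)\<bar> \<le> 0"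
      unfolding s_def[symmetric] u_def[symmetric] v_def[symmetric]
      using pos by (simp add: ln_mult ln_realpow)
  qed
  then have "\<eta> * (log_mean c (c + \<eta>) t - 2 * log_mean c (c + \<eta>) (t - \<eta>) + log_mean c (c + \<eta>) (t - 2 * \<eta>)) \<le> 0"
    by (simp add: algebra_simps)
  then show ?thesis unfolding e1 e2 using assms by (simp add: mult_le_0_iff)
qed

text \<open>The term \<open>2 h\<close> absorbs the displacement of zeros by the grid. Far from \<open>x\<close> it costs an
  error of \<open>O(1 / K)\<close>; near \<open>x\<close> the error is bounded, and it will be multiplied by the small mass of
  a short interval.\<close>
lemma smoothed_log_le_log_mean:
  assumes h: "h > 0" and K: "K \<ge> 2"
  shows "ln (\<bar>x - t\<bar> + 2 * h) \<le> log_mean x (x + h) t + 3 / (K - 1) +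
    (ln (K + 2) + 2) * indicator {x - K * h..x + K * h} t"
proof (cases "t \<in> {x - K * h..x + K * h}")
  case True
  have "\<bar>x - t\<bar> + 2 * h \<le> (K + 2) * h" using True by (auto simp: algebra_simps abs_le_iff)
  then have "ln (\<bar>x - t\<bar> + 2 * h) \<le> ln ((K + 2) * h)" using h by (subst ln_le_cancel_iff) auto
  also have "\<dots> = ln (K + 2) + ln h" using h K by (simp add: ln_mult)
  also have "ln h \<le> log_mean x (x + h) t + 2" using log_mean_ge[OF h, of x t] by simp
  finally have "ln (\<bar>x - t\<bar> + 2 * h) \<le> log_mean x (x + h) t + (ln (K + 2) + 2)" by simp
  moreover have "0 \<le> 3 / (K - 1)" using K by simp
  moreover have ind: "indicator {x - K * h..x + K * h} t = (1 :: real)" using True by simp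
  ultimately show ?thesis unfolding ind mult_1_right by linarith
next
  case False
  then have far: "\<bar>x - t\<bar> > K * h" by (auto simp: algebra_simps)
  have Kh: "K * h \<ge> 2 * h" using K h by simp
  define u where "u = \<bar>x - t\<bar> - h"
  have "(K - 1) * h = K * h - h" by (simp add: algebra_simps)
  then have u: "u \<ge> (K - 1) * h" "u > 0" unfolding u_def using far Kh h by linarith+
  have "log_mean x (x + h) t \<ge> ln u"
  proof (rule log_mean_lower)
    fix v assume "v \<in> {x..x + h}"
    then have "u \<le> \<bar>v - t\<bar>" by (auto simp: u_def)
    then show "ln u \<le> ln \<bar>v - t\<bar>" using u by (subst ln_le_cancel_iff) auto
  qed (use h in auto)
  moreover have "ln (\<bar>x - t\<bar> + 2 * h) \<le> ln u + 3 / (K - 1)"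
  proof -
    have e: "\<bar>x - t\<bar> + 2 * h = u + 3 * h" by (simp add: u_def)
    have "u + 3 * h = u * (1 + 3 * h / u)" using u(2) by (simp add: distrib_left)
    then have "ln (\<bar>x - t\<bar> + 2 * h) = ln (u * (1 + 3 * h / u))" unfolding e by (rule arg_cong)
    also have "\<dots> = ln u + ln (1 + 3 * h / u)"
    proof -
      have "3 * h / u > 0" using u(2) h by simp
      then have "1 + 3 * h / u > 0" by linarith
      with u(2) show ?thesis by (rule ln_mult_pos)
    qed
    also have "ln (1 + 3 * h / u) \<le> 3 * h / u" using u h by (intro ln_add_one_self_le_self) auto
    also have "\<dots> \<le> 3 * h / ((K - 1) * h)" using u h K by (intro divide_left_mono) auto
    also have "\<dots> = 3 / (K - 1)" using h by simp
    finally show ?thesis by simp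
  qed
  moreover have ind: "indicator {x - K * h..x + K * h} t = (0 :: real)" using False by simp
  ultimately show ?thesis unfolding ind mult_zero_right by linarith
qed

section \<open>Variational inequalities for extremal measures\<close>

text \<open>The logarithmic kernel shifted by \<open>ln L\<close>. It is nonnegative at distances up to \<open>L\<close>, so that
  Tonelli's theorem and Fatou's lemma apply; at larger distances the coercion to \<open>ennreal\<close> truncates it to
  \<open>0\<close>, which does not happen on an interval of length at most \<open>L\<close>.\<close>
definition log_kern :: "real \<Rightarrow> real \<Rightarrow> real \<Rightarrow> ennreal" where
  "log_kern L x y = (if x = y then \<infinity> else ennreal (ln L - ln \<bar>x - y\<bar>))"

lemma log_kern_measurable [measurable (raw)]:
  assumes [measurable]: "f \<in> borel_measurable M" "g \<in> borel_measurable M"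
  shows "(\<lambda>x. log_kern L (f x) (g x)) \<in> borel_measurable M"
  unfolding log_kern_def by measurable

lemma log_kern_commute: "log_kern L x y = log_kern L y x"
  by (auto simp: log_kern_def abs_minus_commute)

definition mutual_energy :: "real \<Rightarrow> real measure \<Rightarrow> real measure \<Rightarrow> ennreal" where
  "mutual_energy L \<mu> \<nu> = (\<integral>\<^sup>+ x. \<integral>\<^sup>+ y. log_kern L x y \<partial>\<nu> \<partial>\<mu>)"

lemma prob_measures_onD:
  assumes "\<nu> \<in> prob_measures_on {a..r}"
  shows "prob_space \<nu>" "sets \<nu> = sets borel" "space \<nu> = UNIV" "AE x in \<nu>. x \<in> {a..r}"
proof -
  show 1: "prob_space \<nu>" and 2: "sets \<nu> = sets borel" using assms by (auto simp: prob_measures_on_def)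
  show 3: "space \<nu> = UNIV" using sets_eq_imp_space_eq[OF 2] by simp
  interpret prob_space \<nu> by (rule 1)
  have "emeasure \<nu> {a..r} = 1" using assms by (auto simp: prob_measures_on_def)
  then have "prob {a..r} = 1" by (simp add: emeasure_eq_measure)
  then show "AE x in \<nu>. x \<in> {a..r}" by (subst (asm) prob_eq_1) (auto simp: 2)
qed

lemma mutual_energy_commute:
  assumes "prob_space \<mu>" "prob_space \<nu>" and [measurable_cong]: "sets \<mu> = sets borel" "sets \<nu> = sets borel"
  shows "mutual_energy L \<mu> \<nu> = mutual_energy L \<nu> \<mu>"
proof -
  interpret M: prob_space \<mu> by fact
  interpret N: prob_space \<nu> by fact
  interpret P: pair_sigma_finite \<mu> \<nu> ..
  have "mutual_energy L \<mu> \<nu> = (\<integral>\<^sup>+ y. \<integral>\<^sup>+ x. log_kern L x y \<partial>\<mu> \<partial>\<nu>)"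
    unfolding mutual_energy_def by (rule P.Fubini'[symmetric]) measurable
  also have "\<dots> = mutual_energy L \<nu> \<mu>" unfolding mutual_energy_def by (simp add: log_kern_commute)
  finally show ?thesis .
qed

text \<open>On the interval the negative part of the logarithmic kernel is at most \<open>ln L\<close>; so it has a finite
  integral and the shift may be integrated separately.\<close>
lemma ereal_integral_log_kernel:
  assumes \<nu>: "\<nu> \<in> prob_measures_on {a..r}" and L: "1 \<le> L" "r - a \<le> L"
  shows "ereal_integral (\<nu> \<Otimes>\<^sub>M \<nu>) (\<lambda>(x, y). log_kernel x y) = enn2ereal (mutual_energy L \<nu> \<nu>) - ereal (ln L)"
proof -
  note p = prob_measures_onD[OF \<nu>]
  note [measurable_cong] = p(2)
  interpret N: prob_space \<nu> by (rule p)
  interpret P: pair_prob_space \<nu> \<nu> ..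
  let ?P = "\<nu> \<Otimes>\<^sub>M \<nu>"
  have meas: "(\<lambda>z. log_kernel (fst z) (snd z)) \<in> borel_measurable ?P"
    unfolding log_kernel_def by measurable
  let ?A = "\<integral>\<^sup>+ z. e2ennreal (log_kernel (fst z) (snd z)) \<partial>?P"
  let ?B = "\<integral>\<^sup>+ z. e2ennreal (- log_kernel (fst z) (snd z)) \<partial>?P"
  have ae: "AE z in ?P. fst z \<in> {a..r} \<and> snd z \<in> {a..r}"
  proof (rule P.AE_pair_measure)
    show "{z \<in> space ?P. fst z \<in> {a..r} \<and> snd z \<in> {a..r}} \<in> sets ?P" by measurable
    show "AE x in \<nu>. AE y in \<nu>. fst (x, y) \<in> {a..r} \<and> snd (x, y) \<in> {a..r}"
      using p(4) by eventually_elim (use p(4) in auto)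
  qed
  have key: "e2ennreal (log_kernel x y) + ennreal (ln L) = log_kern L x y + e2ennreal (- log_kernel x y)"
      "e2ennreal (- log_kernel x y) \<le> ennreal (ln L)"
    if "x \<in> {a..r}" "y \<in> {a..r}" for x y
  proof -
    define v where "v = ln (1 / \<bar>x - y\<bar>)"
    have *: "log_kernel x y = ereal v" "log_kern L x y = ennreal (ln L + v)" "ln L + v \<ge> 0" if "x \<noteq> y"
    proof -
      have "ln \<bar>x - y\<bar> \<le> ln L" using that \<open>x \<in> {a..r}\<close> \<open>y \<in> {a..r}\<close> L by (subst ln_le_cancel_iff) auto
      moreover have "v = - ln \<bar>x - y\<bar>" using that by (simp add: v_def ln_div)
      ultimately show "log_kernel x y = ereal v" "log_kern L x y = ennreal (ln L + v)" "ln L + v \<ge> 0"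
        using that by (auto simp: log_kernel_def log_kern_def v_def)
    qed
    have e: "e2ennreal (ereal u) = ennreal u" for u by simp
    have 0: "ln L \<ge> 0" using L by simp
    show "e2ennreal (log_kernel x y) + ennreal (ln L) = log_kern L x y + e2ennreal (- log_kernel x y)"
    proof (cases "x = y")
      case True
      then show ?thesis by (simp add: log_kernel_def log_kern_def)
    next
      case False
      show ?thesis
      proof (cases "v \<ge> 0")
        case True
        then show ?thesis using *[OF False] 0 by (simp add: e ennreal_plus[symmetric] ennreal_neg add.commute del: ennreal_plus)
      next
        case v: False
        then show ?thesis using *[OF False] 0
          by (simp add: e ennreal_plus[symmetric] ennreal_neg del: ennreal_plus)
      qed
    qed
    show "e2ennreal (- log_kernel x y) \<le> ennreal (ln L)"
    proof (cases "x = y")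
      case True
      then show ?thesis by (simp add: log_kernel_def e2ennreal_neg)
    next
      case False
      then show ?thesis using *[OF False] by (auto intro!: ennreal_leI)
    qed
  qed
  have "?A + ennreal (ln L) = (\<integral>\<^sup>+ z. e2ennreal (log_kernel (fst z) (snd z)) + ennreal (ln L) \<partial>?P)"
    using meas by (subst nn_integral_add) (auto simp: P.emeasure_space_1)
  also have "\<dots> = (\<integral>\<^sup>+ z. log_kern L (fst z) (snd z) + e2ennreal (- log_kernel (fst z) (snd z)) \<partial>?P)"
    by (intro nn_integral_cong_AE eventually_mono[OF ae]) (intro key(1); simp)
  also have "\<dots> = (\<integral>\<^sup>+ z. log_kern L (fst z) (snd z) \<partial>?P) + ?B"
    using meas by (subst nn_integral_add) auto
  also have "(\<integral>\<^sup>+ z. log_kern L (fst z) (snd z) \<partial>?P) = mutual_energy L \<nu> \<nu>"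
    unfolding mutual_energy_def by (subst N.nn_integral_fst[symmetric]) auto
  finally have eq: "?A + ennreal (ln L) = mutual_energy L \<nu> \<nu> + ?B" .
  have "?B \<le> (\<integral>\<^sup>+ z. ennreal (ln L) \<partial>?P)"
    by (intro nn_integral_mono_AE eventually_mono[OF ae]) (intro key(2); simp)
  then have "?B \<le> ennreal (ln L)" by (simp add: P.emeasure_space_1)
  then obtain B where B: "?B = ennreal B" "B \<ge> 0" by (cases ?B) (auto simp: top_unique)
  have "enn2ereal ?A + ereal (ln L) = enn2ereal (mutual_energy L \<nu> \<nu>) + ereal B"
    using arg_cong[OF eq, of enn2ereal] L B by (simp add: plus_ennreal.rep_eq enn2ereal_ennreal)
  then have "enn2ereal ?A - enn2ereal ?B = enn2ereal (mutual_energy L \<nu> \<nu>) - ereal (ln L)"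
    using B by (cases "enn2ereal ?A"; cases "enn2ereal (mutual_energy L \<nu> \<nu>)") (auto simp: enn2ereal_ennreal)
  then show ?thesis by (simp add: ereal_integral_def case_prod_beta')
qed

lemma uniform_in_prob_measures_on:
  fixes a c d r :: real
  assumes "a \<le> c" "c < d" "d \<le> r"
  shows "uniform_measure lborel {c..d} \<in> prob_measures_on {a..r}"
proof -
  have "prob_space (uniform_measure lborel {c..d})"
    using assms by (intro prob_space_uniform_measure) auto
  moreover have "emeasure (uniform_measure lborel {c..d}) {a..r} = 1"
    using assms by (simp add: Int_absorb2 divide_ennreal ennreal_eq_1)
  ultimately show ?thesis by (simp add: prob_measures_on_def)
qed

lemma nn_integral_uniform_interval:
  fixes c d :: real
  assumes "c < d" and [measurable]: "f \<in> borel_measurable borel"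
    and f: "\<And>x. f x \<ge> 0" "(f has_integral I) {c..d}"
  shows "(\<integral>\<^sup>+ x. ennreal (f x) \<partial>uniform_measure lborel {c..d}) = ennreal (I / (d - c))"
proof -
  have "I \<ge> 0" using f by (intro has_integral_nonneg[OF f(2)]) auto
  have "(\<integral>\<^sup>+ x. ennreal (f x) \<partial>uniform_measure lborel {c..d}) =
     (\<integral>\<^sup>+ x. ennreal (f x) * indicator {c..d} x \<partial>lborel) / emeasure lborel {c..d}"
    by (intro nn_integral_uniform_measure) auto
  also have "(\<integral>\<^sup>+ x. ennreal (f x) * indicator {c..d} x \<partial>lborel) = (\<integral>\<^sup>+ x. ennreal (if x \<in> {c..d} then f x else 0) \<partial>lborel)"
    by (intro nn_integral_cong) (auto split: split_indicator)
  also have "\<dots> = ennreal I"   proof (rule nn_integral_has_integral_lborel)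
    show "((\<lambda>x. if x \<in> {c..d} then f x else 0) has_integral I) UNIV"
      using f(2) by (simp only: has_integral_restrict_UNIV)
  qed (use f in auto)
  finally show ?thesis using assms(1) \<open>I \<ge> 0\<close> by (simp add: divide_ennreal)
qed

lemma uniform_potential:
  assumes "a \<le> c" "c < d" "d \<le> r" "1 \<le> L" "r - a \<le> L" "y \<in> {a..r}"
  shows "(\<integral>\<^sup>+ x. log_kern L x y \<partial>uniform_measure lborel {c..d}) = ennreal (ln L - log_mean c d y)"
proof -
  define g where "g x = max 0 (ln L - ln \<bar>x - y\<bar>)" for x
  have "(\<integral>\<^sup>+ x. log_kern L x y \<partial>uniform_measure lborel {c..d}) = (\<integral>\<^sup>+ x. ennreal (g x) \<partial>uniform_measure lborel {c..d})"
  proof (rule nn_integral_cong_AE)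
    have "AE x in lborel. x \<noteq> y" by (rule AE_lborel_singleton)
    then have "AE x in lborel. x \<in> {c..d} \<longrightarrow> log_kern L x y = ennreal (g x)"
      by eventually_elim (auto simp: log_kern_def g_def max_def ennreal_neg)
    then show "AE x in uniform_measure lborel {c..d}. log_kern L x y = ennreal (g x)"
      using assms by (intro AE_uniform_measureI) auto
  qed
  also have "\<dots> = ennreal (((d - c) * ln L - (d - c) * log_mean c d y) / (d - c))"
  proof (rule nn_integral_uniform_interval)
    have "((\<lambda>_. ln L) has_integral ((d - c) * ln L)) {c..d}"
      using has_integral_const_real[of "ln L" c d] assms(2) by simp
    then have "((\<lambda>x. ln L - ln \<bar>x - y\<bar>) has_integral ((d - c) * ln L - (d - c) * log_mean c d y)) {c..d}"
      by (intro has_integral_diff has_integral_ln_abs assms)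
    then show "(g has_integral ((d - c) * ln L - (d - c) * log_mean c d y)) {c..d}"
    proof (rule has_integral_eq[rotated])
      fix x assume x: "x \<in> {c..d}"
      have "ln \<bar>x - y\<bar> \<le> ln L"
      proof (cases "x = y")
        case False
        then show ?thesis using x assms by (subst ln_le_cancel_iff) auto
      qed (use assms in auto)
      then show "ln L - ln \<bar>x - y\<bar> = g x" by (simp add: g_def)
    qed
  qed (use assms in \<open>auto simp: g_def[abs_def]\<close>)
  also have "((d - c) * ln L - (d - c) * log_mean c d y) / (d - c) = ln L - log_mean c d y"
    using assms by (simp add: diff_divide_distrib)
  finally show ?thesis .
qed

locale extremal_field =
  fixes a r L B :: real and w :: "real \<Rightarrow> real" and \<sigma> :: "real measure"
  assumes ar: "a < r" and L: "1 \<le> L" "r - a \<le> L"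
    and field_continuous: "continuous_on {a..r} (external_field w)"
    and field_bounded: "\<And>x. x \<in> {a..r} \<Longrightarrow> \<bar>external_field w x\<bar> \<le> B"
    and extremal: "is_extremal_measure {a..r} w \<sigma>"
begin

abbreviation "Q \<equiv> external_field w"

text \<open>The external field, made nonnegative by the shift \<open>B\<close> and cut off outside the interval.\<close>
definition field :: "real \<Rightarrow> real" where
  "field x = indicator {a..r} x * (Q x + B)"

lemma B_nonneg: "B \<ge> 0" using field_bounded[of a] ar by auto

lemma field_nonneg: "field x \<ge> 0"
  using field_bounded[of x] by (auto simp: field_def split: split_indicator)

lemma field_measurable [measurable]: "field \<in> borel_measurable borel"
proof -
  have "(\<lambda>x. indicator {a..r} x *\<^sub>R (Q x + B)) \<in> borel_measurable borel"
    by (intro borel_measurable_continuous_on_indicator continuous_intros field_continuous) auto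
  then show ?thesis by (simp add: field_def[abs_def])
qed

lemma nn_integral_field:
  assumes "\<nu> \<in> prob_measures_on {a..r}"
  shows "(\<integral>\<^sup>+ x. ennreal (field x) \<partial>\<nu>) = ennreal ((LINT x:{a..r}|\<nu>. Q x) + B)"
    "0 \<le> (LINT x:{a..r}|\<nu>. Q x) + B"
proof -
  note p = prob_measures_onD[OF assms]
  note [measurable_cong] = p(2)
  interpret prob_space \<nu> by (rule p)
  have [measurable]: "(\<lambda>x. indicator {a..r} x * Q x) \<in> borel_measurable borel"
    using borel_measurable_continuous_on_indicator[OF _ field_continuous] by simp
  have int: "integrable \<nu> (\<lambda>x. indicator {a..r} x * Q x)"
    using field_bounded B_nonneg by (intro integrable_const_bound[of _ B]) (auto split: split_indicator)
  have ae: "AE x in \<nu>. field x = indicator {a..r} x * Q x + B"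
    using p(4) by eventually_elim (auto simp: field_def)
  have eq: "(LINT x|\<nu>. field x) = (LINT x:{a..r}|\<nu>. Q x) + B"
  proof -
    have "(LINT x|\<nu>. field x) = (LINT x|\<nu>. indicator {a..r} x * Q x + B)"
      by (rule integral_cong_AE) (use ae in auto)
    also have "\<dots> = (LINT x|\<nu>. indicator {a..r} x * Q x) + B"
      using int by (simp add: prob_space)
    finally show ?thesis by (simp add: set_lebesgue_integral_def)
  qed
  have "integrable \<nu> (\<lambda>x. indicator {a..r} x * Q x + B)" using int by simp
  then have int': "integrable \<nu> field" by (subst integrable_cong_AE[OF _ _ ae]) auto
  show "(\<integral>\<^sup>+ x. ennreal (field x) \<partial>\<nu>) = ennreal ((LINT x:{a..r}|\<nu>. Q x) + B)"
    unfolding eq[symmetric] by (rule nn_integral_eq_integral[OF int']) (simp add: field_nonneg)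
  show "0 \<le> (LINT x:{a..r}|\<nu>. Q x) + B"
    unfolding eq[symmetric] by (intro Bochner_Integration.integral_nonneg field_nonneg)
qed

lemma nn_integral_field_uniform:
  assumes "a \<le> c" "c < d" "d \<le> r"
  shows "(\<integral>\<^sup>+ x. ennreal (field x) \<partial>uniform_measure lborel {c..d}) = ennreal (integral {c..d} Q / (d - c) + B)"
    "0 \<le> integral {c..d} Q / (d - c) + B"
proof -
  have "continuous_on {c..d} Q" using field_continuous assms by (auto intro: continuous_on_subset)
  then have "(Q has_integral integral {c..d} Q) {c..d}"
    by (intro integrable_integral integrable_continuous_real)
  moreover have "((\<lambda>_. B) has_integral ((d - c) * B)) {c..d}"
    using has_integral_const_real[of B c d] assms by simp
  ultimately have "((\<lambda>x. Q x + B) has_integral (integral {c..d} Q + (d - c) * B)) {c..d}"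
    by (rule has_integral_add)
  then have i: "(field has_integral (integral {c..d} Q + (d - c) * B)) {c..d}"
    by (rule has_integral_eq[rotated]) (use assms in \<open>auto simp: field_def\<close>)
  have e: "(integral {c..d} Q + (d - c) * B) / (d - c) = integral {c..d} Q / (d - c) + B"
    using assms by (simp add: add_divide_distrib)
  show "(\<integral>\<^sup>+ x. ennreal (field x) \<partial>uniform_measure lborel {c..d}) = ennreal (integral {c..d} Q / (d - c) + B)"
    using nn_integral_uniform_interval[OF assms(2) field_measurable field_nonneg i] e by simp
  have "0 \<le> integral {c..d} Q + (d - c) * B" using field_nonneg by (intro has_integral_nonneg[OF i])
  then show "0 \<le> integral {c..d} Q / (d - c) + B" using assms by (simp flip: e)
qed

definition energy :: "real measure \<Rightarrow> ennreal" where
  "energy \<nu> = mutual_energy L \<nu> \<nu> + 2 * (\<integral>\<^sup>+ x. ennreal (field x) \<partial>\<nu>)"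

lemma sigma: "\<sigma> \<in> prob_measures_on {a..r}"
  using extremal by (simp add: is_extremal_measure_def)

lemma energy_minimal:
  assumes "\<nu> \<in> prob_measures_on {a..r}"
  shows "energy \<sigma> \<le> energy \<nu>"
proof -
  have "weighted_energy {a..r} w \<sigma> \<le> weighted_energy {a..r} w \<nu>"
    using extremal assms by (simp add: is_extremal_measure_def)
  then have le: "enn2ereal (mutual_energy L \<sigma> \<sigma>) - ereal (ln L) + ereal (2 * (LINT x:{a..r}|\<sigma>. Q x)) \<le>
      enn2ereal (mutual_energy L \<nu> \<nu>) - ereal (ln L) + ereal (2 * (LINT x:{a..r}|\<nu>. Q x))"
    unfolding weighted_energy_def using ereal_integral_log_kernel[OF sigma L] ereal_integral_log_kernel[OF assms L] by simp
  have two: "2 * ennreal u = ennreal (2 * u)" for u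
    by (metis ennreal_mult' ennreal_numeral zero_le_numeral)
  show ?thesis
  proof (cases "mutual_energy L \<nu> \<nu> = top")
    case True
    then show ?thesis by (simp add: energy_def)
  next
    case False
    then obtain m where m: "mutual_energy L \<nu> \<nu> = ennreal m" "m \<ge> 0" by (cases "mutual_energy L \<nu> \<nu>") auto
    have "mutual_energy L \<sigma> \<sigma> \<noteq> top" using le m by (auto simp: enn2ereal_ennreal)
    then obtain s where s: "mutual_energy L \<sigma> \<sigma> = ennreal s" "s \<ge> 0" by (cases "mutual_energy L \<sigma> \<sigma>") auto
    have "s + 2 * ((LINT x:{a..r}|\<sigma>. Q x) + B) \<le> m + 2 * ((LINT x:{a..r}|\<nu>. Q x) + B)"
      using le by (simp add: m s enn2ereal_ennreal)
    then show ?thesis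
      using m s nn_integral_field[OF sigma] nn_integral_field[OF assms]
      by (simp add: energy_def two ennreal_plus[symmetric] ennreal_leI del: ennreal_plus)
  qed
qed

lemma prob_space_sigma: "prob_space \<sigma>" and sets_sigma: "sets \<sigma> = sets borel"
  and AE_sigma: "AE x in \<sigma>. x \<in> {a..r}" and space_sigma: "space \<sigma> = UNIV"
  using prob_measures_onD[OF sigma] by auto

lemma nn_integral_uniform_potential_le:
  assumes \<nu>: "\<nu> \<in> prob_measures_on {a..r}" and "a \<le> c" "c < d" "d \<le> r"
  shows "mutual_energy L (uniform_measure lborel {c..d}) \<nu> = (\<integral>\<^sup>+ y. ennreal (ln L - log_mean c d y) \<partial>\<nu>)"
    "mutual_energy L (uniform_measure lborel {c..d}) \<nu> \<le> ennreal (ln L - ln (d - c) + 2)"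
proof -
  note p = prob_measures_onD[OF \<nu>]
  note u = prob_measures_onD[OF uniform_in_prob_measures_on[OF assms(2-4)]]
  interpret prob_space \<nu> by (rule p)
  have "mutual_energy L (uniform_measure lborel {c..d}) \<nu> = mutual_energy L \<nu> (uniform_measure lborel {c..d})"
    using u(1,2) p(1,2) by (intro mutual_energy_commute) auto
  also have "\<dots> = (\<integral>\<^sup>+ y. ennreal (ln L - log_mean c d y) \<partial>\<nu>)"
    unfolding mutual_energy_def
  proof (intro nn_integral_cong_AE eventually_mono[OF p(4)])
    fix y assume "y \<in> {a..r}"
    then show "(\<integral>\<^sup>+ x. log_kern L y x \<partial>uniform_measure lborel {c..d}) = ennreal (ln L - log_mean c d y)"
      unfolding log_kern_commute[of L y] by (rule uniform_potential[OF assms(2-4) L])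
  qed
  finally show eq: "mutual_energy L (uniform_measure lborel {c..d}) \<nu> = (\<integral>\<^sup>+ y. ennreal (ln L - log_mean c d y) \<partial>\<nu>)" .
  have "ln L - log_mean c d y \<le> ln L - ln (d - c) + 2" for y
    using log_mean_ge[of "d - c" c y] assms by simp
  then have "(\<integral>\<^sup>+ y. ennreal (ln L - log_mean c d y) \<partial>\<nu>) \<le> (\<integral>\<^sup>+ y. ennreal (ln L - ln (d - c) + 2) \<partial>\<nu>)"
    by (intro nn_integral_mono ennreal_leI)
  also have "\<dots> = ennreal (ln L - ln (d - c) + 2)" by (simp add: emeasure_space_1)
  finally show "mutual_energy L (uniform_measure lborel {c..d}) \<nu> \<le> ennreal (ln L - ln (d - c) + 2)"
    by (simp add: eq)
qed

lemma mutual_energy_le: "mutual_energy L \<sigma> \<sigma> \<le> ennreal (ln L - ln (r - a) + 2 + 4 * B)"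
proof -
  let ?u = "uniform_measure lborel {a..r}"
  have u: "?u \<in> prob_measures_on {a..r}" using ar by (intro uniform_in_prob_measures_on) auto
  note p = prob_measures_onD[OF u]
  interpret prob_space ?u by (rule p)
  have "field x \<le> 2 * B" for x
    using field_bounded[of x] B_nonneg by (auto simp: field_def split: split_indicator)
  then have "(\<integral>\<^sup>+ x. ennreal (field x) \<partial>?u) \<le> (\<integral>\<^sup>+ x. ennreal (2 * B) \<partial>?u)"
    by (intro nn_integral_mono ennreal_leI)
  also have "\<dots> = ennreal (2 * B)" using emeasure_space_1 by simp
  finally have f: "(\<integral>\<^sup>+ x. ennreal (field x) \<partial>?u) \<le> ennreal (2 * B)" .
  have nonneg: "ln L - ln (r - a) + 2 \<ge> 0" using L ar by (smt (verit) ln_le_cancel_iff)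
  have "mutual_energy L \<sigma> \<sigma> \<le> energy \<sigma>" by (simp add: energy_def)
  also have "\<dots> \<le> energy ?u" by (rule energy_minimal[OF u])
  also have "\<dots> \<le> ennreal (ln L - ln (r - a) + 2) + 2 * ennreal (2 * B)"
    unfolding energy_def using nn_integral_uniform_potential_le(2)[OF u, of a r] ar f
    by (intro add_mono mult_left_mono) auto
  also have "\<dots> = ennreal (ln L - ln (r - a) + 2 + 4 * B)"
    using nonneg B_nonneg by (simp add: ennreal_plus[symmetric] ennreal_mult'[symmetric] flip: ennreal_numeral del: ennreal_plus)
  finally show ?thesis .
qed

text \<open>Two points of \<open>{c..d}\<close> interact with at least \<open>ln L - ln (d - c)\<close>, and the energy of \<open>\<sigma>\<close> is
  bounded in terms of the interval and of the bound for the field.\<close>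
lemma interval_mass:
  assumes "c < d"
  shows "(measure \<sigma> {c..d})\<^sup>2 * (ln L - ln (d - c)) \<le> ln L - ln (r - a) + 2 + 4 * B"
proof (cases "ln L - ln (d - c) \<ge> 0")
  case True
  interpret prob_space \<sigma> by (rule prob_space_sigma)
  let ?J = "{c..d}"
  let ?v = "ln L - ln (d - c)"
  have J: "?J \<in> sets \<sigma>" by (simp add: sets_sigma)
  have "ennreal ((measure \<sigma> ?J)\<^sup>2 * ?v) = ennreal ?v * emeasure \<sigma> ?J * emeasure \<sigma> ?J"
    using True by (simp add: emeasure_eq_measure ennreal_mult'[symmetric] power2_eq_square mult_ac)
  also have "\<dots> = (\<integral>\<^sup>+ x. \<integral>\<^sup>+ y. ennreal ?v * indicator ?J y * indicator ?J x \<partial>\<sigma> \<partial>\<sigma>)"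
    using J by (simp add: nn_integral_cmult nn_integral_multc)
  also have "\<dots> \<le> mutual_energy L \<sigma> \<sigma>"
    unfolding mutual_energy_def
  proof (intro nn_integral_mono)
    fix x y
    show "ennreal ?v * indicator ?J y * indicator ?J x \<le> log_kern L x y"
    proof (cases "x \<in> ?J \<and> y \<in> ?J \<and> x \<noteq> y")
      case True
      then have "ln \<bar>x - y\<bar> \<le> ln (d - c)" using assms by (subst ln_le_cancel_iff) auto
      then show ?thesis using True by (auto simp: log_kern_def intro!: ennreal_leI)
    next
      case False
      then show ?thesis by (auto simp: log_kern_def split: split_indicator)
    qed
  qed
  also have "\<dots> \<le> ennreal (ln L - ln (r - a) + 2 + 4 * B)" by (rule mutual_energy_le)
  finally show ?thesis
  proof (subst (asm) ennreal_le_iff)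
    show "0 \<le> ln L - ln (r - a) + 2 + 4 * B" using L ar B_nonneg by (smt (verit) ln_le_cancel_iff)
  qed
next
  case False
  have "(measure \<sigma> {c..d})\<^sup>2 * (ln L - ln (d - c)) \<le> 0" using False by (intro mult_nonneg_nonpos) auto
  also have "0 \<le> ln L - ln (r - a) + 2 + 4 * B" using L ar B_nonneg by (smt (verit) ln_le_cancel_iff)
  finally show ?thesis .
qed

definition potential :: "real \<Rightarrow> ennreal" where
  "potential x = (\<integral>\<^sup>+ y. log_kern L x y \<partial>\<sigma>)"

lemma potential_measurable [measurable]: "potential \<in> borel_measurable borel"
proof -
  interpret prob_space \<sigma> by (rule prob_space_sigma)
  note [measurable_cong] = sets_sigma
  show ?thesis unfolding potential_def[abs_def] by measurable
qed

text \<open>The proportion \<open>s\<close> of the mass of \<open>\<sigma>\<close> on \<open>A\<close> is taken away and distributed according to \<open>\<omega>\<close>.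
  The measure is constructed as the law of a point that is drawn from \<open>\<sigma>\<close> and, if it lies in
  \<open>A\<close>, redrawn from \<open>\<omega>\<close> with probability \<open>s\<close>.\<close>
lemma transported_measure:
  assumes A [measurable]: "A \<in> sets borel" and \<omega>: "\<omega> \<in> prob_measures_on {a..r}" and s: "0 \<le> s" "s \<le> 1"
  shows "\<exists>\<nu>\<in>prob_measures_on {a..r}. \<forall>f\<in>borel_measurable borel.
    (\<integral>\<^sup>+ x. f x \<partial>\<nu>) = ennreal s * emeasure \<sigma> A * (\<integral>\<^sup>+ x. f x \<partial>\<omega>) +
      (\<integral>\<^sup>+ x. ennreal (1 - s * indicator A x) * f x \<partial>\<sigma>)"
proof -
  note pw = prob_measures_onD[OF \<omega>]
  note [measurable_cong] = sets_sigma pw(2)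
  let ?b = "measure_pmf (bernoulli_pmf s)"
  interpret S: prob_space \<sigma> by (rule prob_space_sigma)
  interpret W: prob_space \<omega> by (rule pw)
  interpret b: prob_space ?b by unfold_locales (simp add: measure_pmf.emeasure_space_1)
  interpret WB: pair_prob_space \<omega> ?b ..
  interpret P: pair_prob_space \<sigma> "\<omega> \<Otimes>\<^sub>M ?b" ..
  define h where "h z = (if fst z \<in> A \<and> snd (snd z) then fst (snd z) else fst z)" for z :: "real \<times> real \<times> bool"
  have h [measurable]: "h \<in> (\<sigma> \<Otimes>\<^sub>M (\<omega> \<Otimes>\<^sub>M ?b)) \<rightarrow>\<^sub>M borel"
    unfolding h_def by measurable
  define \<nu> where "\<nu> = distr (\<sigma> \<Otimes>\<^sub>M (\<omega> \<Otimes>\<^sub>M ?b)) borel h"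
  have int: "(\<integral>\<^sup>+ x. f x \<partial>\<nu>) = ennreal s * emeasure \<sigma> A * (\<integral>\<^sup>+ x. f x \<partial>\<omega>) +
      (\<integral>\<^sup>+ x. ennreal (1 - s * indicator A x) * f x \<partial>\<sigma>)"
    if [measurable]: "f \<in> borel_measurable borel" for f
  proof -
    have "(\<integral>\<^sup>+ x. f x \<partial>\<nu>) = (\<integral>\<^sup>+ z. f (h z) \<partial>(\<sigma> \<Otimes>\<^sub>M (\<omega> \<Otimes>\<^sub>M ?b)))"
      unfolding \<nu>_def by (rule nn_integral_distr) measurable
    also have "\<dots> = (\<integral>\<^sup>+ x. \<integral>\<^sup>+ v. f (h (x, v)) \<partial>(\<omega> \<Otimes>\<^sub>M ?b) \<partial>\<sigma>)"
      by (rule WB.nn_integral_fst[symmetric]) measurable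
    also have "\<dots> = (\<integral>\<^sup>+ x. \<integral>\<^sup>+ y. \<integral>\<^sup>+ u. f (h (x, y, u)) \<partial>?b \<partial>\<omega> \<partial>\<sigma>)"
      by (intro nn_integral_cong measure_pmf.nn_integral_fst[symmetric]) measurable
    also have "\<dots> = (\<integral>\<^sup>+ x. \<integral>\<^sup>+ y. (ennreal s * indicator A x) * f y + ennreal (1 - s * indicator A x) * f x \<partial>\<omega> \<partial>\<sigma>)"
    proof (intro nn_integral_cong)
      fix x y
      have "(\<integral>\<^sup>+ u. f (h (x, y, u)) \<partial>?b) = f (h (x, y, True)) * ennreal s + f (h (x, y, False)) * ennreal (1 - s)"
        using s by (simp add: nn_integral_bernoulli_pmf)
      also have "\<dots> = (ennreal s * indicator A x) * f y + ennreal (1 - s * indicator A x) * f x"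
      proof (cases "x \<in> A")
        case False
        have "(ennreal s + ennreal (1 - s)) * f x = f x"
          using s by (simp add: ennreal_plus[symmetric] del: ennreal_plus)
        with False show ?thesis by (simp add: h_def mult.commute distrib_left)
      qed (simp add: h_def mult.commute)
      finally show "(\<integral>\<^sup>+ u. f (h (x, y, u)) \<partial>?b) = \<dots>" .
    qed
    also have "\<dots> = (\<integral>\<^sup>+ x. (ennreal s * indicator A x) * (\<integral>\<^sup>+ y. f y \<partial>\<omega>) + ennreal (1 - s * indicator A x) * f x \<partial>\<sigma>)"
      by (intro nn_integral_cong) (simp add: nn_integral_add nn_integral_cmult W.emeasure_space_1)
    also have "\<dots> = (\<integral>\<^sup>+ x. (ennreal s * indicator A x) * (\<integral>\<^sup>+ y. f y \<partial>\<omega>) \<partial>\<sigma>) + (\<integral>\<^sup>+ x. ennreal (1 - s * indicator A x) * f x \<partial>\<sigma>)"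
      by (intro nn_integral_add) measurable
    also have "(\<integral>\<^sup>+ x. (ennreal s * indicator A x) * (\<integral>\<^sup>+ y. f y \<partial>\<omega>) \<partial>\<sigma>) = ennreal s * emeasure \<sigma> A * (\<integral>\<^sup>+ y. f y \<partial>\<omega>)"
      using A by (subst nn_integral_multc) (auto simp: nn_integral_cmult sets_sigma)
    finally show ?thesis .
  qed
  have "prob_space \<nu>" unfolding \<nu>_def by (rule P.prob_space_distr) measurable
  moreover have "sets \<nu> = sets borel" by (simp add: \<nu>_def)
  moreover have "emeasure \<nu> {a..r} = 1"
  proof -
    have w1: "emeasure \<omega> {a..r} = 1" using \<omega> by (simp add: prob_measures_on_def)
    have "emeasure \<nu> {a..r} = (\<integral>\<^sup>+ x. indicator {a..r} x \<partial>\<nu>)" by (simp add: \<nu>_def)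
    also have "\<dots> = ennreal s * emeasure \<sigma> A * 1 + (\<integral>\<^sup>+ x. ennreal (1 - s * indicator A x) * indicator {a..r} x \<partial>\<sigma>)"
      using w1 pw(2) by (subst int) auto
    also have "(\<integral>\<^sup>+ x. ennreal (1 - s * indicator A x) * indicator {a..r} x \<partial>\<sigma>) = (\<integral>\<^sup>+ x. ennreal (1 - s * indicator A x) \<partial>\<sigma>)"
      by (intro nn_integral_cong_AE eventually_mono[OF AE_sigma]) auto
    also have "ennreal s * emeasure \<sigma> A * 1 + \<dots> = (\<integral>\<^sup>+ x. ennreal s * indicator A x + ennreal (1 - s * indicator A x) \<partial>\<sigma>)"
      using A by (subst nn_integral_add) (auto simp: nn_integral_cmult sets_sigma)
    also have "\<dots> = (\<integral>\<^sup>+ x. 1 \<partial>\<sigma>)"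
      using s by (intro nn_integral_cong) (auto split: split_indicator simp: ennreal_plus[symmetric] simp del: ennreal_plus)
    finally show ?thesis by (simp add: S.emeasure_space_1)
  qed
  ultimately have "\<nu> \<in> prob_measures_on {a..r}" by (simp add: prob_measures_on_def)
  then show ?thesis using int by blast
qed

text \<open>The first variation of the energy in the direction of a transport from \<open>A\<close> to \<open>\<omega>\<close> is
  nonnegative.\<close>
lemma transport_inequality:
  assumes A [measurable]: "A \<in> sets borel" and \<omega>: "\<omega> \<in> prob_measures_on {a..r}"
    and fin: "mutual_energy L \<omega> \<omega> \<noteq> top" "mutual_energy L \<omega> \<sigma> \<noteq> top"
  shows "(\<integral>\<^sup>+ x. indicator A x * (potential x + ennreal (field x)) \<partial>\<sigma>) \<le>
    emeasure \<sigma> A * (mutual_energy L \<omega> \<sigma> + (\<integral>\<^sup>+ x. ennreal (field x) \<partial>\<omega>))"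
proof -
  note pw = prob_measures_onD[OF \<omega>]
  note [measurable_cong] = sets_sigma pw(2)
  interpret S: prob_space \<sigma> by (rule prob_space_sigma)
  interpret W: prob_space \<omega> by (rule pw)
  interpret SS: pair_sigma_finite \<sigma> \<sigma> ..
  let ?m = "emeasure \<sigma> A"
  let ?I = "indicator A :: real \<Rightarrow> ennreal"
  define BS where "BS = mutual_energy L \<sigma> \<sigma>"
  define BW where "BW = mutual_energy L \<omega> \<omega>"
  define BM where "BM = mutual_energy L \<omega> \<sigma>"
  define qS where "qS = (\<integral>\<^sup>+ x. ennreal (field x) \<partial>\<sigma>)"
  define qW where "qW = (\<integral>\<^sup>+ x. ennreal (field x) \<partial>\<omega>)"
  define D where "D = (\<integral>\<^sup>+ x. ?I x * potential x \<partial>\<sigma>)"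
  define qA where "qA = (\<integral>\<^sup>+ x. ?I x * ennreal (field x) \<partial>\<sigma>)"
  have BM: "mutual_energy L \<sigma> \<omega> = BM" unfolding BM_def
    by (rule mutual_energy_commute) (use prob_space_sigma sets_sigma pw in auto)
  have BS: "BS = (\<integral>\<^sup>+ x. potential x \<partial>\<sigma>)" by (simp add: BS_def mutual_energy_def potential_def)
  have BM': "BM = (\<integral>\<^sup>+ x. potential x \<partial>\<omega>)" by (simp add: BM_def mutual_energy_def potential_def)
  have le1: "?I x * z \<le> z" for x and z :: ennreal by (simp split: split_indicator)
  have "D \<le> BS" unfolding D_def BS by (intro nn_integral_mono le1)
  have "qA \<le> qS" unfolding qA_def qS_def by (intro nn_integral_mono le1)
  have BSfin: "BS \<noteq> top" using mutual_energy_le by (auto simp: BS_def top_unique)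
  have qfin: "qS \<noteq> top" "qW \<noteq> top"
    using nn_integral_field(1)[OF sigma] nn_integral_field(1)[OF \<omega>] by (simp_all add: qS_def qW_def)
  \<comment> \<open>minimality gives an inequality between quadratic polynomials in \<open>s\<close> with equal constant terms\<close>
  have main: "ennreal (2 * s) * (D + qA) \<le>
      ennreal (s\<^sup>2) * (?m * ?m * BW + BS) + ennreal (2 * s) * (?m * (BM + qW))" if s: "0 < s" "s \<le> 1" for s
  proof -
    define g where "g x = ennreal (1 - s * indicator A x)" for x
    have [measurable]: "g \<in> borel_measurable borel" unfolding g_def by measurable
    have g1: "g x \<le> 1" for x using s by (auto simp: g_def ennreal_le_1 split: split_indicator)
    have gs: "g x + ennreal s * ?I x = 1" for x
      using s by (auto simp: g_def ennreal_plus[symmetric] split: split_indicator simp del: ennreal_plus)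
    obtain \<nu> where \<nu>: "\<nu> \<in> prob_measures_on {a..r}"
      and int: "\<And>f. f \<in> borel_measurable borel \<Longrightarrow>
        (\<integral>\<^sup>+ x. f x \<partial>\<nu>) = ennreal s * ?m * (\<integral>\<^sup>+ x. f x \<partial>\<omega>) + (\<integral>\<^sup>+ x. g x * f x \<partial>\<sigma>)"
      using transported_measure[OF A \<omega>, of s] s unfolding g_def by auto
    define \<Omega> where "\<Omega> x = (\<integral>\<^sup>+ y. log_kern L x y \<partial>\<omega>)" for x
    define \<Gamma> where "\<Gamma> x = (\<integral>\<^sup>+ y. g y * log_kern L x y \<partial>\<sigma>)" for x
    have [measurable]: "\<Omega> \<in> borel_measurable borel" unfolding \<Omega>_def[abs_def] by measurable
    have [measurable]: "\<Gamma> \<in> borel_measurable borel" unfolding \<Gamma>_def[abs_def] by measurable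
    have "mutual_energy L \<nu> \<nu> = (\<integral>\<^sup>+ x. ennreal s * ?m * \<Omega> x + \<Gamma> x \<partial>\<nu>)"
      unfolding mutual_energy_def \<Omega>_def \<Gamma>_def by (intro nn_integral_cong int) measurable
    also have "\<dots> = ennreal s * ?m * (\<integral>\<^sup>+ x. ennreal s * ?m * \<Omega> x + \<Gamma> x \<partial>\<omega>) +
        (\<integral>\<^sup>+ x. g x * (ennreal s * ?m * \<Omega> x + \<Gamma> x) \<partial>\<sigma>)"
      by (rule int) measurable
    also have "(\<integral>\<^sup>+ x. ennreal s * ?m * \<Omega> x + \<Gamma> x \<partial>\<omega>) = ennreal s * ?m * BW + (\<integral>\<^sup>+ x. \<Gamma> x \<partial>\<omega>)"
      by (simp add: nn_integral_add nn_integral_cmult BW_def mutual_energy_def \<Omega>_def)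
    also have "(\<integral>\<^sup>+ x. g x * (ennreal s * ?m * \<Omega> x + \<Gamma> x) \<partial>\<sigma>) =
        (\<integral>\<^sup>+ x. ennreal s * ?m * (g x * \<Omega> x) + g x * \<Gamma> x \<partial>\<sigma>)"
      by (intro nn_integral_cong) (simp add: distrib_left mult_ac)
    also have "\<dots> = ennreal s * ?m * (\<integral>\<^sup>+ x. g x * \<Omega> x \<partial>\<sigma>) + (\<integral>\<^sup>+ x. g x * \<Gamma> x \<partial>\<sigma>)"
      by (simp add: nn_integral_add nn_integral_cmult)
    finally have e1: "mutual_energy L \<nu> \<nu> = ennreal s * ?m * (ennreal s * ?m * BW + (\<integral>\<^sup>+ x. \<Gamma> x \<partial>\<omega>)) +
       (ennreal s * ?m * (\<integral>\<^sup>+ x. g x * \<Omega> x \<partial>\<sigma>) + (\<integral>\<^sup>+ x. g x * \<Gamma> x \<partial>\<sigma>))" .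
    have b1: "(\<integral>\<^sup>+ x. \<Gamma> x \<partial>\<omega>) \<le> BM"
      unfolding BM' \<Gamma>_def potential_def using mult_right_mono[OF g1] by (intro nn_integral_mono) simp
    have "(\<integral>\<^sup>+ x. g x * \<Omega> x \<partial>\<sigma>) \<le> (\<integral>\<^sup>+ x. \<Omega> x \<partial>\<sigma>)"
      using mult_right_mono[OF g1] by (intro nn_integral_mono) simp
    then have b2: "(\<integral>\<^sup>+ x. g x * \<Omega> x \<partial>\<sigma>) \<le> BM"
      by (simp add: BM[symmetric] mutual_energy_def \<Omega>_def)
    \<comment> \<open>from \<open>(1 - s 1\<^sub>A(x)) (1 - s 1\<^sub>A(y)) + s 1\<^sub>A(x) + s 1\<^sub>A(y) \<le> 1 + s\<^sup>2\<close>; this form needs no subtraction in \<open>ennreal\<close>\<close>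
    have b3: "(\<integral>\<^sup>+ x. g x * \<Gamma> x \<partial>\<sigma>) + ennreal (2 * s) * D \<le> (1 + ennreal (s\<^sup>2)) * BS"
    proof -
      have D1: "ennreal s * D = (\<integral>\<^sup>+ x. \<integral>\<^sup>+ y. ennreal s * ?I x * log_kern L x y \<partial>\<sigma> \<partial>\<sigma>)"
        unfolding D_def potential_def by (simp add: nn_integral_cmult[symmetric] mult.assoc)
      have D2: "ennreal s * D = (\<integral>\<^sup>+ x. \<integral>\<^sup>+ y. ennreal s * ?I y * log_kern L x y \<partial>\<sigma> \<partial>\<sigma>)"
      proof -
        have "(\<integral>\<^sup>+ x. \<integral>\<^sup>+ y. ennreal s * ?I y * log_kern L x y \<partial>\<sigma> \<partial>\<sigma>) =
          (\<integral>\<^sup>+ y. \<integral>\<^sup>+ x. ennreal s * ?I y * log_kern L x y \<partial>\<sigma> \<partial>\<sigma>)"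
          by (rule SS.Fubini'[symmetric]) measurable
        also have "\<dots> = (\<integral>\<^sup>+ y. \<integral>\<^sup>+ x. ennreal s * ?I y * log_kern L y x \<partial>\<sigma> \<partial>\<sigma>)"
          by (simp add: log_kern_commute)
        finally show ?thesis using D1 by simp
      qed
      have "(\<integral>\<^sup>+ x. g x * \<Gamma> x \<partial>\<sigma>) + ennreal (2 * s) * D = (\<integral>\<^sup>+ x. g x * \<Gamma> x \<partial>\<sigma>) + (ennreal s * D + ennreal s * D)"
        using s by (simp add: distrib_right[symmetric] ennreal_plus[symmetric] del: ennreal_plus)
      also have "\<dots> = (\<integral>\<^sup>+ x. \<integral>\<^sup>+ y. g x * g y * log_kern L x y + (ennreal s * ?I x * log_kern L x y +
          ennreal s * ?I y * log_kern L x y) \<partial>\<sigma> \<partial>\<sigma>)"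
      proof -
        have "(\<integral>\<^sup>+ x. g x * \<Gamma> x \<partial>\<sigma>) = (\<integral>\<^sup>+ x. \<integral>\<^sup>+ y. g x * g y * log_kern L x y \<partial>\<sigma> \<partial>\<sigma>)"
          unfolding \<Gamma>_def by (simp add: nn_integral_cmult[symmetric] mult.assoc)
        then show ?thesis
          by (subst (1) D1, subst D2) (simp add: nn_integral_add)
      qed
      also have "\<dots> \<le> (\<integral>\<^sup>+ x. \<integral>\<^sup>+ y. (1 + ennreal (s\<^sup>2)) * log_kern L x y \<partial>\<sigma> \<partial>\<sigma>)"
      proof (intro nn_integral_mono)
        fix x y
        have "g x * g y + (ennreal s * ?I x + ennreal s * ?I y) \<le> 1 + ennreal (s\<^sup>2)"
        proof -
          have "g x * g y + (ennreal s * ?I x + ennreal s * ?I y) =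
            ennreal ((1 - s * indicator A x) * (1 - s * indicator A y) + (s * indicator A x + s * indicator A y))"
          proof -
            have i: "ennreal s * ?I z = ennreal (s * indicator A z)" for z by (auto split: split_indicator)
            have n: "0 \<le> 1 - s * indicator A z" "0 \<le> s * indicator A z" for z
              using s by (auto split: split_indicator)
            show ?thesis unfolding g_def i ennreal_mult[OF n(1) n(1)] ennreal_plus[OF n(2) n(2)]
              ennreal_plus[OF mult_nonneg_nonneg[OF n(1) n(1)] add_nonneg_nonneg[OF n(2) n(2)]] ..
          qed
          also have "\<dots> \<le> ennreal (1 + s\<^sup>2)"
            using s by (intro ennreal_leI) (auto split: split_indicator simp: power2_eq_square algebra_simps)
          also have "\<dots> = 1 + ennreal (s\<^sup>2)" using s by (simp add: ennreal_plus)
          finally show ?thesis .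
        qed
        from mult_right_mono[OF this, of "log_kern L x y"]
        show "g x * g y * log_kern L x y + (ennreal s * ?I x * log_kern L x y + ennreal s * ?I y * log_kern L x y)
          \<le> (1 + ennreal (s\<^sup>2)) * log_kern L x y"
          by (simp add: distrib_right)
      qed
      also have "\<dots> = (1 + ennreal (s\<^sup>2)) * BS"
        by (simp add: nn_integral_cmult BS_def mutual_energy_def)
      finally show ?thesis .
    qed
    have f1: "(\<integral>\<^sup>+ x. ennreal (field x) \<partial>\<nu>) + ennreal s * qA = ennreal s * ?m * qW + qS"
    proof -
      have "(\<integral>\<^sup>+ x. ennreal (field x) \<partial>\<nu>) + ennreal s * qA =
        ennreal s * ?m * qW + ((\<integral>\<^sup>+ x. g x * ennreal (field x) \<partial>\<sigma>) + ennreal s * qA)"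
        by (subst int) (auto simp: qW_def add.assoc)
      also have "(\<integral>\<^sup>+ x. g x * ennreal (field x) \<partial>\<sigma>) + ennreal s * qA =
        (\<integral>\<^sup>+ x. g x * ennreal (field x) + ennreal s * (?I x * ennreal (field x)) \<partial>\<sigma>)"
        by (simp add: nn_integral_add nn_integral_cmult qA_def)
      also have "\<dots> = (\<integral>\<^sup>+ x. (g x + ennreal s * ?I x) * ennreal (field x) \<partial>\<sigma>)"
        by (simp add: distrib_right mult.assoc)
      also have "\<dots> = qS" by (simp add: gs qS_def)
      finally show ?thesis .
    qed
    have "energy \<sigma> + ennreal (2 * s) * (D + qA) \<le> energy \<nu> + ennreal (2 * s) * (D + qA)"
      by (intro add_right_mono energy_minimal \<nu>)
    also have "\<dots> = mutual_energy L \<nu> \<nu> + ennreal (2 * s) * D + 2 * ((\<integral>\<^sup>+ x. ennreal (field x) \<partial>\<nu>) + ennreal s * qA)"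
    proof -
      have "ennreal (2 * s) = 2 * ennreal s" using s by (simp add: ennreal_mult)
      then show ?thesis by (simp add: energy_def distrib_left mult.assoc add_ac)
    qed
    also have "\<dots> = ennreal s * ?m * (ennreal s * ?m * BW + (\<integral>\<^sup>+ x. \<Gamma> x \<partial>\<omega>)) + ennreal s * ?m * (\<integral>\<^sup>+ x. g x * \<Omega> x \<partial>\<sigma>) +
        ((\<integral>\<^sup>+ x. g x * \<Gamma> x \<partial>\<sigma>) + ennreal (2 * s) * D) + 2 * (ennreal s * ?m * qW + qS)"
      unfolding f1 e1 by (simp add: add_ac)
    also have "\<dots> \<le> ennreal s * ?m * (ennreal s * ?m * BW + BM) + ennreal s * ?m * BM +
        (1 + ennreal (s\<^sup>2)) * BS + 2 * (ennreal s * ?m * qW + qS)"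
      by (intro add_mono mult_left_mono b1 b2 b3) auto
    also have "\<dots> = energy \<sigma> + (ennreal (s\<^sup>2) * (?m * ?m * BW + BS) + ennreal (2 * s) * (?m * (BM + qW)))"
    proof -
      have "ennreal (s\<^sup>2) = ennreal s * ennreal s" "ennreal (2 * s) = 2 * ennreal s"
        using s by (simp_all add: power2_eq_square ennreal_mult)
      then show ?thesis
        by (simp add: energy_def BS_def[symmetric] qS_def[symmetric] algebra_simps mult_2)
    qed
    finally have "energy \<sigma> + ennreal (2 * s) * (D + qA) \<le>
      energy \<sigma> + (ennreal (s\<^sup>2) * (?m * ?m * BW + BS) + ennreal (2 * s) * (?m * (BM + qW)))" .
    moreover have "energy \<sigma> \<noteq> top"
      using BSfin qfin by (auto simp: energy_def BS_def[symmetric] qS_def[symmetric] ennreal_mult_eq_top_iff)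
    ultimately show ?thesis by (simp add: ennreal_add_left_cancel_le)
  qed
  have "D + qA \<noteq> top" using \<open>D \<le> BS\<close> \<open>qA \<le> qS\<close> BSfin qfin by (auto simp: top_unique)
  then obtain u where u: "D + qA = ennreal u" "u \<ge> 0" by (cases "D + qA") auto
  have "?m * ?m * BW + BS \<noteq> top" using fin BSfin by (auto simp: BW_def ennreal_mult_eq_top_iff)
  then obtain X where X: "?m * ?m * BW + BS = ennreal X" "X \<ge> 0" by (cases "?m * ?m * BW + BS") auto
  have "?m * (BM + qW) \<noteq> top" using fin qfin by (auto simp: BM_def ennreal_mult_eq_top_iff)
  then obtain v where v: "?m * (BM + qW) = ennreal v" "v \<ge> 0" by (cases "?m * (BM + qW)") auto
  \<comment> \<open>divide by \<open>2 s\<close> and let \<open>s\<close> tend to \<open>0\<close>\<close>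
  have "u \<le> v + e" if e: "e > 0" for e
  proof -
    define s where "s = min 1 (e / (X + 1))"
    have s: "0 < s" "s \<le> 1" using e X by (auto simp: s_def)
    have "s * X \<le> e / (X + 1) * X" using X by (intro mult_right_mono) (auto simp: s_def)
    also have "\<dots> \<le> e" using e X by (simp add: field_simps)
    finally have sX: "s * X \<le> e" .
    have "ennreal (2 * s * u) \<le> ennreal (s\<^sup>2 * X + 2 * s * v)"
      using main[OF s] s X v u by (simp add: ennreal_mult ennreal_plus)
    then have "2 * s * u \<le> s\<^sup>2 * X + 2 * s * v" using s X v by (subst (asm) ennreal_le_iff) auto
    then have "s * (2 * u) \<le> s * (s * X + 2 * v)" by (simp add: power2_eq_square algebra_simps)
    then have "2 * u \<le> s * X + 2 * v" using s by simp
    then show ?thesis using sX e by linarith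
  qed
  then have "u \<le> v" by (rule field_le_epsilon)
  then have "D + qA \<le> ?m * (BM + qW)" using u v by (simp add: ennreal_leI)
  also have "D + qA = (\<integral>\<^sup>+ x. ?I x * (potential x + ennreal (field x)) \<partial>\<sigma>)"
    by (simp add: D_def qA_def nn_integral_add[symmetric] distrib_left)
  finally show ?thesis by (simp add: BM_def qW_def)
qed

end

lemma tendsto_log_kern:
  assumes "X \<longlonglongrightarrow> x"
  shows "(\<lambda>k. log_kern L (X k) y) \<longlonglongrightarrow> log_kern L x y"
proof (cases "x = y")
  case False
  have "eventually (\<lambda>k. X k \<noteq> y) sequentially"
    using tendsto_imp_eventually_ne[OF assms False] .
  then have "eventually (\<lambda>k. ennreal (ln L - ln \<bar>X k - y\<bar>) = log_kern L (X k) y) sequentially"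
    by eventually_elim (simp add: log_kern_def)
  moreover have "(\<lambda>k. ennreal (ln L - ln \<bar>X k - y\<bar>)) \<longlonglongrightarrow> ennreal (ln L - ln \<bar>x - y\<bar>)"
    using False by (intro tendsto_intros assms) auto
  ultimately show ?thesis using False by (simp add: log_kern_def[of L x y] tendsto_cong)
next
  case True
  show ?thesis
    unfolding log_kern_def[of L x y] if_P[OF True] infinity_ennreal_def tendsto_top_iff_ennreal
  proof (intro allI impI)
    fix l :: real assume "l \<ge> 0"
    define e where "e = exp (ln L - l - 1)"
    have "e > 0" by (simp add: e_def)
    then have "eventually (\<lambda>k. dist (X k) x < e) sequentially" using assms tendstoD by blast
    then show "eventually (\<lambda>k. ennreal l < log_kern L (X k) y) sequentially"
    proof eventually_elim
      case (elim k)
      show ?case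
      proof (cases "X k = y")
        case False
        have "\<bar>X k - y\<bar> < e" using elim True by (simp add: dist_real_def)
        then have "ln \<bar>X k - y\<bar> < ln e" using False by (subst ln_less_cancel_iff) (auto simp: e_def)
        then have "l < ln L - ln \<bar>X k - y\<bar>" by (simp add: e_def)
        then show ?thesis using False \<open>l \<ge> 0\<close> by (simp add: log_kern_def ennreal_lessI)
      qed (simp add: log_kern_def)
    qed
  qed
qed

context extremal_field begin

text \<open>The modified Robin constant of the equilibrium problem, shifted by \<open>ln L + B\<close>.\<close>
definition robin :: ennreal where
  "robin = mutual_energy L \<sigma> \<sigma> + (\<integral>\<^sup>+ x. ennreal (field x) \<partial>\<sigma>)"

lemma robin_finite: "robin \<noteq> top"
  using mutual_energy_le nn_integral_field(1)[OF sigma] by (auto simp: robin_def top_unique)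

text \<open>Otherwise transporting mass from a neighbourhood of \<open>x\<close> to \<open>\<sigma>\<close> itself would lower the
  energy.\<close>
lemma potential_on_support_almost:
  assumes "x \<in> msupport \<sigma>" "e > 0" "\<epsilon> > 0"
  shows "\<exists>y\<in>{a..r}. dist y x < e \<and> potential y + ennreal (field y) \<le> robin + ennreal \<epsilon>"
proof (rule ccontr)
  assume "\<not> ?thesis"
  then have gt: "robin + ennreal \<epsilon> \<le> potential y + ennreal (field y)" if "y \<in> {a..r} \<inter> ball x e" for y
    using that by (force simp: dist_commute)
  interpret S: prob_space \<sigma> by (rule prob_space_sigma)
  note [measurable_cong] = sets_sigma
  let ?A = "{a..r} \<inter> ball x e"
  let ?m = "emeasure \<sigma> ?A"
  have "emeasure \<sigma> (ball x e) > 0" using assms by (simp add: msupport_def)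
  also have "emeasure \<sigma> (ball x e) = ?m"
    by (intro emeasure_eq_AE eventually_mono[OF AE_sigma]) (auto simp: sets_sigma)
  finally have m: "?m > 0" .
  have "(robin + ennreal \<epsilon>) * ?m = (\<integral>\<^sup>+ y. (robin + ennreal \<epsilon>) * indicator ?A y \<partial>\<sigma>)"
    by (rule nn_integral_cmult_indicator[symmetric]) (simp add: sets_sigma)
  also have "\<dots> \<le> (\<integral>\<^sup>+ y. indicator ?A y * (potential y + ennreal (field y)) \<partial>\<sigma>)"
    using gt by (intro nn_integral_mono) (auto split: split_indicator)
  also have "\<dots> \<le> ?m * robin"
    unfolding robin_def using mutual_energy_le
    by (intro transport_inequality sigma) (auto simp: top_unique)
  finally have le: "robin * ?m + ennreal \<epsilon> * ?m \<le> robin * ?m"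
    unfolding distrib_right[of robin "ennreal \<epsilon>"] mult.commute[of ?m robin] .
  have "robin * ?m \<noteq> top" using robin_finite S.emeasure_finite by (auto simp: ennreal_mult_eq_top_iff)
  then have "ennreal \<epsilon> * ?m \<le> 0"
    using le ennreal_add_left_cancel_le[of "robin * ?m" "ennreal \<epsilon> * ?m" 0] by simp
  then show False using m assms(3) by (simp add: ennreal_eq_0_iff not_le)
qed

text \<open>The bound holds at points arbitrarily close to \<open>x\<close>, and by Fatou's lemma the potential is lower
  semicontinuous.\<close>
lemma potential_on_support:
  assumes "x \<in> msupport \<sigma>" "x \<in> {a..r}"
  shows "potential x + ennreal (field x) \<le> robin"
proof -
  interpret S: prob_space \<sigma> by (rule prob_space_sigma)
  note [measurable_cong] = sets_sigma
  have "\<exists>y\<in>{a..r}. dist y x < 1 / real (Suc k) \<and> potential y + ennreal (field y) \<le> robin + ennreal (1 / real (Suc k))" for k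
    using assms by (intro potential_on_support_almost) auto
  then obtain X where X: "\<And>k. X k \<in> {a..r}" "\<And>k. dist (X k) x < 1 / real (Suc k)"
    "\<And>k. potential (X k) + ennreal (field (X k)) \<le> robin + ennreal (1 / real (Suc k))" by metis
  have "(\<lambda>k. dist (X k) x) \<longlonglongrightarrow> 0"
    by (rule tendsto_sandwich[OF _ _ tendsto_const LIMSEQ_inverse_real_of_nat])
      (use X(2) in \<open>auto simp: inverse_eq_divide less_imp_le simp del: of_nat_Suc intro!: always_eventually\<close>)
  then have lim: "X \<longlonglongrightarrow> x" by (rule tendsto_dist_iff[THEN iffD2])
  have "(\<lambda>k. field (X k)) \<longlonglongrightarrow> field x"
  proof -
    have "(\<lambda>k. Q (X k)) \<longlonglongrightarrow> Q x"
      by (rule continuous_on_tendsto_compose[OF field_continuous lim]) (use X(1) assms(2) in auto)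
    then have "(\<lambda>k. Q (X k) + B) \<longlonglongrightarrow> Q x + B" by (intro tendsto_intros)
    moreover have "field (X k) = Q (X k) + B" for k using X(1)[of k] by (simp add: field_def)
    moreover have "field x = Q x + B" using assms(2) by (simp add: field_def)
    ultimately show ?thesis by simp
  qed
  then have limf: "(\<lambda>k. log_kern L (X k) y + ennreal (field (X k))) \<longlonglongrightarrow> log_kern L x y + ennreal (field x)" for y
    by (intro tendsto_add tendsto_log_kern lim tendsto_ennrealI)
  have pot: "potential z + ennreal (field z) = (\<integral>\<^sup>+ y. log_kern L z y + ennreal (field z) \<partial>\<sigma>)" for z
    by (simp add: potential_def nn_integral_add S.emeasure_space_1)
  have "potential x + ennreal (field x) = (\<integral>\<^sup>+ y. liminf (\<lambda>k. log_kern L (X k) y + ennreal (field (X k))) \<partial>\<sigma>)"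
    unfolding pot using lim_imp_Liminf[OF sequentially_bot limf] by (intro nn_integral_cong) simp
  also have "\<dots> \<le> liminf (\<lambda>k. \<integral>\<^sup>+ y. log_kern L (X k) y + ennreal (field (X k)) \<partial>\<sigma>)"
    by (intro nn_integral_liminf) measurable
  also have "\<dots> \<le> liminf (\<lambda>k. robin + ennreal (1 / real (Suc k)))"
    using X(3) unfolding pot by (intro Liminf_mono always_eventually) auto
  also have "\<dots> = robin + ennreal 0"
  proof (rule lim_imp_Liminf[OF sequentially_bot])
    have "(\<lambda>k. 1 / real (Suc k)) \<longlonglongrightarrow> 0" using LIMSEQ_inverse_real_of_nat by (simp add: inverse_eq_divide)
    then show "(\<lambda>k. robin + ennreal (1 / real (Suc k))) \<longlonglongrightarrow> robin + ennreal 0"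
      by (intro tendsto_add tendsto_const tendsto_ennrealI)
  qed
  finally show ?thesis by simp
qed

text \<open>The constant for the unshifted problem, with the sign of \<open>\<integral> ln \<bar>x - t\<bar> d\<sigma>(t) - Q(x)\<close>.\<close>
definition level :: real where
  "level = ln L + B - enn2real robin"

lemma integrable_log_mean: "integrable \<sigma> (log_mean c d)"
proof -
  interpret S: prob_space \<sigma> by (rule prob_space_sigma)
  have "compact (log_mean c d ` {a..r})"
    by (intro compact_continuous_image continuous_on_log_mean) auto
  then obtain M where M: "\<And>x. x \<in> {a..r} \<Longrightarrow> norm (log_mean c d x) \<le> M"
    using compact_imp_bounded bounded_iff by (metis imageI)
  moreover have "log_mean c d \<in> borel_measurable \<sigma>"
    using borel_measurable_continuous_onI[OF continuous_on_log_mean] sets_sigma by (simp cong: measurable_cong_sets)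
  ultimately show ?thesis
    by (intro S.integrable_const_bound[of _ M] eventually_mono[OF AE_sigma])
qed

lemma uniform_energy_eq:
  assumes "a \<le> c" "c < d" "d \<le> r"
  shows "mutual_energy L (uniform_measure lborel {c..d}) \<sigma> + (\<integral>\<^sup>+ x. ennreal (field x) \<partial>uniform_measure lborel {c..d})
     = ennreal (ln L - (LINT t|\<sigma>. log_mean c d t) + (integral {c..d} Q / (d - c) + B))"
    "ln L - (LINT t|\<sigma>. log_mean c d t) + (integral {c..d} Q / (d - c) + B) \<ge> 0"
proof -
  interpret S: prob_space \<sigma> by (rule prob_space_sigma)
  have le: "log_mean c d y \<le> ln L" if "y \<in> {a..r}" for y
  proof (rule log_mean_upper[OF assms(2)])
    fix x assume "x \<in> {c..d}" "x \<noteq> y"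
    then show "ln \<bar>x - y\<bar> \<le> ln L" using that assms L by (subst ln_le_cancel_iff) auto
  qed
  have int: "integrable \<sigma> (\<lambda>y. ln L - log_mean c d y)" using integrable_log_mean by simp
  have ae: "AE y in \<sigma>. 0 \<le> ln L - log_mean c d y" using AE_sigma by eventually_elim (use le in auto)
  have "mutual_energy L (uniform_measure lborel {c..d}) \<sigma> = ennreal (LINT y|\<sigma>. ln L - log_mean c d y)"
    unfolding nn_integral_uniform_potential_le(1)[OF sigma assms] using int ae by (rule nn_integral_eq_integral)
  also have "(LINT y|\<sigma>. ln L - log_mean c d y) = ln L - (LINT t|\<sigma>. log_mean c d t)"
    using integrable_log_mean by (simp add: S.prob_space)
  finally have m: "mutual_energy L (uniform_measure lborel {c..d}) \<sigma> = ennreal (ln L - (LINT t|\<sigma>. log_mean c d t))" .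
  have "0 \<le> (LINT y|\<sigma>. ln L - log_mean c d y)" using ae by (rule integral_nonneg_AE)
  then have n: "0 \<le> ln L - (LINT t|\<sigma>. log_mean c d t)"
    using integrable_log_mean by (simp add: S.prob_space)
  show "mutual_energy L (uniform_measure lborel {c..d}) \<sigma> + (\<integral>\<^sup>+ x. ennreal (field x) \<partial>uniform_measure lborel {c..d})
     = ennreal (ln L - (LINT t|\<sigma>. log_mean c d t) + (integral {c..d} Q / (d - c) + B))"
    unfolding m nn_integral_field_uniform(1)[OF assms]
    by (rule ennreal_plus[symmetric, OF n nn_integral_field_uniform(2)[OF assms]])
  show "ln L - (LINT t|\<sigma>. log_mean c d t) + (integral {c..d} Q / (d - c) + B) \<ge> 0"
    using n nn_integral_field_uniform(2)[OF assms] by linarith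
qed

text \<open>Transport of all mass to the uniform distribution on \<open>{c..d}\<close>. Working with means avoids
  the exceptional sets of capacity zero in the pointwise inequality.\<close>
lemma mean_potential_upper:
  assumes "a \<le> c" "c < d" "d \<le> r"
  shows "(LINT t|\<sigma>. log_mean c d t) - integral {c..d} Q / (d - c) \<le> level"
proof -
  interpret S: prob_space \<sigma> by (rule prob_space_sigma)
  note [measurable_cong] = sets_sigma
  let ?u = "uniform_measure lborel {c..d}"
  have u: "?u \<in> prob_measures_on {a..r}" using assms by (rule uniform_in_prob_measures_on)
  have fin: "mutual_energy L ?u \<nu> \<noteq> top" if "\<nu> \<in> prob_measures_on {a..r}" for \<nu>
    using nn_integral_uniform_potential_le(2)[OF that assms] by (auto simp: top_unique)
  have "robin = (\<integral>\<^sup>+ x. indicator UNIV x * (potential x + ennreal (field x)) \<partial>\<sigma>)"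
    by (simp add: robin_def potential_def[symmetric] mutual_energy_def nn_integral_add)
  also have "\<dots> \<le> emeasure \<sigma> UNIV * (mutual_energy L ?u \<sigma> + (\<integral>\<^sup>+ x. ennreal (field x) \<partial>?u))"
    by (intro transport_inequality fin u sigma) auto
  also have "emeasure \<sigma> UNIV = 1" using S.emeasure_space_1 space_sigma by simp
  finally have "robin \<le> ennreal (ln L - (LINT t|\<sigma>. log_mean c d t) + (integral {c..d} Q / (d - c) + B))"
    by (simp add: uniform_energy_eq[OF assms])
  then have "enn2real robin \<le> ln L - (LINT t|\<sigma>. log_mean c d t) + (integral {c..d} Q / (d - c) + B)"
    using uniform_energy_eq(2)[OF assms] by (intro enn2real_leI)
  then show ?thesis by (simp add: level_def)
qed

text \<open>The inequality on the support holds at every point, so it may be integrated over \<open>{c..d}\<close>.\<close>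
lemma mean_potential_lower:
  assumes "a \<le> c" "c < d" "d \<le> r" "{c..d} \<subseteq> msupport \<sigma>"
  shows "(LINT t|\<sigma>. log_mean c d t) - integral {c..d} Q / (d - c) \<ge> level"
proof -
  let ?u = "uniform_measure lborel {c..d}"
  have u: "?u \<in> prob_measures_on {a..r}" using assms(1-3) by (rule uniform_in_prob_measures_on)
  note p = prob_measures_onD[OF u]
  interpret U: prob_space ?u by (rule p)
  have ae: "AE x in ?u. x \<in> {c..d}" using assms by (intro AE_uniform_measureI) auto
  have "ennreal (ln L - (LINT t|\<sigma>. log_mean c d t) + (integral {c..d} Q / (d - c) + B)) =
      (\<integral>\<^sup>+ x. potential x + ennreal (field x) \<partial>?u)"
    unfolding uniform_energy_eq(1)[OF assms(1-3), symmetric]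
    by (simp add: potential_def[symmetric] mutual_energy_def nn_integral_add)
  also have "\<dots> \<le> (\<integral>\<^sup>+ x. robin \<partial>?u)"
    using assms by (intro nn_integral_mono_AE eventually_mono[OF ae] potential_on_support) auto
  also have "\<dots> = robin" using U.emeasure_space_1 by simp
  also have "\<dots> = ennreal (enn2real robin)" using robin_finite by (simp add: less_top)
  finally have "ln L - (LINT t|\<sigma>. log_mean c d t) + (integral {c..d} Q / (d - c) + B) \<le> enn2real robin"
    by (subst (asm) ennreal_le_iff) auto
  then show ?thesis by (simp add: level_def)
qed

end

section \<open>Equilibrium with point charges to the right of the interval\<close>

text \<open>The function \<open>ln u + u\<^sup>2 / (2 D\<^sup>2)\<close> is concave on \<open>(0, D]\<close>.\<close>
lemma ln_le_tangent_minus_square: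
  fixes u v D :: real
  assumes "0 < u" "u \<le> D" "0 < v" "v \<le> D"
  shows "ln u \<le> ln v + (u - v) / v - (u - v)\<^sup>2 / (2 * D\<^sup>2)"
proof -
  have D: "D > 0" using assms by linarith
  define g where "g x = ln v + (x - v) / v - (x - v)\<^sup>2 / (2 * D\<^sup>2) - ln x" for x
  define g' where "g' x = 1 / v - (x - v) / D\<^sup>2 - 1 / x" for x
  have der: "(g has_real_derivative g' x) (at x)" if "x > 0" for x
    unfolding g_def g'_def using that D assms(3) by (auto intro!: derivative_eq_intros simp: field_simps)
  have sgn: "g' x = (x - v) * (1 / (x * v) - 1 / D\<^sup>2)" if "x > 0" for x
    using that assms D unfolding g'_def by (simp add: field_simps)
  have nn: "1 / (x * v) - 1 / D\<^sup>2 \<ge> 0" if "0 < x" "x \<le> D" for x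
  proof -
    have "x * v \<le> D * D" using that assms by (intro mult_mono) auto
    then show ?thesis using that assms D by (simp add: power2_eq_square frac_le)
  qed
  have "g u \<ge> g v"
  proof (cases "u \<ge> v")
    case True
    show ?thesis
    proof (rule DERIV_nonneg_imp_nondecreasing[of v u g])
      show "v \<le> u" by (rule True)
      fix x assume x: "v \<le> x" "x \<le> u"
      then have "g' x \<ge> 0" using assms nn[of x] by (simp add: sgn)
      then show "\<exists>y. (g has_real_derivative y) (at x) \<and> 0 \<le> y" using der[of x] x assms by auto
    qed
  next
    case False
    show ?thesis
    proof (rule DERIV_nonpos_imp_nonincreasing[of u v g])
      show "u \<le> v" using False by simp
      fix x assume x: "u \<le> x" "x \<le> v"
      then have "g' x \<le> 0" using assms nn[of x] by (simp add: sgn mult_nonpos_nonneg)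
      then show "\<exists>y. (g has_real_derivative y) (at x) \<and> y \<le> 0" using der[of x] x assms by auto
    qed
  qed
  then show ?thesis by (simp add: g_def)
qed

text \<open>The function \<open>p\<close> below is the negative of the external field: unit mass, divided equally among the
  points \<open>y j\<close>, to the right of the interval.\<close>
locale point_field =
  fixes n :: nat and y :: "nat \<Rightarrow> real" and a r a2 b2 :: real
  assumes n: "n \<ge> 1" and ar: "a < r" and ra2: "r < a2"
    and y: "\<And>j. j < n \<Longrightarrow> y j \<in> {a2..b2}"
begin

definition p :: "real \<Rightarrow> real" where
  "p x = (\<Sum>j<n. ln (y j - x)) / real n"

text \<open>The force exerted by the charges: minus the derivative of \<open>p\<close>.\<close>
definition repulsion :: "real \<Rightarrow> real" where
  "repulsion x = (\<Sum>j<n. 1 / (y j - x)) / real n"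

text \<open>A lower bound for \<open>- p''\<close> on the interval.\<close>
definition \<kappa> :: real where
  "\<kappa> = 1 / (b2 - a)\<^sup>2"

lemma a2b2: "a2 \<le> b2" using y[of 0] n by auto

lemma kappa_pos: "\<kappa> > 0" using ar ra2 a2b2 by (simp add: \<kappa>_def)

lemma average_le:
  assumes "\<And>j. j < n \<Longrightarrow> f j \<le> (c :: real)"
  shows "(\<Sum>j<n. f j) / real n \<le> c"
proof -
  have "(\<Sum>j<n. f j) \<le> (\<Sum>j<n. c)" using assms by (intro sum_mono) auto
  then show ?thesis using n by (simp add: divide_le_eq mult.commute)
qed

lemma p_tangent:
  assumes "x \<in> {a..r}" "x0 \<in> {a..r}"
  shows "p x \<le> p x0 - (x - x0) * repulsion x0 - \<kappa> / 2 * (x - x0)\<^sup>2"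
proof -
  have "ln (y j - x) \<le> ln (y j - x0) - (x - x0) * (1 / (y j - x0)) - \<kappa> / 2 * (x - x0)\<^sup>2" if "j < n" for j
    using ln_le_tangent_minus_square[of "y j - x" "b2 - a" "y j - x0"] y[OF that] assms ra2
    by (simp add: \<kappa>_def power2_commute diff_divide_distrib)
  then have "(\<Sum>j<n. ln (y j - x)) \<le> (\<Sum>j<n. ln (y j - x0) - (x - x0) * (1 / (y j - x0)) - \<kappa> / 2 * (x - x0)\<^sup>2)"
    by (intro sum_mono) auto
  also have "\<dots> = (\<Sum>j<n. ln (y j - x0)) - (x - x0) * (\<Sum>j<n. 1 / (y j - x0)) - real n * (\<kappa> / 2 * (x - x0)\<^sup>2)"
    by (simp only: sum_subtractf sum_distrib_left sum_constant card_lessThan)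
  also have "\<dots> = real n * (p x0 - (x - x0) * repulsion x0 - \<kappa> / 2 * (x - x0)\<^sup>2)"
    using n by (simp add: p_def repulsion_def right_diff_distrib)
  finally show ?thesis using n by (simp add: p_def[of x] divide_le_eq mult.commute)
qed

lemma repulsion_bounds:
  assumes "x \<in> {a..r}"
  shows "0 \<le> repulsion x" "repulsion x \<le> 1 / (a2 - r)"
proof -
  have yx: "y j - x \<ge> a2 - r" if "j < n" for j using y[OF that] assms by auto
  show "0 \<le> repulsion x" unfolding repulsion_def
  proof (intro divide_nonneg_nonneg sum_nonneg)
    fix j assume "j \<in> {..<n}"
    then show "0 \<le> y j - x" using yx[of j] ra2 by simp
  qed auto
  show "repulsion x \<le> 1 / (a2 - r)" unfolding repulsion_def
  proof (rule average_le)
    fix j assume "j < n"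
    then show "1 / (y j - x) \<le> 1 / (a2 - r)" using yx[of j] ra2 by (intro frac_le) auto
  qed
qed

lemma p_decreasing:
  assumes "a \<le> x" "x \<le> x'" "x' \<le> r"
  shows "p x \<le> p x' + (x' - x) / (a2 - r)"
proof -
  have "p x \<le> p x' - (x - x') * repulsion x'"
  proof -
    have "0 \<le> \<kappa> / 2 * (x - x')\<^sup>2" using kappa_pos by simp
    then show ?thesis using p_tangent[of x x'] assms by simp
  qed
  also have "\<dots> = p x' + (x' - x) * repulsion x'" by (simp add: algebra_simps)
  also have "\<dots> \<le> p x' + (x' - x) * (1 / (a2 - r))"
    using repulsion_bounds[of x'] assms by (intro add_left_mono mult_left_mono) auto
  finally show ?thesis by simp
qed

lemma p_continuous: "continuous_on {a..r} p"
  unfolding p_def[abs_def] divide_inverse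
proof (intro continuous_intros ballI)
  fix j x assume "j \<in> {..<n}" "x \<in> {a..r}"
  then have "y j - x > 0" using y[of j] ra2 by auto
  then show "y j - x \<noteq> 0" by simp
qed

end

text \<open>The two variational inequalities in terms of means; the second one expresses that the support of
  \<open>\<sigma>\<close> reaches from \<open>a\<close> to \<open>hi\<close>.\<close>
locale equilibrium = point_field +
  fixes \<sigma> :: "real measure" and hi \<Phi> :: real
  assumes prob: "prob_space \<sigma>" and sets_borel: "sets \<sigma> = sets borel" and AE_I: "AE t in \<sigma>. t \<in> {a..r}"
    and hi: "hi \<le> r"
    and mean_upper: "\<And>c d. a \<le> c \<Longrightarrow> c < d \<Longrightarrow> d \<le> r \<Longrightarrow>
      (LINT t|\<sigma>. log_mean c d t) + integral {c..d} p / (d - c) \<le> \<Phi>"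
    and mean_lower: "\<And>c d. a \<le> c \<Longrightarrow> c < d \<Longrightarrow> d \<le> hi \<Longrightarrow>
      (LINT t|\<sigma>. log_mean c d t) + integral {c..d} p / (d - c) \<ge> \<Phi>"
begin

interpretation prob_space \<sigma> by (rule prob)

lemma integrable_continuous:
  assumes "continuous_on UNIV (f :: real \<Rightarrow> real)"
  shows "integrable \<sigma> f"
proof -
  have "compact (f ` {a..r})"
    using assms continuous_on_subset by (intro compact_continuous_image) blast+
  then obtain M where M: "\<And>x. x \<in> {a..r} \<Longrightarrow> norm (f x) \<le> M"
    using compact_imp_bounded bounded_iff by (metis imageI)
  moreover have "f \<in> borel_measurable \<sigma>"
    using borel_measurable_continuous_onI[OF assms] sets_borel by (simp cong: measurable_cong_sets)
  ultimately show ?thesis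
    by (intro integrable_const_bound[of _ M] eventually_mono[OF AE_I])
qed

lemma integrable_log_mean: "integrable \<sigma> (log_mean c d)"
  by (intro integrable_continuous continuous_on_log_mean)

text \<open>The means of the logarithmic potential plus \<open>p\<close> over three adjacent intervals in the support are equal
  to \<open>\<Phi>\<close>, so the second difference
  of the logarithmic potential balances that of \<open>p\<close>, which is strictly concave. Mass outside of the three
  intervals contributes to this second difference with the wrong sign.\<close>
lemma mass_lower_bound:
  assumes "\<eta> > 0" "a \<le> c" "c + 3 * \<eta> \<le> hi"
  shows "\<kappa> * \<eta>\<^sup>2 / 8 \<le> measure \<sigma> {c..c + 3 * \<eta>}"
proof -
  let ?J = "{c..c + 3 * \<eta>}"
  define Bf where "Bf t = log_mean c (c + \<eta>) t - 2 * log_mean (c + \<eta>) (c + 2 * \<eta>) t + log_mean (c + 2 * \<eta>) (c + 3 * \<eta>) t" for t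
  have Bf: "Bf t \<le> 8 * indicator ?J t" for t
  proof (cases "t \<in> ?J")
    case False
    then show ?thesis using second_difference_log_mean[of \<eta> t c] assms by (auto simp: Bf_def)
  next
    case True
    have up: "log_mean u (u + \<eta>) t \<le> ln (3 * \<eta>)" if "u \<ge> c" "u + \<eta> \<le> c + 3 * \<eta>" for u
      using that True assms by (intro log_mean_upper) (auto simp del: ln_mult intro!: ln_le_cancel_iff[THEN iffD2])
    have "ln (3::real) \<le> 2" using ln_le_minus_one[of "3::real"] by simp
    then show ?thesis
      using up[of c] up[of "c + 2 * \<eta>"] log_mean_ge[of \<eta> "c + \<eta>" t] assms True
      by (simp add: Bf_def ln_mult algebra_simps)
  qed
  have "(LINT t|\<sigma>. Bf t) \<le> (LINT t|\<sigma>. 8 * indicator ?J t)"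
  proof (rule integral_mono)
    show "integrable \<sigma> Bf" unfolding Bf_def by (intro Bochner_Integration.integrable_add Bochner_Integration.integrable_diff integrable_mult_right integrable_log_mean)
    show "integrable \<sigma> (\<lambda>t. (8::real) * indicator ?J t)"
      by (intro integrable_mult_right integrable_real_indicator) (auto simp: sets_borel less_top[symmetric])
  qed (rule Bf)
  also have "\<dots> = 8 * measure \<sigma> ?J" by (simp add: sets_borel)
  finally have 1: "(LINT t|\<sigma>. Bf t) \<le> 8 * measure \<sigma> ?J" .
  have 2: "(LINT t|\<sigma>. Bf t) = (LINT t|\<sigma>. log_mean c (c + \<eta>) t) - 2 * (LINT t|\<sigma>. log_mean (c + \<eta>) (c + 2 * \<eta>) t)
      + (LINT t|\<sigma>. log_mean (c + 2 * \<eta>) (c + 3 * \<eta>) t)"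
    unfolding Bf_def by (simp add: integrable_log_mean)
  have pc: "continuous_on {u..v} p" if "a \<le> u" "v \<le> r" for u v
    using p_continuous that by (auto intro: continuous_on_subset)
  have s1: "integral {c + \<eta>..c + 2 * \<eta>} p = integral {c..c + \<eta>} (\<lambda>x. p (x + \<eta>))"
    using integral_shift[of c \<eta> "c + \<eta>" p] pc[of "c + \<eta>" "c + 2 * \<eta>"] assms hi by (simp add: o_def algebra_simps)
  have s2: "integral {c + 2 * \<eta>..c + 3 * \<eta>} p = integral {c..c + \<eta>} (\<lambda>x. p (x + 2 * \<eta>))"
    using integral_shift[of c "2 * \<eta>" "c + \<eta>" p] pc[of "c + 2 * \<eta>" "c + 3 * \<eta>"] assms hi by (simp add: o_def algebra_simps)
  have int: "(\<lambda>x. p (x + v)) integrable_on {c..c + \<eta>}" if "0 \<le> v" "v \<le> 2 * \<eta>" for v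
    using that assms hi
    by (intro integrable_continuous_real continuous_on_compose2[OF p_continuous] continuous_intros) auto
  have "integral {c..c + \<eta>} p - 2 * integral {c + \<eta>..c + 2 * \<eta>} p + integral {c + 2 * \<eta>..c + 3 * \<eta>} p =
    integral {c..c + \<eta>} (\<lambda>x. p x - 2 * p (x + \<eta>) + p (x + 2 * \<eta>))"
    unfolding s1 s2 using int[of 0] int[of \<eta>] int[of "2 * \<eta>"] assms
    by (simp add: integral_add integral_diff integrable_diff)
  also have "\<dots> \<le> integral {c..c + \<eta>} (\<lambda>x. - \<kappa> * \<eta>\<^sup>2)"
  proof (rule integral_le)
    show "(\<lambda>x. p x - 2 * p (x + \<eta>) + p (x + 2 * \<eta>)) integrable_on {c..c + \<eta>}"
      using int[of 0] int[of \<eta>] int[of "2 * \<eta>"] assms by (intro integrable_add integrable_diff integrable_on_mult_right) auto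
    fix x assume x: "x \<in> {c..c + \<eta>}"
    have "p x \<le> p (x + \<eta>) - (x - (x + \<eta>)) * repulsion (x + \<eta>) - \<kappa> / 2 * (x - (x + \<eta>))\<^sup>2"
      by (rule p_tangent) (use x assms hi in auto)
    moreover have "p (x + 2 * \<eta>) \<le> p (x + \<eta>) - (x + 2 * \<eta> - (x + \<eta>)) * repulsion (x + \<eta>) - \<kappa> / 2 * (x + 2 * \<eta> - (x + \<eta>))\<^sup>2"
      by (rule p_tangent) (use x assms hi in auto)
    ultimately show "p x - 2 * p (x + \<eta>) + p (x + 2 * \<eta>) \<le> - \<kappa> * \<eta>\<^sup>2"
      by (simp add: algebra_simps)
  qed auto
  also have "\<dots> = \<eta> * (- \<kappa> * \<eta>\<^sup>2)" using assms by simp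
  finally have "(integral {c..c + \<eta>} p - 2 * integral {c + \<eta>..c + 2 * \<eta>} p + integral {c + 2 * \<eta>..c + 3 * \<eta>} p) / \<eta> \<le> - \<kappa> * \<eta>\<^sup>2"
    using assms by (simp add: divide_le_eq mult.commute)
  then have 3: "integral {c..c + \<eta>} p / \<eta> - 2 * (integral {c + \<eta>..c + 2 * \<eta>} p / \<eta>) + integral {c + 2 * \<eta>..c + 3 * \<eta>} p / \<eta> \<le> - \<kappa> * \<eta>\<^sup>2"
    by (simp add: add_divide_distrib diff_divide_distrib)
  have "(LINT t|\<sigma>. log_mean c (c + \<eta>) t) + integral {c..c + \<eta>} p / \<eta> \<ge> \<Phi>"
    using mean_lower[of c "c + \<eta>"] assms by simp
  moreover have "(LINT t|\<sigma>. log_mean (c + 2 * \<eta>) (c + 3 * \<eta>) t) + integral {c + 2 * \<eta>..c + 3 * \<eta>} p / \<eta> \<ge> \<Phi>"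
    using mean_lower[of "c + 2 * \<eta>" "c + 3 * \<eta>"] assms by simp
  moreover have "(LINT t|\<sigma>. log_mean (c + \<eta>) (c + 2 * \<eta>) t) + integral {c + \<eta>..c + 2 * \<eta>} p / \<eta> \<le> \<Phi>"
    using mean_upper[of "c + \<eta>" "c + 2 * \<eta>"] assms hi by simp
  ultimately show ?thesis using 1 2 3 by linarith
qed

end

section \<open>Hat functions on a grid with one large gap\<close>

text \<open>The points \<open>\<dots>, - 2 h, - h, 0\<close> and \<open>\<delta>, \<delta> + h, \<delta> + 2 h, \<dots>\<close>: the gap is the cell from
  index \<open>0\<close> to index \<open>1\<close>.\<close>
definition grid :: "real \<Rightarrow> real \<Rightarrow> int \<Rightarrow> real" where
  "grid \<delta> h l = (if l \<le> 0 then of_int l * h else \<delta> + of_int (l - 1) * h)"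

text \<open>The piecewise linear function that is \<open>1\<close> at the grid point with index \<open>l\<close> and \<open>0\<close> at the others.
  The hat functions distribute a point mass to the two ends of its cell and keep the centre of mass.\<close>
definition hat :: "real \<Rightarrow> real \<Rightarrow> int \<Rightarrow> real \<Rightarrow> real" where
  "hat \<delta> h l z = max 0 (min ((z - grid \<delta> h (l - 1)) / (grid \<delta> h l - grid \<delta> h (l - 1)))
     ((grid \<delta> h (l + 1) - z) / (grid \<delta> h (l + 1) - grid \<delta> h l)))"

lemma grid_0 [simp]: "grid \<delta> h 0 = 0" and grid_1 [simp]: "grid \<delta> h 1 = \<delta>"
  by (simp_all add: grid_def)

lemma hat_nonneg: "hat \<delta> h l z \<ge> 0" by (simp add: hat_def)

lemma continuous_on_hat: "continuous_on A (hat \<delta> h l)"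
  unfolding hat_def[abs_def] divide_inverse by (intro continuous_intros)

locale gap_grid =
  fixes \<delta> h :: real
  assumes h: "h > 0" and h\<delta>: "h \<le> \<delta>"
begin

abbreviation "g \<equiv> grid \<delta> h"

lemma step: "g (l + 1) - g l = (if l = 0 then \<delta> else h)"
  by (auto simp: grid_def algebra_simps)

lemma step_ge: "g (l + 1) - g l \<ge> h" using h\<delta> by (simp add: step)

lemma step_pos: "g (l + 1) - g l > 0" using step_ge[of l] h by linarith

lemma step_pos': "g l - g (l - 1) > 0" using step_pos[of "l - 1"] by simp

lemma grid_mono: "l \<le> m \<Longrightarrow> g l \<le> g m"
proof (induction m rule: int_ge_induct)
  case (step i)
  then show ?case using step_pos[of i] by linarith
qed simp

lemma hat_cell:
  assumes "g k \<le> z" "z \<le> g (k + 1)"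
  shows "hat \<delta> h k z = (g (k + 1) - z) / (g (k + 1) - g k)"
    "hat \<delta> h (k + 1) z = (z - g k) / (g (k + 1) - g k)"
    "\<And>l. l \<noteq> k \<Longrightarrow> l \<noteq> k + 1 \<Longrightarrow> hat \<delta> h l z = 0"
proof -
  let ?w = "g (k + 1) - g k"
  have w: "?w > 0" by (rule step_pos)
  have in01: "0 \<le> (g (k + 1) - z) / ?w" "(g (k + 1) - z) / ?w \<le> 1" "0 \<le> (z - g k) / ?w" "(z - g k) / ?w \<le> 1"
    using assms w by (simp_all add: divide_le_eq)
  have "1 \<le> (z - g (k - 1)) / (g k - g (k - 1))"
    using assms step_pos'[of k] by (simp add: le_divide_eq)
  then show "hat \<delta> h k z = (g (k + 1) - z) / ?w" using in01 by (simp add: hat_def)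
  have "1 \<le> (g (k + 1 + 1) - z) / (g (k + 1 + 1) - g (k + 1))"
    using assms step_pos[of "k + 1"] by (simp add: le_divide_eq)
  then show "hat \<delta> h (k + 1) z = (z - g k) / ?w" using in01 by (simp add: hat_def)
  fix l assume l: "l \<noteq> k" "l \<noteq> k + 1"
  show "hat \<delta> h l z = 0"
  proof (cases "l < k")
    case True
    then have "g (l + 1) \<le> z" using grid_mono[of "l + 1" k] assms by simp
    then have "(g (l + 1) - z) / (g (l + 1) - g l) \<le> 0"
      using step_pos[of l] by (simp add: divide_nonpos_pos)
    then show ?thesis by (auto simp: hat_def)
  next
    case False
    then have "z \<le> g (l - 1)" using l grid_mono[of "k + 1" "l - 1"] assms by simp
    then have "(z - g (l - 1)) / (g l - g (l - 1)) \<le> 0"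
      using step_pos'[of l] by (simp add: divide_nonpos_pos)
    then show ?thesis by (auto simp: hat_def)
  qed
qed

lemma cell_exists:
  assumes "N \<ge> 1" "- of_int N * h \<le> z" "z \<le> \<delta> + of_int (N - 1) * h"
  shows "\<exists>k\<in>{- N..N - 1}. g k \<le> z \<and> z \<le> g (k + 1)"
proof -
  consider "z < 0" | "0 \<le> z" "z \<le> \<delta>" | "z > \<delta>" by linarith
  then show ?thesis
  proof cases
    case 1
    define k where "k = \<lfloor>z / h\<rfloor>"
    have "z / h < 0" using 1 h by (simp add: divide_neg_pos)
    then have "\<lfloor>z / h\<rfloor> < 0" by simp
    then have k: "k \<le> - 1" unfolding k_def by linarith
    have "of_int (- N) \<le> z / h" using assms h by (simp add: le_divide_eq)
    then have "- N \<le> k" unfolding k_def by (simp only: le_floor_iff)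
    moreover have "of_int k \<le> z / h" "z / h \<le> of_int k + 1" unfolding k_def by linarith+
    then have "of_int k * h \<le> z" "z \<le> (of_int k + 1) * h"
      using h by (simp_all add: pos_le_divide_eq pos_divide_le_eq)
    ultimately show ?thesis using k assms by (intro bexI[of _ k]) (auto simp: grid_def)
  next
    case 2
    then show ?thesis using assms by (intro bexI[of _ 0]) auto
  next
    case 3
    define k where "k = \<lceil>(z - \<delta>) / h\<rceil>"
    have "0 < (z - \<delta>) / h" using 3 h by simp
    then have k: "k \<ge> 1" by (simp add: k_def)
    have "(z - \<delta>) / h \<le> of_int (N - 1)" using assms h by (simp add: divide_le_eq)
    then have "k \<le> N - 1" unfolding k_def by (simp only: ceiling_le_iff)
    moreover have "of_int k - 1 \<le> (z - \<delta>) / h" "(z - \<delta>) / h \<le> of_int k" unfolding k_def by linarith+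
    then have "(of_int k - 1) * h \<le> z - \<delta>" "z - \<delta> \<le> of_int k * h"
      using h by (simp_all add: pos_le_divide_eq pos_divide_le_eq)
    ultimately show ?thesis using k assms by (intro bexI[of _ k]) (auto simp: grid_def)
  qed
qed

lemma sum_hat_cell:
  assumes "g k \<le> z" "z \<le> g (k + 1)" "k \<in> {- N..N - 1}"
  shows "(\<Sum>l\<in>{- N..N}. hat \<delta> h l z * \<phi> l) =
    ((g (k + 1) - z) * \<phi> k + (z - g k) * \<phi> (k + 1)) / (g (k + 1) - g k)"
proof -
  have "(\<Sum>l\<in>{- N..N}. hat \<delta> h l z * \<phi> l) = (\<Sum>l\<in>{k, k + 1}. hat \<delta> h l z * \<phi> l)"
    using assms hat_cell(3)[OF assms(1,2)] by (intro sum.mono_neutral_right) auto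
  then show ?thesis using hat_cell(1,2)[OF assms(1,2)] by (simp add: add_divide_distrib)
qed

text \<open>In the small cells only the distance to the grid points counts; in the gap the centre of mass does,
  and the second assumption is a bound for the linear interpolation of \<open>\<phi>\<close>.\<close>
lemma sum_hat_le:
  assumes N: "N \<ge> 1" and z: "- of_int N * h \<le> z" "z \<le> \<delta> + of_int (N - 1) * h"
    and out: "\<And>v. \<bar>v - z\<bar> \<le> h \<Longrightarrow> \<phi> v \<le> M"
    and gap: "0 \<le> z \<Longrightarrow> z \<le> \<delta> \<Longrightarrow> ((\<delta> - z) * \<phi> 0 + z * \<phi> \<delta>) / \<delta> \<le> M"
  shows "(\<Sum>l\<in>{- N..N}. hat \<delta> h l z * \<phi> (g l)) \<le> M"
proof -
  obtain k where k: "k \<in> {- N..N - 1}" "g k \<le> z" "z \<le> g (k + 1)" using cell_exists[OF N z] by blast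
  note s = sum_hat_cell[OF k(2,3,1), of "\<lambda>l. \<phi> (g l)"]
  show ?thesis
  proof (cases "k = 0")
    case True
    then show ?thesis using s gap k by simp
  next
    case False
    then have w: "g (k + 1) - g k = h" by (simp add: step)
    have "\<phi> (g k) \<le> M" "\<phi> (g (k + 1)) \<le> M" using k w by (auto intro!: out)
    then have "(g (k + 1) - z) * \<phi> (g k) + (z - g k) * \<phi> (g (k + 1)) \<le> (g (k + 1) - z) * M + (z - g k) * M"
      using k by (intro add_mono mult_left_mono) auto
    also have "\<dots> = M * (g (k + 1) - g k)" by (simp add: algebra_simps)
    also have "\<dots> = M * h" by (simp only: w)
    finally have "((g (k + 1) - z) * \<phi> (g k) + (z - g k) * \<phi> (g (k + 1))) / h \<le> M"
      using h by (simp only: pos_divide_le_eq)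
    then show ?thesis by (simp only: s w)
  qed
qed

lemma sum_hat:
  assumes "N \<ge> 1" "- of_int N * h \<le> z" "z \<le> \<delta> + of_int (N - 1) * h"
  shows "(\<Sum>l\<in>{- N..N}. hat \<delta> h l z) = 1"
proof -
  obtain k where k: "k \<in> {- N..N - 1}" "g k \<le> z" "z \<le> g (k + 1)" using cell_exists[OF assms] by blast
  show ?thesis using sum_hat_cell[OF k(2,3,1), of "\<lambda>_. 1"] step_pos[of k] by simp
qed

lemma hat_Lipschitz: "\<bar>hat \<delta> h l z - hat \<delta> h l z'\<bar> \<le> \<bar>z - z'\<bar> / h"
proof -
  let ?w1 = "g l - g (l - 1)" and ?w2 = "g (l + 1) - g l"
  have w: "?w1 \<ge> h" "?w2 \<ge> h" using step_ge[of "l - 1"] step_ge[of l] by simp_all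
  have *: "\<bar>max 0 (min u v) - max 0 (min u' v')\<bar> \<le> d" if "\<bar>u - u'\<bar> \<le> d" "\<bar>v - v'\<bar> \<le> d" for u v u' v' d :: real
    using that unfolding abs_le_iff by linarith
  show ?thesis unfolding hat_def
  proof (rule *)
    have "\<bar>(z - g (l - 1)) / ?w1 - (z' - g (l - 1)) / ?w1\<bar> = \<bar>z - z'\<bar> / ?w1"
      using w h by (simp add: diff_divide_distrib[symmetric])
    also have "\<dots> \<le> \<bar>z - z'\<bar> / h" using w h by (intro divide_left_mono) auto
    finally show "\<bar>(z - g (l - 1)) / ?w1 - (z' - g (l - 1)) / ?w1\<bar> \<le> \<bar>z - z'\<bar> / h" .
    have "\<bar>(g (l + 1) - z) / ?w2 - (g (l + 1) - z') / ?w2\<bar> = \<bar>z - z'\<bar> / ?w2"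
      using w h by (simp add: diff_divide_distrib[symmetric] abs_minus_commute)
    also have "\<dots> \<le> \<bar>z - z'\<bar> / h" using w h by (intro divide_left_mono) auto
    finally show "\<bar>(g (l + 1) - z) / ?w2 - (g (l + 1) - z') / ?w2\<bar> \<le> \<bar>z - z'\<bar> / h" .
  qed
qed

lemma grid_outside_gap: "g l \<le> 0 \<or> g l \<ge> \<delta>"
  using grid_mono[of l 0] grid_mono[of 1 l] by (cases "l \<le> 0") auto

lemma grid_bounds:
  assumes "l \<in> {- N..N}" "N \<ge> 1"
  shows "g l \<in> {- of_int N * h..\<delta> + of_int (N - 1) * h}"
proof -
  have "g (- N) = - of_int N * h" "g N = \<delta> + of_int (N - 1) * h" using assms by (auto simp: grid_def)
  then show ?thesis using grid_mono[of "- N" l] grid_mono[of l N] assms by auto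
qed

end

section \<open>Polynomials that peak at a prescribed point\<close>

lemma ln_abs_tangent:
  fixes x x0 v :: real
  assumes "(x - v) * (x0 - v) > 0"
  shows "ln \<bar>x - v\<bar> \<le> ln \<bar>x0 - v\<bar> + (x - x0) / (x0 - v)"
proof -
  have nz: "x - v \<noteq> 0" "x0 - v \<noteq> 0" using assms by auto
  have q: "(x - v) / (x0 - v) > 0" using assms by (simp add: zero_less_divide_iff zero_less_mult_iff)
  have "ln \<bar>x - v\<bar> - ln \<bar>x0 - v\<bar> = ln \<bar>(x - v) / (x0 - v)\<bar>" using nz by (simp add: ln_div abs_divide)
  also have "\<bar>(x - v) / (x0 - v)\<bar> = (x - v) / (x0 - v)" using q by (rule abs_of_pos)
  also have "ln \<dots> \<le> (x - v) / (x0 - v) - 1" by (rule ln_le_minus_one[OF q])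
  also have "\<dots> = (x - x0) / (x0 - v)" using nz by (simp add: field_simps)
  finally show ?thesis by simp
qed

text \<open>The condition on \<open>N\<close> makes the translated grid cover \<open>{a..r}\<close>, wherever the gap is placed
  around \<open>x0\<close>.\<close>
locale gap_configuration = equilibrium n y a r a2 b2 \<sigma> hi \<Phi> + gap_grid \<delta> h
  for n y a r a2 b2 \<sigma> hi \<Phi> \<delta> h +
  fixes N :: int and x0 :: real
  assumes N: "N \<ge> 1" "of_int N * h \<ge> r - a + \<delta> + h"
    and x0: "a \<le> x0 - \<delta>" "x0 + \<delta> \<le> hi"
begin

interpretation prob_space \<sigma> by (rule prob)

text \<open>The left end of the gap: \<open>x0\<close> divides the gap in the ratio \<open>1 - s\<close> to \<open>s\<close>.\<close>
definition \<alpha> :: "real \<Rightarrow> real" where "\<alpha> s = x0 - (1 - s) * \<delta>"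

definition node :: "real \<Rightarrow> int \<Rightarrow> real" where "node s l = \<alpha> s + g l"

definition mass :: "real \<Rightarrow> int \<Rightarrow> real" where "mass s l = (LINT t|\<sigma>. hat \<delta> h l (t - \<alpha> s))"

abbreviation "I \<equiv> {- N..N}"

lemma delta_pos: "\<delta> > 0" using h h\<delta> by linarith

lemma node_0 [simp]: "node s 0 = \<alpha> s" and node_1 [simp]: "node s 1 = \<alpha> s + \<delta>" by (simp_all add: node_def)

lemma alpha_range:
  assumes "s \<in> {0..1}"
  shows "x0 - \<delta> \<le> \<alpha> s" "\<alpha> s \<le> x0"
proof -
  have "0 \<le> (1 - s) * \<delta>" "0 \<le> s * \<delta>" using assms delta_pos by auto
  then show "x0 - \<delta> \<le> \<alpha> s" "\<alpha> s \<le> x0" by (auto simp: \<alpha>_def algebra_simps)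
qed

lemma z_range:
  assumes "s \<in> {0..1}" "t \<in> {a..r}"
  shows "- of_int N * h \<le> t - \<alpha> s" "t - \<alpha> s \<le> \<delta> + of_int (N - 1) * h" "\<bar>t - \<alpha> s\<bar> \<le> r - a"
  using alpha_range[OF assms(1)] assms(2) N x0 hi h delta_pos by (auto simp: algebra_simps abs_le_iff)

lemma integrable_hat: "integrable \<sigma> (\<lambda>t. hat \<delta> h l (t - \<alpha> s))"
  by (intro integrable_continuous continuous_on_compose2[OF continuous_on_hat[of UNIV]] continuous_intros) auto

lemma mass_nonneg: "mass s l \<ge> 0"
  unfolding mass_def by (intro Bochner_Integration.integral_nonneg hat_nonneg)

lemma sum_mass:
  "(\<Sum>l\<in>I. mass s l * \<phi> l) = (LINT t|\<sigma>. (\<Sum>l\<in>I. hat \<delta> h l (t - \<alpha> s) * \<phi> l))"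
  "integrable \<sigma> (\<lambda>t. \<Sum>l\<in>I. hat \<delta> h l (t - \<alpha> s) * \<phi> l)"
proof -
  show "(\<Sum>l\<in>I. mass s l * \<phi> l) = (LINT t|\<sigma>. (\<Sum>l\<in>I. hat \<delta> h l (t - \<alpha> s) * \<phi> l))"
    unfolding mass_def by (subst Bochner_Integration.integral_sum) (auto simp: integrable_hat)
  show "integrable \<sigma> (\<lambda>t. \<Sum>l\<in>I. hat \<delta> h l (t - \<alpha> s) * \<phi> l)" by (auto simp: integrable_hat)
qed

lemma sum_mass_le:
  assumes "integrable \<sigma> F" "\<And>t. t \<in> {a..r} \<Longrightarrow> (\<Sum>l\<in>I. hat \<delta> h l (t - \<alpha> s) * \<phi> l) \<le> F t"
  shows "(\<Sum>l\<in>I. mass s l * \<phi> l) \<le> (LINT t|\<sigma>. F t)"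
  unfolding sum_mass(1) by (intro integral_mono_AE sum_mass(2) assms eventually_mono[OF AE_I])

lemma total_mass:
  assumes "s \<in> {0..1}"
  shows "(\<Sum>l\<in>I. mass s l) = 1"
proof -
  have "(\<Sum>l\<in>I. mass s l * 1) = (LINT t|\<sigma>. (\<Sum>l\<in>I. hat \<delta> h l (t - \<alpha> s) * 1))" by (rule sum_mass)
  also have "\<dots> = (LINT t|\<sigma>. 1)"
    using sum_mass(2)[where \<phi> = "\<lambda>_. 1"] assms N z_range
    by (intro integral_cong_AE eventually_mono[OF AE_I]) (auto simp: sum_hat)
  finally show ?thesis by (simp add: prob_space)
qed

definition end_mass :: real where "end_mass = \<kappa> * (\<delta> / 6)\<^sup>2 / 16"

lemma end_mass_pos: "end_mass > 0" using kappa_pos delta_pos by (simp add: end_mass_def)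

lemma mass_gap_ends:
  assumes "s \<in> {0..1}"
  shows "mass s 0 \<ge> end_mass" "mass s 1 \<ge> end_mass"
proof -
  have *: "measure \<sigma> {u..u + 3 * (\<delta> / 6)} / 2 \<le> mass s l"
    if "\<And>t. t \<in> {u..u + 3 * (\<delta> / 6)} \<Longrightarrow> hat \<delta> h l (t - \<alpha> s) \<ge> 1 / 2" for u l
  proof -
    have "(LINT t|\<sigma>. (1 / 2 :: real) * indicator {u..u + 3 * (\<delta> / 6)} t) \<le> mass s l"
      unfolding mass_def
    proof (rule integral_mono)
      show "integrable \<sigma> (\<lambda>t. (1 / 2 :: real) * indicator {u..u + 3 * (\<delta> / 6)} t)"
        by (intro integrable_mult_right integrable_real_indicator) (auto simp: sets_borel less_top[symmetric])
      show "1 / 2 * indicator {u..u + 3 * (\<delta> / 6)} t \<le> hat \<delta> h l (t - \<alpha> s)" for t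
        using that[of t] hat_nonneg by (auto split: split_indicator)
    qed (rule integrable_hat)
    then show ?thesis by (simp add: sets_borel)
  qed
  have low: "\<kappa> * (\<delta> / 6)\<^sup>2 / 8 \<le> measure \<sigma> {u..u + 3 * (\<delta> / 6)}" if "a \<le> u" "u + 3 * (\<delta> / 6) \<le> hi" for u
    using that delta_pos by (intro mass_lower_bound) auto
  have d: "g (0 + 1) = \<delta>" "g 0 = 0" by simp_all
  have "measure \<sigma> {\<alpha> s..\<alpha> s + 3 * (\<delta> / 6)} / 2 \<le> mass s 0"
  proof (rule *)
    fix t assume t: "t \<in> {\<alpha> s..\<alpha> s + 3 * (\<delta> / 6)}"
    then have "hat \<delta> h 0 (t - \<alpha> s) = (\<delta> - (t - \<alpha> s)) / \<delta>"
      using hat_cell(1)[of 0 "t - \<alpha> s"] delta_pos by simp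
    also have "\<dots> \<ge> 1 / 2" using t delta_pos by (simp add: pos_le_divide_eq)
    finally show "hat \<delta> h 0 (t - \<alpha> s) \<ge> 1 / 2" .
  qed
  moreover have "\<kappa> * (\<delta> / 6)\<^sup>2 / 8 \<le> measure \<sigma> {\<alpha> s..\<alpha> s + 3 * (\<delta> / 6)}"
    using alpha_range[OF assms] x0 delta_pos by (intro low) auto
  ultimately show "mass s 0 \<ge> end_mass" by (simp add: end_mass_def)
  have "measure \<sigma> {\<alpha> s + \<delta> / 2..\<alpha> s + \<delta> / 2 + 3 * (\<delta> / 6)} / 2 \<le> mass s 1"
  proof (rule *)
    fix t assume t: "t \<in> {\<alpha> s + \<delta> / 2..\<alpha> s + \<delta> / 2 + 3 * (\<delta> / 6)}"
    then have "hat \<delta> h 1 (t - \<alpha> s) = (t - \<alpha> s) / \<delta>"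
      using hat_cell(2)[of 0 "t - \<alpha> s"] delta_pos by simp
    also have "\<dots> \<ge> 1 / 2" using t delta_pos by (simp add: pos_le_divide_eq)
    finally show "hat \<delta> h 1 (t - \<alpha> s) \<ge> 1 / 2" .
  qed
  moreover have "\<kappa> * (\<delta> / 6)\<^sup>2 / 8 \<le> measure \<sigma> {\<alpha> s + \<delta> / 2..\<alpha> s + \<delta> / 2 + 3 * (\<delta> / 6)}"
    using alpha_range[OF assms] x0 delta_pos by (intro low) auto
  ultimately show "mass s 1 \<ge> end_mass" by (simp add: end_mass_def)
qed

lemma continuous_on_mass: "continuous_on A (\<lambda>s. mass s l)"
proof -
  have lip: "\<bar>mass s l - mass s' l\<bar> \<le> \<delta> / h * \<bar>s - s'\<bar>" for s s'
  proof -
    have "continuous_on UNIV (\<lambda>t. \<bar>hat \<delta> h l (t - \<alpha> s) - hat \<delta> h l (t - \<alpha> s')\<bar>)"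
      by (intro continuous_on_rabs continuous_on_diff continuous_on_compose2[OF continuous_on_hat[of UNIV]] continuous_on_id continuous_on_const) auto
    then have i1: "integrable \<sigma> (\<lambda>t. \<bar>hat \<delta> h l (t - \<alpha> s) - hat \<delta> h l (t - \<alpha> s')\<bar>)"
      by (rule integrable_continuous)
    have i2: "integrable \<sigma> (\<lambda>t. \<delta> / h * \<bar>s - s'\<bar>)" by simp
    have eq: "mass s l - mass s' l = (LINT t|\<sigma>. hat \<delta> h l (t - \<alpha> s) - hat \<delta> h l (t - \<alpha> s'))"
      unfolding mass_def by (rule Bochner_Integration.integral_diff[symmetric]) (rule integrable_hat)+
    have shift: "\<bar>(t - \<alpha> s) - (t - \<alpha> s')\<bar> / h = \<delta> / h * \<bar>s - s'\<bar>" for t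
    proof -
      have "(t - \<alpha> s) - (t - \<alpha> s') = \<delta> * (s' - s)" by (simp add: \<alpha>_def algebra_simps)
      then show ?thesis using delta_pos by (simp add: abs_mult abs_minus_commute)
    qed
    have "\<bar>mass s l - mass s' l\<bar> \<le> (LINT t|\<sigma>. \<bar>hat \<delta> h l (t - \<alpha> s) - hat \<delta> h l (t - \<alpha> s')\<bar>)"
      unfolding eq by (rule integral_abs_bound)
    also have "\<dots> \<le> (LINT t|\<sigma>. \<delta> / h * \<bar>s - s'\<bar>)"
    proof (rule integral_mono[OF i1 i2])
      fix t
      show "\<bar>hat \<delta> h l (t - \<alpha> s) - hat \<delta> h l (t - \<alpha> s')\<bar> \<le> \<delta> / h * \<bar>s - s'\<bar>"
        using hat_Lipschitz[of l "t - \<alpha> s" "t - \<alpha> s'"] unfolding shift .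
    qed
    also have "\<dots> = \<delta> / h * \<bar>s - s'\<bar>" by (simp add: prob_space)
    finally show ?thesis .
  qed
  have "(\<delta> / h)-lipschitz_on A (\<lambda>s. mass s l)"
    using lip delta_pos h by (intro lipschitz_onI) (auto simp: dist_real_def)
  then show ?thesis by (rule lipschitz_on_continuous_on)
qed

text \<open>The derivative at \<open>x0\<close> of the potential of the discretised measure plus \<open>p\<close>.\<close>
definition slope :: "real \<Rightarrow> real" where
  "slope s = (\<Sum>l\<in>I. mass s l / (x0 - node s l)) - repulsion x0"

lemma x0_minus_node: "x0 - node s l = (1 - s) * \<delta> - g l" by (simp add: node_def \<alpha>_def)

lemma node_distance:
  assumes "0 < s0" "s \<in> {s0..1 - s0}"
  shows "\<bar>x0 - node s l\<bar> \<ge> s0 * \<delta>"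
proof -
  have "s0 * \<delta> \<le> (1 - s) * \<delta>" "(1 - s) * \<delta> \<le> (1 - s0) * \<delta>" using assms delta_pos by auto
  moreover have "(1 - s0) * \<delta> = \<delta> - s0 * \<delta>" by (simp add: algebra_simps)
  ultimately show ?thesis using grid_outside_gap[of l] unfolding x0_minus_node by linarith
qed

text \<open>If \<open>x0\<close> is very close to an end of the gap, the mass at this end, which is at least \<open>end_mass\<close>,
  dominates the slope and pushes away from it. All other contributions are bounded by \<open>2 / \<delta>\<close> and
  \<open>1 / (a2 - r)\<close>. The intermediate value theorem gives a position with slope \<open>0\<close>, at a distance of
  at least \<open>s0 * \<delta>\<close> from the ends.\<close>
lemma balanced_position:
  assumes s0: "0 < s0" "s0 \<le> 1 / 4" "s0 * (2 + \<delta> / (a2 - r)) \<le> end_mass"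
  shows "\<exists>s\<in>{s0..1 - s0}. slope s = 0"
proof -
  have x0r: "x0 \<in> {a..r}" using x0 hi delta_pos by auto
  have s01: "s0 \<in> {0..1}" "1 - s0 \<in> {0..1}" using s0 by auto
  have sd: "s0 * \<delta> > 0" using s0 delta_pos by simp
  have s4: "s0 * \<delta> \<le> \<delta> / 4" using s0 delta_pos mult_right_mono[of s0 "1/4" \<delta>] by simp
  have one: "(1 - s0) * \<delta> = \<delta> - s0 * \<delta>" by (simp add: algebra_simps)
  have small: "x / d \<le> x * (2 / \<delta>)" if "x \<ge> 0" "d \<ge> \<delta> / 2 \<or> d < 0" for x d
  proof (cases "d < 0")
    case True
    have "x / d \<le> 0" using True that by (simp add: divide_nonneg_neg)
    also have "0 \<le> x * (2 / \<delta>)" using that delta_pos by simp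
    finally show ?thesis .
  next
    case False
    then have "x / d \<le> x / (\<delta> / 2)" using that delta_pos by (intro divide_left_mono) auto
    then show ?thesis by simp
  qed
  have I1: "1 \<in> I" "0 \<in> I" using N by auto
  have bound: "(\<Sum>l\<in>I - {i}. mass s l * (2 / \<delta>)) \<le> 2 / \<delta>" if "s \<in> {0..1}" for s i
  proof -
    have "(\<Sum>l\<in>I - {i}. mass s l) \<le> (\<Sum>l\<in>I. mass s l)" by (intro sum_mono2) (auto simp: mass_nonneg)
    then have "(\<Sum>l\<in>I - {i}. mass s l) * (2 / \<delta>) \<le> 1 * (2 / \<delta>)"
      using total_mass[OF that] delta_pos by (intro mult_right_mono) auto
    then show ?thesis by (simp only: sum_distrib_right mult_1)
  qed
  have left: "slope s0 \<le> 0"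
  proof -
    have "(\<Sum>l\<in>I. mass s0 l / (x0 - node s0 l)) = mass s0 1 / (x0 - node s0 1) + (\<Sum>l\<in>I - {1}. mass s0 l / (x0 - node s0 l))"
      using I1 by (intro sum.remove) auto
    also have "(\<Sum>l\<in>I - {1}. mass s0 l / (x0 - node s0 l)) \<le> (\<Sum>l\<in>I - {1}. mass s0 l * (2 / \<delta>))"
    proof (intro sum_mono small mass_nonneg)
      fix l assume "l \<in> I - {1}"
      then consider "l \<le> 0" | "l \<ge> 1" by fastforce
      then show "\<delta> / 2 \<le> x0 - node s0 l \<or> x0 - node s0 l < 0"
      proof cases
        case 1
        then have "g l \<le> 0" using grid_mono[of l 0] by simp
        then show ?thesis using s4 delta_pos unfolding x0_minus_node one by linarith
      next
        case 2
        then have "g l \<ge> \<delta>" using grid_mono[of 1 l] by simp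
        then show ?thesis using sd unfolding x0_minus_node one by linarith
      qed
    qed
    also have "\<dots> \<le> 2 / \<delta>" using s01 by (intro bound) auto
    also have "mass s0 1 / (x0 - node s0 1) = - (mass s0 1 / (s0 * \<delta>))"
      by (simp add: \<alpha>_def one minus_divide_right[symmetric])
    finally have "(\<Sum>l\<in>I. mass s0 l / (x0 - node s0 l)) \<le> 2 / \<delta> - mass s0 1 / (s0 * \<delta>)" by simp
    moreover have "2 / \<delta> \<le> mass s0 1 / (s0 * \<delta>)"
    proof -
      have "2 * s0 \<le> s0 * (2 + \<delta> / (a2 - r))" using s0 delta_pos ra2 by (simp add: distrib_left)
      also have "\<dots> \<le> mass s0 1" using s0 mass_gap_ends(2)[OF s01(1)] by linarith
      finally show ?thesis using s0 delta_pos by (simp add: field_simps)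
    qed
    ultimately show ?thesis using repulsion_bounds[OF x0r] by (simp add: slope_def)
  qed
  have right: "slope (1 - s0) \<ge> 0"
  proof -
    let ?s = "1 - s0"
    have "(\<Sum>l\<in>I. - (mass ?s l) / (x0 - node ?s l)) = - (mass ?s 0) / (x0 - node ?s 0) + (\<Sum>l\<in>I - {0}. - (mass ?s l) / (x0 - node ?s l))"
      using I1 by (intro sum.remove) auto
    also have "(\<Sum>l\<in>I - {0}. - (mass ?s l) / (x0 - node ?s l)) = (\<Sum>l\<in>I - {0}. mass ?s l / (node ?s l - x0))"
      by (intro sum.cong refl) (metis minus_diff_eq minus_divide_divide minus_minus)
    also have "\<dots> \<le> (\<Sum>l\<in>I - {0}. mass ?s l * (2 / \<delta>))"
    proof (intro sum_mono small mass_nonneg)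
      fix l assume "l \<in> I - {0}"
      have e: "node ?s l - x0 = g l - s0 * \<delta>" using x0_minus_node[of ?s l] by simp
      consider "l \<le> 0" | "l \<ge> 1" by fastforce
      then show "\<delta> / 2 \<le> node ?s l - x0 \<or> node ?s l - x0 < 0"
      proof cases
        case 1
        then have "g l \<le> 0" using grid_mono[of l 0] by simp
        then show ?thesis using sd unfolding e by linarith
      next
        case 2
        then have "g l \<ge> \<delta>" using grid_mono[of 1 l] by simp
        then show ?thesis using s4 delta_pos unfolding e by linarith
      qed
    qed
    also have "\<dots> \<le> 2 / \<delta>" using s01 by (intro bound) auto
    finally have "- (\<Sum>l\<in>I. mass ?s l / (x0 - node ?s l)) \<le> 2 / \<delta> - mass ?s 0 / (s0 * \<delta>)"
      by (simp add: sum_negf \<alpha>_def)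
    moreover have "2 / \<delta> + 1 / (a2 - r) \<le> mass ?s 0 / (s0 * \<delta>)"
    proof -
      have "(2 / \<delta> + 1 / (a2 - r)) * (s0 * \<delta>) = s0 * (2 + \<delta> / (a2 - r))"
        using delta_pos by (simp add: field_simps)
      also have "\<dots> \<le> mass ?s 0" using s0 mass_gap_ends(1)[OF s01(2)] by linarith
      finally show ?thesis using sd by (simp only: pos_le_divide_eq)
    qed
    ultimately show ?thesis using repulsion_bounds[OF x0r] by (simp add: slope_def)
  qed
  have "continuous_on {s0..1 - s0} slope"
    unfolding slope_def
  proof (intro continuous_intros continuous_on_mass ballI)
    fix l s assume "s \<in> {s0..1 - s0}"
    then have "\<bar>x0 - node s l\<bar> \<ge> s0 * \<delta>" using s0 by (intro node_distance)
    then show "x0 - node s l \<noteq> 0" using sd by auto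
  next
    show "continuous_on {s0..1 - s0} (\<lambda>s. node s l)" for l
      unfolding node_def \<alpha>_def by (intro continuous_intros)
  qed
  then show ?thesis using IVT'[of slope s0 0 "1 - s0"] left right s0 by auto
qed

lemma in_gap_same_side:
  assumes "s \<in> {0<..<1}" "x \<in> {\<alpha> s<..<\<alpha> s + \<delta>}"
  shows "(x - node s l) * (x0 - node s l) > 0"
proof -
  have x0s: "x0 \<in> {\<alpha> s<..<\<alpha> s + \<delta>}"
  proof -
    have "(1 - s) * \<delta> > 0" "s * \<delta> > 0" using assms delta_pos by auto
    then show ?thesis by (auto simp: \<alpha>_def algebra_simps)
  qed
  from grid_outside_gap[of l] show ?thesis
  proof
    assume "g l \<le> 0"
    then show ?thesis using assms x0s by (intro mult_pos_pos) (auto simp: node_def)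
  next
    assume "\<delta> \<le> g l"
    then show ?thesis using assms x0s by (intro mult_neg_neg) (auto simp: node_def)
  qed
qed

text \<open>Between the zeros at the ends of the gap, each logarithm lies below its tangent at \<open>x0\<close>.\<close>
lemma sum_ln_tangent:
  assumes "s \<in> {0<..<1}" "x \<in> {\<alpha> s<..<\<alpha> s + \<delta>}" "\<And>l. k l \<ge> 0"
  shows "(\<Sum>l\<in>I. k l * ln \<bar>x - node s l\<bar>) \<le>
    (\<Sum>l\<in>I. k l * ln \<bar>x0 - node s l\<bar>) + (x - x0) * (\<Sum>l\<in>I. k l / (x0 - node s l))"
proof -
  have "(\<Sum>l\<in>I. k l * ln \<bar>x - node s l\<bar>) \<le> (\<Sum>l\<in>I. k l * (ln \<bar>x0 - node s l\<bar> + (x - x0) / (x0 - node s l)))"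
    using assms by (intro sum_mono mult_left_mono ln_abs_tangent in_gap_same_side) auto
  also have "\<dots> = (\<Sum>l\<in>I. k l * ln \<bar>x0 - node s l\<bar>) + (x - x0) * (\<Sum>l\<in>I. k l / (x0 - node s l))"
    by (simp add: distrib_left sum.distrib sum_distrib_left mult_ac)
  finally show ?thesis .
qed

text \<open>The mean of the potential over the gap is not lowered by the move of mass within the gap, and by at
  most \<open>e1\<close> by the displacements of length \<open>h\<close> outside.\<close>
lemma gap_log_mean_lower:
  assumes s: "s \<in> {0..1}"
    and e1: "e1 \<ge> 0" "\<And>z v. \<bar>z\<bar> \<le> r - a \<Longrightarrow> \<bar>v - z\<bar> \<le> h \<Longrightarrow> log_mean 0 \<delta> z \<le> log_mean 0 \<delta> v + e1"
  shows "(\<Sum>l\<in>I. mass s l * log_mean (\<alpha> s) (\<alpha> s + \<delta>) (node s l)) + integral {\<alpha> s..\<alpha> s + \<delta>} p / \<delta> \<ge> \<Phi> - e1"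
proof -
  have tr: "log_mean (\<alpha> s) (\<alpha> s + \<delta>) t = log_mean 0 \<delta> (t - \<alpha> s)" for t
    using log_mean_translate[of 0 "\<alpha> s" \<delta> "t - \<alpha> s"] by (simp add: add.commute)
  have tr': "log_mean (\<alpha> s) (\<alpha> s + \<delta>) (node s l) = log_mean 0 \<delta> (g l)" for l
    by (simp add: tr node_def)
  have "(\<Sum>l\<in>I. mass s l * (- log_mean 0 \<delta> (g l))) \<le> (LINT t|\<sigma>. e1 - log_mean (\<alpha> s) (\<alpha> s + \<delta>) t)"
  proof (rule sum_mass_le)
    show "integrable \<sigma> (\<lambda>t. e1 - log_mean (\<alpha> s) (\<alpha> s + \<delta>) t)" using integrable_log_mean by simp
    fix t assume t: "t \<in> {a..r}"
    note z = z_range[OF s t]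
    show "(\<Sum>l\<in>I. hat \<delta> h l (t - \<alpha> s) * (- log_mean 0 \<delta> (g l))) \<le> e1 - log_mean (\<alpha> s) (\<alpha> s + \<delta>) t"
    proof (rule sum_hat_le[OF N(1) z(1,2), of "\<lambda>v. - log_mean 0 \<delta> v"])
      show "- log_mean 0 \<delta> v \<le> e1 - log_mean (\<alpha> s) (\<alpha> s + \<delta>) t" if "\<bar>v - (t - \<alpha> s)\<bar> \<le> h" for v
        using e1(2)[OF z(3) that] by (simp add: tr)
      assume z0: "0 \<le> t - \<alpha> s" "t - \<alpha> s \<le> \<delta>"
      have ends: "log_mean 0 \<delta> 0 = ln \<delta> - 1" "log_mean 0 \<delta> \<delta> = ln \<delta> - 1"
        using log_mean_ends[of 0 \<delta>] delta_pos by simp_all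
      have "((\<delta> - (t - \<alpha> s)) * - log_mean 0 \<delta> 0 + (t - \<alpha> s) * - log_mean 0 \<delta> \<delta>) / \<delta> = - (ln \<delta> - 1)"
        unfolding ends using delta_pos by (simp add: field_simps)
      also have "\<dots> \<le> e1 - log_mean 0 \<delta> (t - \<alpha> s)"
        using log_mean_le_ends[of 0 \<delta> "t - \<alpha> s"] z0 delta_pos e1(1) by simp
      finally show "((\<delta> - (t - \<alpha> s)) * - log_mean 0 \<delta> 0 + (t - \<alpha> s) * - log_mean 0 \<delta> \<delta>) / \<delta> \<le> e1 - log_mean (\<alpha> s) (\<alpha> s + \<delta>) t"
        by (simp add: tr)
    qed
  qed
  also have "\<dots> = e1 - (LINT t|\<sigma>. log_mean (\<alpha> s) (\<alpha> s + \<delta>) t)"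
    using integrable_log_mean by (simp add: prob_space)
  finally have "(LINT t|\<sigma>. log_mean (\<alpha> s) (\<alpha> s + \<delta>) t) - e1 \<le> (\<Sum>l\<in>I. mass s l * log_mean (\<alpha> s) (\<alpha> s + \<delta>) (node s l))"
    by (simp add: tr' sum_negf)
  moreover have "(LINT t|\<sigma>. log_mean (\<alpha> s) (\<alpha> s + \<delta>) t) + integral {\<alpha> s..\<alpha> s + \<delta>} p / (\<alpha> s + \<delta> - \<alpha> s) \<ge> \<Phi>"
    using alpha_range[OF s] x0 delta_pos by (intro mean_lower) auto
  ultimately show ?thesis by simp
qed

text \<open>A function with slope \<open>0\<close> at \<open>x0\<close> and concavity \<open>\<kappa>\<close> in the gap exceeds its mean over the gap by
  \<open>\<kappa> / 2\<close> times the mean of \<open>(x - x0)\<^sup>2\<close>, which is at least \<open>\<delta>\<^sup>2 / 12\<close>.\<close>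
lemma value_at_balanced_position:
  assumes s: "s \<in> {0<..<1}" "slope s = 0"
    and e1: "e1 \<ge> 0" "\<And>z v. \<bar>z\<bar> \<le> r - a \<Longrightarrow> \<bar>v - z\<bar> \<le> h \<Longrightarrow> log_mean 0 \<delta> z \<le> log_mean 0 \<delta> v + e1"
  shows "(\<Sum>l\<in>I. mass s l * ln \<bar>x0 - node s l\<bar>) + p x0 \<ge> \<Phi> - e1 + \<kappa> * \<delta>\<^sup>2 / 24"
proof -
  define f where "f x = (\<Sum>l\<in>I. mass s l * ln \<bar>x - node s l\<bar>) + p x" for x
  define \<beta> where "\<beta> = \<alpha> s + \<delta>"
  have s': "s \<in> {0..1}" using s by auto
  have ab: "\<alpha> s < x0" "x0 < \<beta>" "a \<le> \<alpha> s" "\<beta> \<le> r"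
  proof -
    have "(1 - s) * \<delta> > 0" "s * \<delta> > 0" using s delta_pos by auto
    then show "\<alpha> s < x0" "x0 < \<beta>" "a \<le> \<alpha> s" "\<beta> \<le> r"
      using alpha_range[OF s'] x0 hi by (auto simp: \<alpha>_def \<beta>_def algebra_simps)
  qed
  have below: "f x \<le> f x0 - \<kappa> / 2 * (x - x0)\<^sup>2" if "x \<in> {\<alpha> s<..<\<beta>}" for x
  proof -
    have "(\<Sum>l\<in>I. mass s l * ln \<bar>x - node s l\<bar>) \<le>
      (\<Sum>l\<in>I. mass s l * ln \<bar>x0 - node s l\<bar>) + (x - x0) * (\<Sum>l\<in>I. mass s l / (x0 - node s l))"
      using that s by (intro sum_ln_tangent mass_nonneg) (auto simp: \<beta>_def)
    also have "(\<Sum>l\<in>I. mass s l / (x0 - node s l)) = repulsion x0" using s(2) by (simp add: slope_def)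
    finally show ?thesis using p_tangent[of x x0] that ab by (simp add: f_def)
  qed
  have int1: "(f has_integral (\<Sum>l\<in>I. mass s l * (\<delta> * log_mean (\<alpha> s) \<beta> (node s l))) + integral {\<alpha> s..\<beta>} p) {\<alpha> s..\<beta>}"
    unfolding f_def
  proof (intro has_integral_add has_integral_sum has_integral_mult_right)
    fix l
    show "((\<lambda>x. ln \<bar>x - node s l\<bar>) has_integral \<delta> * log_mean (\<alpha> s) \<beta> (node s l)) {\<alpha> s..\<beta>}"
      using has_integral_ln_abs[of "\<alpha> s" \<beta> "node s l"] ab by (simp add: \<beta>_def)
    show "(p has_integral integral {\<alpha> s..\<beta>} p) {\<alpha> s..\<beta>}"
      using ab by (intro integrable_integral integrable_continuous_real continuous_on_subset[OF p_continuous]) auto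
  qed auto
  \<comment> \<open>an antiderivative of the parabola that bounds \<open>f\<close> in the gap\<close>
  define F where "F x = (f x0 * x - \<kappa> / 6 * (x - x0) ^ 3)" for x
  have int2: "((\<lambda>x. f x0 - \<kappa> / 2 * (x - x0)\<^sup>2) has_integral F \<beta> - F (\<alpha> s)) {\<alpha> s..\<beta>}"
  proof (rule fundamental_theorem_of_calculus)
    show "\<alpha> s \<le> \<beta>" using ab by simp
    fix x
    have "(F has_real_derivative (f x0 - \<kappa> / 2 * (x - x0)\<^sup>2)) (at x within {\<alpha> s..\<beta>})"
      unfolding F_def by (auto intro!: derivative_eq_intros simp: power2_eq_square)
    then show "(F has_vector_derivative (f x0 - \<kappa> / 2 * (x - x0)\<^sup>2)) (at x within {\<alpha> s..\<beta>})"
      by (simp add: has_real_derivative_iff_has_vector_derivative)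
  qed
  \<comment> \<open>at the ends of the gap, where \<open>f\<close> should be \<open>- \<infinity>\<close>, the convention \<open>ln 0 = 0\<close> has to be overridden\<close>
  have "((\<lambda>x. if x \<in> {\<alpha> s, \<beta>} then f x0 - \<kappa> / 2 * (x - x0)\<^sup>2 else f x) has_integral
    (\<Sum>l\<in>I. mass s l * (\<delta> * log_mean (\<alpha> s) \<beta> (node s l))) + integral {\<alpha> s..\<beta>} p) {\<alpha> s..\<beta>}"
    by (rule has_integral_spike_finite[OF _ _ int1, of "{\<alpha> s, \<beta>}"]) auto
  then have "(\<Sum>l\<in>I. mass s l * (\<delta> * log_mean (\<alpha> s) \<beta> (node s l))) + integral {\<alpha> s..\<beta>} p \<le> F \<beta> - F (\<alpha> s)"
    by (rule has_integral_le[OF _ int2]) (use below in auto)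
  also have "F \<beta> - F (\<alpha> s) = \<delta> * f x0 - \<kappa> / 6 * ((\<beta> - x0) ^ 3 + (x0 - \<alpha> s) ^ 3)"
    by (simp add: F_def \<beta>_def power3_eq_cube algebra_simps)
  also have "\<dots> \<le> \<delta> * f x0 - \<kappa> / 6 * (\<delta> ^ 3 / 4)"
  proof -
    define A where "A = x0 - \<alpha> s"
    define B where "B = \<beta> - x0"
    have "\<delta> = A + B" "A > 0" "B > 0" using ab by (auto simp: A_def B_def \<beta>_def)
    moreover have "B ^ 3 + A ^ 3 - (A + B) ^ 3 / 4 = 3 / 4 * ((A + B) * (A - B)\<^sup>2)"
      by (simp add: power3_eq_cube power2_eq_square field_simps)
    ultimately have "\<delta> ^ 3 / 4 \<le> B ^ 3 + A ^ 3"
      by (metis add_pos_pos diff_ge_0_iff_ge less_imp_le mult_nonneg_nonneg zero_le_divide_iff zero_le_numeral zero_le_power2)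
    then have "\<kappa> / 6 * (\<delta> ^ 3 / 4) \<le> \<kappa> / 6 * (B ^ 3 + A ^ 3)" using kappa_pos by (intro mult_left_mono) auto
    then show ?thesis by (simp add: A_def B_def)
  qed
  finally have le: "(\<Sum>l\<in>I. mass s l * (\<delta> * log_mean (\<alpha> s) \<beta> (node s l))) + integral {\<alpha> s..\<beta>} p \<le>
    \<delta> * (f x0 - \<kappa> * \<delta>\<^sup>2 / 24)"
    by (simp add: power3_eq_cube power2_eq_square algebra_simps)
  have "\<delta> * (\<Phi> - e1) \<le> \<delta> * ((\<Sum>l\<in>I. mass s l * log_mean (\<alpha> s) \<beta> (node s l)) + integral {\<alpha> s..\<beta>} p / \<delta>)"
    using gap_log_mean_lower[OF s' e1] delta_pos unfolding \<beta>_def by (intro mult_left_mono) auto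
  also have "\<dots> = (\<Sum>l\<in>I. mass s l * (\<delta> * log_mean (\<alpha> s) \<beta> (node s l))) + integral {\<alpha> s..\<beta>} p"
    using delta_pos by (simp add: distrib_left sum_distrib_left mult_ac)
  also note le
  finally have "\<Phi> - e1 \<le> f x0 - \<kappa> * \<delta>\<^sup>2 / 24" using delta_pos by simp
  then show ?thesis by (simp add: f_def)
qed

text \<open>Each zero comes from mass at a distance of at most \<open>h\<close> or from the gap, where concavity applies. The
  upper variational inequality for \<open>{x..x + h}\<close> then bounds the sum; adding \<open>h\<close> to the distances keeps the
  logarithms finite at the nodes.\<close>
lemma outside_gap_bound:
  assumes s: "s \<in> {0..1}" and x: "a \<le> x" "x + h \<le> r" "x \<notin> {\<alpha> s<..<\<alpha> s + \<delta>}"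
    and K: "K \<ge> 2" and \<epsilon>: "measure \<sigma> {x - K * h..x + K * h} \<le> \<epsilon>"
  shows "(\<Sum>l\<in>I. mass s l * ln (\<bar>x - node s l\<bar> + h)) + p x \<le>
    \<Phi> + 3 / (K - 1) + (ln (K + 2) + 2) * \<epsilon> + h / (a2 - r)"
proof -
  let ?J = "{x - K * h..x + K * h}"
  have intJ: "integrable \<sigma> (\<lambda>t. (ln (K + 2) + 2) * indicator ?J t)"
    by (intro integrable_mult_right integrable_real_indicator) (auto simp: sets_borel less_top[symmetric])
  have "(\<Sum>l\<in>I. mass s l * ln (\<bar>x - node s l\<bar> + h)) \<le>
    (LINT t|\<sigma>. log_mean x (x + h) t + 3 / (K - 1) + (ln (K + 2) + 2) * indicator ?J t)"
  proof (rule sum_mass_le)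
    show "integrable \<sigma> (\<lambda>t. log_mean x (x + h) t + 3 / (K - 1) + (ln (K + 2) + 2) * indicator ?J t)"
      using integrable_log_mean intJ by simp
    fix t assume t: "t \<in> {a..r}"
    note z = z_range[OF s t]
    have "(\<Sum>l\<in>I. hat \<delta> h l (t - \<alpha> s) * ln (\<bar>x - node s l\<bar> + h)) \<le> ln (\<bar>x - t\<bar> + 2 * h)"
      unfolding node_def
    proof (rule sum_hat_le[OF N(1) z(1,2), of "\<lambda>v. ln (\<bar>x - (\<alpha> s + v)\<bar> + h)"])
      fix v assume "\<bar>v - (t - \<alpha> s)\<bar> \<le> h"
      then show "ln (\<bar>x - (\<alpha> s + v)\<bar> + h) \<le> ln (\<bar>x - t\<bar> + 2 * h)"
        using h by (subst ln_le_cancel_iff) auto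
    next
      assume z0: "0 \<le> t - \<alpha> s" "t - \<alpha> s \<le> \<delta>"
      define \<theta> where "\<theta> = (t - \<alpha> s) / \<delta>"
      have \<theta>: "0 \<le> \<theta>" "\<theta> \<le> 1" using z0 delta_pos by (auto simp: \<theta>_def)
      have t\<theta>: "t = \<alpha> s + \<theta> * \<delta>" using delta_pos by (simp add: \<theta>_def)
      define A where "A = \<bar>x - \<alpha> s\<bar> + h"
      define B where "B = \<bar>x - (\<alpha> s + \<delta>)\<bar> + h"
      have pos: "A > 0" "B > 0" using h by (auto simp: A_def B_def)
      have lin: "(1 - \<theta>) * A + \<theta> * B = \<bar>x - t\<bar> + h"
      proof (cases "x \<le> \<alpha> s")
        case True
        then have e: "A = \<alpha> s - x + h" "B = \<alpha> s - x + \<delta> + h" "\<bar>x - t\<bar> = t - x"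
          using z0 delta_pos by (auto simp: A_def B_def)
        show ?thesis unfolding e using t\<theta> by (simp add: algebra_simps)
      next
        case False
        then have "x \<ge> \<alpha> s + \<delta>" using x(3) by auto
        then have e: "A = x - \<alpha> s + h" "B = x - \<alpha> s - \<delta> + h" "\<bar>x - t\<bar> = x - t"
          using z0 delta_pos by (auto simp: A_def B_def)
        show ?thesis unfolding e using t\<theta> by (simp add: algebra_simps)
      qed
      have "((\<delta> - (t - \<alpha> s)) * ln (\<bar>x - (\<alpha> s + 0)\<bar> + h) + (t - \<alpha> s) * ln (\<bar>x - (\<alpha> s + \<delta>)\<bar> + h)) / \<delta>
        = (1 - \<theta>) * ln A + \<theta> * ln B"
        using delta_pos by (simp add: A_def B_def t\<theta> field_simps)
      also have "\<dots> \<le> ln ((1 - \<theta>) * A + \<theta> * B)"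
        using concave_onD[OF ln_concave \<theta>, of A B] pos by simp
      also have "\<dots> \<le> ln (\<bar>x - t\<bar> + 2 * h)" unfolding lin using h by (subst ln_le_cancel_iff) auto
      finally show "((\<delta> - (t - \<alpha> s)) * ln (\<bar>x - (\<alpha> s + 0)\<bar> + h) + (t - \<alpha> s) * ln (\<bar>x - (\<alpha> s + \<delta>)\<bar> + h)) / \<delta>
        \<le> ln (\<bar>x - t\<bar> + 2 * h)" .
    qed
    then show "(\<Sum>l\<in>I. hat \<delta> h l (t - \<alpha> s) * ln (\<bar>x - node s l\<bar> + h)) \<le>
      log_mean x (x + h) t + 3 / (K - 1) + (ln (K + 2) + 2) * indicator ?J t"
      using smoothed_log_le_log_mean[OF h K, of x t] by linarith
  qed
  also have "\<dots> = (LINT t|\<sigma>. log_mean x (x + h) t) + 3 / (K - 1) + (ln (K + 2) + 2) * measure \<sigma> ?J"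
    using integrable_log_mean intJ by (simp add: prob_space sets_borel)
  finally have 1: "(\<Sum>l\<in>I. mass s l * ln (\<bar>x - node s l\<bar> + h)) \<le>
    (LINT t|\<sigma>. log_mean x (x + h) t) + 3 / (K - 1) + (ln (K + 2) + 2) * measure \<sigma> ?J" .
  have 2: "(ln (K + 2) + 2) * measure \<sigma> ?J \<le> (ln (K + 2) + 2) * \<epsilon>"
    using K \<epsilon> by (intro mult_left_mono) auto
  have 3: "(LINT t|\<sigma>. log_mean x (x + h) t) + integral {x..x + h} p / h \<le> \<Phi>"
    using mean_upper[of x "x + h"] x h by simp
  have "integral {x..x + h} (\<lambda>_. p x - h / (a2 - r)) \<le> integral {x..x + h} p"
  proof (rule integral_le)
    show "p integrable_on {x..x + h}"
      using x by (intro integrable_continuous_real continuous_on_subset[OF p_continuous]) auto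
    fix v assume v: "v \<in> {x..x + h}"
    then have "p x \<le> p v + (v - x) / (a2 - r)" using x by (intro p_decreasing) auto
    also have "(v - x) / (a2 - r) \<le> h / (a2 - r)" using v ra2 by (intro divide_right_mono) auto
    finally show "p x - h / (a2 - r) \<le> p v" by simp
  qed auto
  then have "h * (p x - h / (a2 - r)) \<le> integral {x..x + h} p" using h by simp
  then have "p x - h / (a2 - r) \<le> integral {x..x + h} p / h" using h by (simp add: pos_le_divide_eq mult.commute)
  then show ?thesis using 1 2 3 by linarith
qed

text \<open>Half of the number that corresponds to the mass, because the polynomial will be squared.\<close>
definition multiplicity_at :: "real \<Rightarrow> int \<Rightarrow> nat" where
  "multiplicity_at s l = nat \<lfloor>real n * mass s l / 2\<rfloor>"

definition peak_poly :: "real \<Rightarrow> real poly" where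
  "peak_poly s = (\<Prod>l\<in>I. [:- node s l, 1:] ^ multiplicity_at s l)"

lemma multiplicity_at_bounds:
  "2 * real (multiplicity_at s l) \<le> real n * mass s l" "real n * mass s l - 2 \<le> 2 * real (multiplicity_at s l)"
proof -
  have "0 \<le> real n * mass s l / 2" using mass_nonneg by simp
  then have "real (multiplicity_at s l) = of_int \<lfloor>real n * mass s l / 2\<rfloor>"
    by (simp add: multiplicity_at_def)
  then have "real (multiplicity_at s l) \<le> real n * mass s l / 2" "real n * mass s l / 2 - 1 \<le> real (multiplicity_at s l)"
    by linarith+
  then show "2 * real (multiplicity_at s l) \<le> real n * mass s l" "real n * mass s l - 2 \<le> 2 * real (multiplicity_at s l)"
    by linarith+
qed

lemma degree_peak_poly:
  assumes "s \<in> {0..1}"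
  shows "degree (peak_poly s) \<le> n div 2"
proof -
  have "degree (peak_poly s) \<le> (\<Sum>l\<in>I. degree ([:- node s l, 1:] ^ multiplicity_at s l))"
    unfolding peak_poly_def by (rule order_trans[OF degree_prod_sum_le]) auto
  also have "\<dots> = (\<Sum>l\<in>I. multiplicity_at s l)" by (intro sum.cong) (auto simp: degree_power_eq)
  finally have 1: "degree (peak_poly s) \<le> (\<Sum>l\<in>I. multiplicity_at s l)" .
  have "2 * real (\<Sum>l\<in>I. multiplicity_at s l) = (\<Sum>l\<in>I. 2 * real (multiplicity_at s l))"
    by (simp add: sum_distrib_left)
  also have "\<dots> \<le> (\<Sum>l\<in>I. real n * mass s l)" by (intro sum_mono multiplicity_at_bounds)
  also have "\<dots> = real n" using total_mass[OF assms] by (simp add: sum_distrib_left[symmetric])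
  finally have "2 * (\<Sum>l\<in>I. multiplicity_at s l) \<le> n" by linarith
  then show ?thesis using 1 by linarith
qed

lemma poly_peak_poly: "(poly (peak_poly s) x)\<^sup>2 = (\<Prod>l\<in>I. \<bar>x - node s l\<bar> ^ (2 * multiplicity_at s l))"
proof -
  have "(poly (peak_poly s) x)\<^sup>2 = (\<Prod>l\<in>I. ((x - node s l) ^ multiplicity_at s l)\<^sup>2)"
    by (simp add: peak_poly_def poly_prod prod_power_distrib)
  also have "\<dots> = (\<Prod>l\<in>I. \<bar>x - node s l\<bar> ^ (2 * multiplicity_at s l))"
  proof (intro prod.cong refl)
    fix l
    have "((x - node s l) ^ multiplicity_at s l)\<^sup>2 = ((x - node s l)\<^sup>2) ^ multiplicity_at s l"
      by (simp add: power_mult[symmetric] mult.commute)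
    also have "\<dots> = (\<bar>x - node s l\<bar>\<^sup>2) ^ multiplicity_at s l" by simp
    also have "\<dots> = \<bar>x - node s l\<bar> ^ (2 * multiplicity_at s l)" by (rule power_mult[symmetric])
    finally show "((x - node s l) ^ multiplicity_at s l)\<^sup>2 = \<bar>x - node s l\<bar> ^ (2 * multiplicity_at s l)" .
  qed
  finally show ?thesis .
qed

lemma prod_power_eq_exp:
  assumes "\<And>l. l \<in> I \<Longrightarrow> v l > (0 :: real)"
  shows "(\<Prod>l\<in>I. v l ^ (2 * multiplicity_at s l)) = exp (\<Sum>l\<in>I. 2 * real (multiplicity_at s l) * ln (v l))"
proof -
  have "(\<Prod>l\<in>I. v l ^ (2 * multiplicity_at s l)) = (\<Prod>l\<in>I. exp (2 * real (multiplicity_at s l) * ln (v l)))"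
  proof (intro prod.cong refl)
    fix l assume "l \<in> I"
    then have "v l ^ (2 * multiplicity_at s l) = exp (ln (v l)) ^ (2 * multiplicity_at s l)" using assms by simp
    also have "\<dots> = exp (real (2 * multiplicity_at s l) * ln (v l))" by (rule exp_of_nat_mult[symmetric])
    finally show "v l ^ (2 * multiplicity_at s l) = exp (2 * real (multiplicity_at s l) * ln (v l))" by simp
  qed
  then show ?thesis by (simp add: exp_sum)
qed

lemma rounding_error:
  assumes "\<And>l. l \<in> I \<Longrightarrow> \<bar>v l\<bar> \<le> M"
  shows "\<bar>(\<Sum>l\<in>I. 2 * real (multiplicity_at s l) * v l) - real n * (\<Sum>l\<in>I. mass s l * v l)\<bar> \<le> 2 * (2 * of_int N + 1) * M"
proof -
  have "(\<Sum>l\<in>I. 2 * real (multiplicity_at s l) * v l) - real n * (\<Sum>l\<in>I. mass s l * v l) =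
    (\<Sum>l\<in>I. (2 * real (multiplicity_at s l) - real n * mass s l) * v l)"
    by (simp add: sum_distrib_left sum_subtractf left_diff_distrib mult.assoc)
  also have "\<bar>\<dots>\<bar> \<le> (\<Sum>l\<in>I. 2 * M)"
  proof (rule order_trans[OF sum_abs], rule sum_mono)
    fix l assume "l \<in> I"
    have "\<bar>2 * real (multiplicity_at s l) - real n * mass s l\<bar> \<le> 2"
      using multiplicity_at_bounds[where s = s and l = l] by linarith
    then show "\<bar>(2 * real (multiplicity_at s l) - real n * mass s l) * v l\<bar> \<le> 2 * M"
      unfolding abs_mult using assms[OF \<open>l \<in> I\<close>] by (intro mult_mono) auto
  qed
  also have "\<dots> = 2 * (2 * of_int N + 1) * M" using N by simp
  finally show ?thesis .
qed

text \<open>Outside the gap, the margin \<open>n \<kappa> \<delta>\<^sup>2 / 48\<close> that is left after the discretisation absorbs the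
  rounding errors. In the gap, rounding changes the slope at \<open>x0\<close> by at most \<open>2 (2 N + 1) / (s0 \<delta>)\<close>, and
  with concavity \<open>n \<kappa>\<close> the maximum is larger than the value at \<open>x0\<close> by a factor
  \<open>exp (O(1 / n))\<close>.\<close>
lemma peak_poly_peaks:
  assumes s0: "0 < s0" and s: "s \<in> {s0..1 - s0}" "slope s = 0"
    and e1: "e1 \<ge> 0" "\<And>z v. \<bar>z\<bar> \<le> r - a \<Longrightarrow> \<bar>v - z\<bar> \<le> h \<Longrightarrow> log_mean 0 \<delta> z \<le> log_mean 0 \<delta> v + e1"
    and K: "K \<ge> 2" and \<epsilon>: "\<And>x. measure \<sigma> {x - K * h..x + K * h} \<le> \<epsilon>"
    and gain: "e1 + (3 / (K - 1) + (ln (K + 2) + 2) * \<epsilon> + h / (a2 - r)) \<le> \<kappa> * \<delta>\<^sup>2 / 48"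
    and M: "\<And>v. min h (s0 * \<delta>) \<le> v \<Longrightarrow> v \<le> r - a + \<delta> + (of_int N + 1) * h \<Longrightarrow> \<bar>ln v\<bar> \<le> M"
    and nlarge: "real n * (\<kappa> * \<delta>\<^sup>2 / 48) \<ge> 4 * (2 * of_int N + 1) * M"
    and x: "a \<le> x" "x + h \<le> r"
  shows "(poly (peak_poly s) x)\<^sup>2 * exp (real n * p x) \<le>
      exp ((2 * (2 * of_int N + 1) / (s0 * \<delta>))\<^sup>2 / (2 * \<kappa>) / real n) * ((poly (peak_poly s) x0)\<^sup>2 * exp (real n * p x0))"
    "poly (peak_poly s) x0 \<noteq> 0"
proof -
  define G where "G = 2 * of_int N + (1 :: real)"
  define k where "k l = 2 * real (multiplicity_at s l)" for l
  have s01: "s \<in> {0..1}" "s \<in> {0<..<1}" using s s0 by auto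
  have G: "G > 0" using N by (simp add: G_def)
  have sd: "s0 * \<delta> > 0" using s0 delta_pos by simp
  have dist0: "\<bar>x0 - node s l\<bar> \<ge> s0 * \<delta>" for l by (rule node_distance[OF s0 s(1)])
  then have pos0: "\<bar>x0 - node s l\<bar> > 0" for l using sd by (meson less_le_trans)
  have noder: "node s l \<in> {x0 - \<delta> - of_int N * h..x0 + \<delta> + of_int N * h}" if "l \<in> I" for l
    using grid_bounds[OF that N(1)] alpha_range[OF s01(1)] h delta_pos by (auto simp: node_def algebra_simps)
  have x0r: "x0 \<in> {a..r}" using x0 hi delta_pos by auto
  have T0: "(poly (peak_poly s) x0)\<^sup>2 = exp (\<Sum>l\<in>I. k l * ln \<bar>x0 - node s l\<bar>)"
    unfolding poly_peak_poly k_def by (rule prod_power_eq_exp) (rule pos0)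
  then show "poly (peak_poly s) x0 \<noteq> 0" by (metis exp_not_eq_zero zero_power2)
  define C where "C = (2 * G / (s0 * \<delta>))\<^sup>2 / (2 * \<kappa>) / real n"
  have C: "C \<ge> 0" using kappa_pos by (simp add: C_def)
  have main: "(poly (peak_poly s) x)\<^sup>2 * exp (real n * p x) \<le> exp C * ((poly (peak_poly s) x0)\<^sup>2 * exp (real n * p x0))"
  proof (cases "x \<in> {\<alpha> s<..<\<alpha> s + \<delta>}")
    case True
    have pos: "\<bar>x - node s l\<bar> > 0" for l using in_gap_same_side[OF s01(2) True, of l] by auto
    have T: "(poly (peak_poly s) x)\<^sup>2 = exp (\<Sum>l\<in>I. k l * ln \<bar>x - node s l\<bar>)"
      unfolding poly_peak_poly k_def by (rule prod_power_eq_exp) (rule pos)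
    define E where "E = (\<Sum>l\<in>I. k l / (x0 - node s l)) - real n * repulsion x0"
    have E: "\<bar>E\<bar> \<le> 2 * G / (s0 * \<delta>)"
    proof -
      have "\<bar>(\<Sum>l\<in>I. k l * (1 / (x0 - node s l))) - real n * (\<Sum>l\<in>I. mass s l * (1 / (x0 - node s l)))\<bar> \<le> 2 * G * (1 / (s0 * \<delta>))"
        unfolding k_def G_def
      proof (rule rounding_error)
        fix l
        have "1 / \<bar>x0 - node s l\<bar> \<le> 1 / (s0 * \<delta>)" using dist0[of l] sd by (intro frac_le) auto
        then show "\<bar>1 / (x0 - node s l)\<bar> \<le> 1 / (s0 * \<delta>)" by simp
      qed
      moreover have "(\<Sum>l\<in>I. mass s l * (1 / (x0 - node s l))) = repulsion x0" using s(2) by (simp add: slope_def)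
      ultimately show ?thesis by (simp add: E_def)
    qed
    have "(\<Sum>l\<in>I. k l * ln \<bar>x - node s l\<bar>) \<le> (\<Sum>l\<in>I. k l * ln \<bar>x0 - node s l\<bar>) + (x - x0) * (\<Sum>l\<in>I. k l / (x0 - node s l))"
      by (rule sum_ln_tangent[OF s01(2) True]) (simp add: k_def)
    moreover have "real n * p x \<le> real n * (p x0 - (x - x0) * repulsion x0 - \<kappa> / 2 * (x - x0)\<^sup>2)"
      using x h x0r by (intro mult_left_mono p_tangent) auto
    ultimately have "(\<Sum>l\<in>I. k l * ln \<bar>x - node s l\<bar>) + real n * p x \<le>
      (\<Sum>l\<in>I. k l * ln \<bar>x0 - node s l\<bar>) + real n * p x0 + ((x - x0) * E - real n * \<kappa> / 2 * (x - x0)\<^sup>2)"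
      by (simp add: E_def algebra_simps)
    also have "(x - x0) * E - real n * \<kappa> / 2 * (x - x0)\<^sup>2 \<le> C"
    proof -
      have nk: "real n * \<kappa> > 0" using n kappa_pos by simp
      have square: "(A * d - E)\<^sup>2 / (2 * A) = A / 2 * d\<^sup>2 - d * E + E\<^sup>2 / (2 * A)" if "A > 0" for A d :: real
        using that by (simp add: power2_eq_square field_simps)
      have "0 \<le> (real n * \<kappa> * (x - x0) - E)\<^sup>2 / (2 * (real n * \<kappa>))" using nk by simp
      also have "\<dots> = real n * \<kappa> / 2 * (x - x0)\<^sup>2 - (x - x0) * E + E\<^sup>2 / (2 * (real n * \<kappa>))"
        by (rule square[OF nk])
      finally have "(x - x0) * E - real n * \<kappa> / 2 * (x - x0)\<^sup>2 \<le> E\<^sup>2 / (2 * (real n * \<kappa>))" by simp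
      also have "E\<^sup>2 \<le> (2 * G / (s0 * \<delta>))\<^sup>2" using E power_mono[OF E, of 2] by simp
      then have "E\<^sup>2 / (2 * (real n * \<kappa>)) \<le> (2 * G / (s0 * \<delta>))\<^sup>2 / (2 * (real n * \<kappa>))"
        using nk by (intro divide_right_mono) auto
      also have "\<dots> = C" by (simp add: C_def mult_ac)
      finally show ?thesis .
    qed
    finally have "exp ((\<Sum>l\<in>I. k l * ln \<bar>x - node s l\<bar>) + real n * p x) \<le>
      exp (C + ((\<Sum>l\<in>I. k l * ln \<bar>x0 - node s l\<bar>) + real n * p x0))" by simp
    then show ?thesis by (simp add: T T0 exp_add)
  next
    case False
    have Mx: "\<bar>ln (\<bar>x - node s l\<bar> + h)\<bar> \<le> M" if "l \<in> I" for l
    proof (rule M)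
      show "min h (s0 * \<delta>) \<le> \<bar>x - node s l\<bar> + h" by simp
      show "\<bar>x - node s l\<bar> + h \<le> r - a + \<delta> + (of_int N + 1) * h"
        using noder[OF that] x h x0r by (simp add: algebra_simps abs_le_iff) linarith
    qed
    have M0: "\<bar>ln \<bar>x0 - node s l\<bar>\<bar> \<le> M" if "l \<in> I" for l
    proof (rule M)
      show "min h (s0 * \<delta>) \<le> \<bar>x0 - node s l\<bar>" using dist0[of l] by simp
      show "\<bar>x0 - node s l\<bar> \<le> r - a + \<delta> + (of_int N + 1) * h"
        using noder[OF that] x0r h ar by (simp add: algebra_simps abs_le_iff) linarith
    qed
    \<comment> \<open>\<open>x\<close> may be a node\<close>
    have "(poly (peak_poly s) x)\<^sup>2 \<le> (\<Prod>l\<in>I. (\<bar>x - node s l\<bar> + h) ^ (2 * multiplicity_at s l))"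
      unfolding poly_peak_poly using h by (intro prod_mono conjI power_mono) auto
    also have "\<dots> = exp (\<Sum>l\<in>I. k l * ln (\<bar>x - node s l\<bar> + h))"
      unfolding k_def using h by (intro prod_power_eq_exp) (simp add: add_nonneg_pos)
    finally have T: "(poly (peak_poly s) x)\<^sup>2 \<le> exp (\<Sum>l\<in>I. k l * ln (\<bar>x - node s l\<bar> + h))" .
    have a1: "(\<Sum>l\<in>I. k l * ln (\<bar>x - node s l\<bar> + h)) \<le> real n * (\<Sum>l\<in>I. mass s l * ln (\<bar>x - node s l\<bar> + h)) + 2 * G * M"
      using rounding_error[of "\<lambda>l. ln (\<bar>x - node s l\<bar> + h)" M s] Mx unfolding k_def G_def by (simp add: abs_le_iff)
    have a2: "(\<Sum>l\<in>I. k l * ln \<bar>x0 - node s l\<bar>) \<ge> real n * (\<Sum>l\<in>I. mass s l * ln \<bar>x0 - node s l\<bar>) - 2 * G * M"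
      using rounding_error[of "\<lambda>l. ln \<bar>x0 - node s l\<bar>" M s] M0 unfolding k_def G_def by (simp add: abs_le_iff)
    have b1: "(\<Sum>l\<in>I. mass s l * ln (\<bar>x - node s l\<bar> + h)) + p x \<le>
      \<Phi> + 3 / (K - 1) + (ln (K + 2) + 2) * \<epsilon> + h / (a2 - r)"
      by (rule outside_gap_bound[OF s01(1) x False K \<epsilon>])
    have b2: "(\<Sum>l\<in>I. mass s l * ln \<bar>x0 - node s l\<bar>) + p x0 \<ge> \<Phi> - e1 + \<kappa> * \<delta>\<^sup>2 / 24"
      by (rule value_at_balanced_position[OF s01(2) s(2) e1])
    define u where "u = (\<Sum>l\<in>I. mass s l * ln (\<bar>x - node s l\<bar> + h)) + p x"
    define v where "v = (\<Sum>l\<in>I. mass s l * ln \<bar>x0 - node s l\<bar>) + p x0"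
    have "u + \<kappa> * \<delta>\<^sup>2 / 48 \<le> v" using b1 b2 gain unfolding u_def v_def by linarith
    then have "real n * (u + \<kappa> * \<delta>\<^sup>2 / 48) \<le> real n * v" by (intro mult_left_mono) auto
    then have "real n * u + 4 * G * M \<le> real n * v" using nlarge unfolding G_def distrib_left by linarith
    then have "(\<Sum>l\<in>I. k l * ln (\<bar>x - node s l\<bar> + h)) + real n * p x \<le> (\<Sum>l\<in>I. k l * ln \<bar>x0 - node s l\<bar>) + real n * p x0"
      using a1 a2 unfolding u_def v_def distrib_left by linarith
    then have "exp ((\<Sum>l\<in>I. k l * ln (\<bar>x - node s l\<bar> + h)) + real n * p x) \<le> (poly (peak_poly s) x0)\<^sup>2 * exp (real n * p x0)"
      by (simp add: T0 exp_add[symmetric])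
    moreover have "(poly (peak_poly s) x)\<^sup>2 * exp (real n * p x) \<le> exp ((\<Sum>l\<in>I. k l * ln (\<bar>x - node s l\<bar> + h)) + real n * p x)"
      using T by (simp add: exp_add)
    moreover have "1 * ((poly (peak_poly s) x0)\<^sup>2 * exp (real n * p x0)) \<le> exp C * ((poly (peak_poly s) x0)\<^sup>2 * exp (real n * p x0))"
      using C by (intro mult_right_mono) auto
    ultimately show ?thesis by linarith
  qed
  then show "(poly (peak_poly s) x)\<^sup>2 * exp (real n * p x) \<le>
      exp ((2 * (2 * of_int N + 1) / (s0 * \<delta>))\<^sup>2 / (2 * \<kappa>) / real n) * ((poly (peak_poly s) x0)\<^sup>2 * exp (real n * p x0))"
    by (simp add: C_def G_def)
qed

end

text \<open>The choice of the parameters, independently of \<open>n\<close>, of the zeros and of the measure: a quarter of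
  \<open>\<gamma>\<close> is reserved for each of the four error terms, which determines \<open>K\<close>, then \<open>\<epsilon>\<close>, then \<open>h\<close>, then
  \<open>N\<close>, \<open>s0\<close> and finally \<open>n0\<close>.\<close>
lemma peak_polynomials_exist:
  fixes a b r a2 b2 \<delta> L E :: real
  assumes "a < r" "b < r" "r < a2" "a2 \<le> b2" "\<delta> > 0" "L > 0"
  shows "\<exists>C n0. \<forall>n y \<sigma> hi \<Phi> x0. n \<ge> n0 \<longrightarrow> equilibrium n y a r a2 b2 \<sigma> hi \<Phi> \<longrightarrow>
    (\<forall>c d. c < d \<longrightarrow> (measure \<sigma> {c..d})\<^sup>2 * (ln L - ln (d - c)) \<le> E) \<longrightarrow> a \<le> x0 - \<delta> \<longrightarrow> x0 + \<delta> \<le> hi \<longrightarrow>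
    (\<exists>T. degree T \<le> n div 2 \<and> poly T x0 \<noteq> 0 \<and>
      (\<forall>x\<in>{a..b}. (poly T x)\<^sup>2 * exp (\<Sum>j<n. ln (y j - x)) \<le>
         exp (C / real n) * ((poly T x0)\<^sup>2 * exp (\<Sum>j<n. ln (y j - x0)))))"
proof -
  define \<kappa> where "\<kappa> = 1 / (b2 - a)\<^sup>2"
  have \<kappa>: "\<kappa> > 0" using assms by (simp add: \<kappa>_def)
  define \<gamma> where "\<gamma> = \<kappa> * \<delta>\<^sup>2 / 48"
  have \<gamma>: "\<gamma> > 0" using \<kappa> assms by (simp add: \<gamma>_def)
  define K where "K = 2 + 12 / \<gamma>"
  have K: "K \<ge> 2" "3 / (K - 1) \<le> \<gamma> / 4"
  proof -
    show "K \<ge> 2" using \<gamma> by (simp add: K_def)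
    have "3 / (K - 1) \<le> 3 / (12 / \<gamma>)" using \<gamma> by (intro frac_le) (auto simp: K_def)
    then show "3 / (K - 1) \<le> \<gamma> / 4" using \<gamma> by simp
  qed
  define l2 where "l2 = ln (K + 2) + 2"
  have l2: "l2 > 0" using K by (simp add: l2_def add_nonneg_pos)
  define \<epsilon> where "\<epsilon> = \<gamma> / (4 * l2)"
  have \<epsilon>: "\<epsilon> > 0" "l2 * \<epsilon> = \<gamma> / 4" using \<gamma> l2 by (auto simp: \<epsilon>_def)
  define X where "X = {- (r - a + 1)..r - a + 1}"
  have "uniformly_continuous_on X (log_mean 0 \<delta>)"
    unfolding X_def by (intro compact_uniformly_continuous continuous_on_log_mean) auto
  then obtain d1 where d1: "d1 > 0" "\<And>z v. z \<in> X \<Longrightarrow> v \<in> X \<Longrightarrow> dist v z < d1 \<Longrightarrow> dist (log_mean 0 \<delta> v) (log_mean 0 \<delta> z) < \<gamma> / 4"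
    unfolding uniformly_continuous_on_def using \<gamma> by (metis zero_less_divide_iff zero_less_numeral)
  define V where "V = \<bar>E\<bar> / \<epsilon>\<^sup>2 + 1"
  define h where "h = Min {\<delta>, d1 / 2, 1, r - b, \<gamma> * (a2 - r) / 4, L * exp (- V) / (2 * K)}"
  have hpos: "h > 0" unfolding h_def using assms d1 \<gamma> K by (subst Min_gr_iff) auto
  have hle: "h \<le> \<delta>" "h \<le> d1 / 2" "h \<le> 1" "h \<le> r - b" "h \<le> \<gamma> * (a2 - r) / 4" "h \<le> L * exp (- V) / (2 * K)"
    unfolding h_def by (rule Min_le; simp)+
  define N :: int where "N = \<lceil>(r - a + \<delta> + h) / h\<rceil>"
  have N: "of_int N * h \<ge> r - a + \<delta> + h" "N \<ge> 1"
  proof -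
    have "(r - a + \<delta> + h) / h \<le> of_int N" unfolding N_def by linarith
    then show "of_int N * h \<ge> r - a + \<delta> + h" using hpos by (simp add: pos_divide_le_eq)
    have "0 < (r - a + \<delta> + h) / h" using assms hpos by simp
    then show "N \<ge> 1" by (simp add: N_def)
  qed
  define cm where "cm = \<kappa> * (\<delta> / 6)\<^sup>2 / 16"
  have cm: "cm > 0" using \<kappa> assms by (simp add: cm_def)
  have den: "2 + \<delta> / (a2 - r) > 0" using assms by (simp add: add_pos_pos)
  \<comment> \<open>small enough for \<open>balanced_position\<close>\<close>
  define s0 where "s0 = min (1 / 4) (cm / (2 + \<delta> / (a2 - r)))"
  have s0: "0 < s0" "s0 \<le> 1 / 4" "s0 * (2 + \<delta> / (a2 - r)) \<le> cm"
  proof -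
    show "0 < s0" using cm den by (simp add: s0_def)
    show "s0 \<le> 1 / 4" unfolding s0_def by (rule min.cobounded1)
    have "s0 \<le> cm / (2 + \<delta> / (a2 - r))" by (simp add: s0_def)
    then show "s0 * (2 + \<delta> / (a2 - r)) \<le> cm" using den by (simp only: pos_le_divide_eq)
  qed
  define lo where "lo = min h (s0 * \<delta>)"
  define W where "W = r - a + \<delta> + (of_int N + 1) * h"
  define M where "M = \<bar>ln lo\<bar> + \<bar>ln W\<bar>"
  have lo: "lo > 0" using hpos s0 assms by (simp add: lo_def)
  have M: "\<bar>ln v\<bar> \<le> M" if "lo \<le> v" "v \<le> W" for v
  proof -
    have "ln lo \<le> ln v" "ln v \<le> ln W" using that lo by (auto intro!: ln_mono)
    then show ?thesis unfolding M_def by linarith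
  qed
  define G where "G = 2 * of_int N + (1 :: real)"
  define n0 where "n0 = nat \<lceil>4 * G * M / \<gamma>\<rceil>"
  define C where "C = (2 * G / (s0 * \<delta>))\<^sup>2 / (2 * \<kappa>)"
  show ?thesis
  proof (intro exI[of _ C] exI[of _ n0] allI impI)
    fix n y \<sigma> hi \<Phi> x0
    assume n: "n \<ge> n0" and eq: "equilibrium n y a r a2 b2 \<sigma> hi \<Phi>"
      and mass: "\<forall>c d. c < d \<longrightarrow> (measure \<sigma> {c..d})\<^sup>2 * (ln L - ln (d - c)) \<le> E"
      and x0: "a \<le> x0 - \<delta>" "x0 + \<delta> \<le> hi"
    interpret E: equilibrium n y a r a2 b2 \<sigma> hi \<Phi> by (rule eq)
    interpret gap_configuration n y a r a2 b2 \<sigma> hi \<Phi> \<delta> h N x0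
      by unfold_locales (use hpos hle N x0 in auto)
    have k: "E.\<kappa> = \<kappa>" by (simp add: E.\<kappa>_def \<kappa>_def)
    have "s0 * (2 + \<delta> / (a2 - r)) \<le> end_mass" using s0(3) unfolding end_mass_def k cm_def[symmetric] .
    then obtain s where s: "s \<in> {s0..1 - s0}" "slope s = 0"
      using balanced_position[of s0] s0 by blast
    have e1: "log_mean 0 \<delta> z \<le> log_mean 0 \<delta> v + \<gamma> / 4" if "\<bar>z\<bar> \<le> r - a" "\<bar>v - z\<bar> \<le> h" for z v
    proof -
      have "z \<in> X" "v \<in> X" using that hle(3) by (auto simp: X_def abs_le_iff)
      moreover have "dist v z < d1" using that hle(2) d1(1) by (simp add: dist_real_def)
      ultimately have "dist (log_mean 0 \<delta> v) (log_mean 0 \<delta> z) < \<gamma> / 4" by (rule d1(2))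
      then show ?thesis unfolding dist_real_def by linarith
    qed
    have conc: "measure \<sigma> {x - K * h..x + K * h} \<le> \<epsilon>" for x
    proof (rule ccontr)
      assume "\<not> ?thesis"
      then have gt: "\<epsilon> < measure \<sigma> {x - K * h..x + K * h}" by simp
      have Kh: "K * h > 0" using K hpos by simp
      have "h * (2 * K) \<le> L * exp (- V)" using hle(6) K by (simp add: pos_le_divide_eq)
      then have "ln (2 * (K * h)) \<le> ln (L * exp (- V))" using Kh assms by (subst ln_le_cancel_iff) (auto simp: mult_ac)
      also have "\<dots> = ln L - V" using assms by (simp add: ln_mult)
      finally have V: "V \<le> ln L - ln (x + K * h - (x - K * h))" by simp
      have "V > 0" by (simp add: V_def add_nonneg_pos)
      have "\<epsilon>\<^sup>2 * V = \<bar>E\<bar> + \<epsilon>\<^sup>2" "\<epsilon>\<^sup>2 > 0" using \<epsilon>(1) by (simp_all add: V_def distrib_left)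
      then have "E < \<epsilon>\<^sup>2 * V" by linarith
      also have "\<dots> \<le> (measure \<sigma> {x - K * h..x + K * h})\<^sup>2 * (ln L - ln (x + K * h - (x - K * h)))"
        using gt \<epsilon>(1) V \<open>V > 0\<close> by (intro mult_mono power_mono) auto
      also have "\<dots> \<le> E" by (intro mass[rule_format]) (use Kh in simp)
      finally show False by simp
    qed
    have gain: "\<gamma> / 4 + (3 / (K - 1) + (ln (K + 2) + 2) * \<epsilon> + h / (a2 - r)) \<le> E.\<kappa> * \<delta>\<^sup>2 / 48"
    proof -
      have "h / (a2 - r) \<le> \<gamma> / 4" using hle(5) assms by (simp add: pos_divide_le_eq)
      then show ?thesis using K(2) \<epsilon>(2) unfolding k \<gamma>_def[symmetric] l2_def[symmetric] by linarith
    qed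
    have nl: "4 * (2 * of_int N + 1) * M \<le> real n * (E.\<kappa> * \<delta>\<^sup>2 / 48)"
    proof -
      have "4 * G * M / \<gamma> \<le> real n" using n unfolding n0_def by linarith
      then show ?thesis using \<gamma> unfolding k \<gamma>_def[symmetric] G_def[symmetric] by (simp add: pos_divide_le_eq)
    qed
    note peak = peak_poly_peaks
    have pn: "real n * E.p x = (\<Sum>j<n. ln (y j - x))" for x using E.n by (simp add: E.p_def)
    show "\<exists>T. degree T \<le> n div 2 \<and> poly T x0 \<noteq> 0 \<and>
      (\<forall>x\<in>{a..b}. (poly T x)\<^sup>2 * exp (\<Sum>j<n. ln (y j - x)) \<le>
         exp (C / real n) * ((poly T x0)\<^sup>2 * exp (\<Sum>j<n. ln (y j - x0))))"
    proof (intro exI[of _ "peak_poly s"] conjI ballI)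
      show "degree (peak_poly s) \<le> n div 2" using s s0 by (intro degree_peak_poly) auto
      have prem: "0 < s0" "s \<in> {s0..1 - s0}" "slope s = 0" "0 \<le> \<gamma> / 4" using s0 s \<gamma> by auto
      have Mv: "\<And>v. min h (s0 * \<delta>) \<le> v \<Longrightarrow> v \<le> r - a + \<delta> + (of_int N + 1) * h \<Longrightarrow> \<bar>ln v\<bar> \<le> M"
        using M unfolding lo_def W_def .
      have "a + h \<le> r" using x0 E.hi hle(1) assms(5) by linarith
      show "poly (peak_poly s) x0 \<noteq> 0"
        by (rule peak(2)[OF prem e1 K(1) conc gain Mv nl order_refl \<open>a + h \<le> r\<close>])
      fix x assume "x \<in> {a..b}"
      then have "a \<le> x" "x + h \<le> r" using hle(4) by auto
      from peak(1)[OF prem e1 K(1) conc gain Mv nl this]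
      show "(poly (peak_poly s) x)\<^sup>2 * exp (\<Sum>j<n. ln (y j - x)) \<le>
         exp (C / real n) * ((poly (peak_poly s) x0)\<^sup>2 * exp (\<Sum>j<n. ln (y j - x0)))"
        unfolding pn k C_def G_def .
    qed
  qed
qed

section \<open>Bounds for the quadrature weights\<close>

context angelesco begin

definition second_zero :: "nat \<Rightarrow> nat \<Rightarrow> real" where
  "second_zero n j = mop_zero \<mu> n (n + 1 + j)"

lemma second_zero: "j < n \<Longrightarrow> second_zero n j \<in> {a 2..b 2}"
  using mop_zero_second[of "n + 1 + j" n] by (auto simp: second_zero_def)

lemma q_fun_eq_exp:
  assumes "x < a 2"
  shows "q_fun \<mu> n x = exp (\<Sum>j<n. ln (second_zero n j - x))"
proof -
  have pos: "second_zero n j - x > 0" if "j < n" for j using second_zero[OF that] assms by auto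
  have "q_fun \<mu> n x = (\<Prod>j\<in>{n + 1..<n + 1 + n}. mop_zero \<mu> n j - x)"
    unfolding q_fun_eq by (intro prod.cong) auto
  also have "\<dots> = (\<Prod>j\<in>{0..<n}. mop_zero \<mu> n (j + (n + 1)) - x)"
    using prod.shift_bounds_nat_ivl[of "\<lambda>j. mop_zero \<mu> n j - x" 0 "n + 1" n] by (simp add: add.commute)
  also have "\<dots> = (\<Prod>j<n. exp (ln (second_zero n j - x)))"
    using pos by (intro prod.cong) (auto simp: second_zero_def add_ac)
  also have "\<dots> = exp (\<Sum>j<n. ln (second_zero n j - x))" by (simp add: exp_sum)
  finally show ?thesis .
qed

definition field_bound :: "real \<Rightarrow> real" where
  "field_bound r = \<bar>ln (a 2 - r)\<bar> + \<bar>ln (b 2 - a 1)\<bar>"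

definition energy_bound :: "real \<Rightarrow> real" where
  "energy_bound r = ln (max 1 (r - a 1)) - ln (r - a 1) + 2 + 4 * field_bound r"

text \<open>Since \<open>q\<^sub>n\<close> is the exponential of \<open>n p\<close> for the point charges at its zeros, the extremal measure
  for \<open>q\<^sub>n\<^bsup>1/n\<^esup>\<close> is an equilibrium in the field of these charges. The bound for the energy does not depend
  on \<open>n\<close>.\<close>
lemma equilibrium_of_extremal_support:
  assumes n: "n \<ge> 1" and r: "a 1 < r" "r < a 2"
    and ext: "has_extremal_support {a 1..r} (weight_fun \<mu> n) {a 1..hi}"
  shows "\<exists>\<sigma> \<Phi>. equilibrium n (second_zero n) (a 1) r (a 2) (b 2) \<sigma> (min hi r) \<Phi> \<and>
    (\<forall>c d. c < d \<longrightarrow> (measure \<sigma> {c..d})\<^sup>2 * (ln (max 1 (r - a 1)) - ln (d - c)) \<le> energy_bound r)"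
proof -
  obtain \<sigma> where \<sigma>: "is_extremal_measure {a 1..r} (weight_fun \<mu> n) \<sigma>" "msupport \<sigma> = {a 1..hi}"
    using ext by (auto simp: has_extremal_support_def)
  interpret P: point_field n "second_zero n" "a 1" r "a 2" "b 2"
    using n r second_zero by unfold_locales
  have Q: "external_field (weight_fun \<mu> n) x = - P.p x" if "x \<in> {a 1..r}" for x
  proof -
    have "x < a 2" using that r by auto
    then show ?thesis using q_fun_pos[of x n]
      by (simp add: external_field_weight_fun q_fun_eq_exp P.p_def)
  qed
  have pb: "\<bar>P.p x\<bar> \<le> field_bound r" if x: "x \<in> {a 1..r}" for x
  proof -
    have l: "\<bar>ln (second_zero n j - x)\<bar> \<le> field_bound r" if "j < n" for j
    proof -
      have "a 2 - r \<le> second_zero n j - x" "second_zero n j - x \<le> b 2 - a 1" "a 2 - r > 0"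
        using second_zero[OF that] x r by auto
      then have "ln (a 2 - r) \<le> ln (second_zero n j - x)" "ln (second_zero n j - x) \<le> ln (b 2 - a 1)"
        by (auto intro!: ln_mono)
      then show ?thesis unfolding field_bound_def by linarith
    qed
    have "P.p x \<le> field_bound r" unfolding P.p_def using l by (intro P.average_le) (auto simp: abs_le_iff)
    moreover have "(\<Sum>j<n. - ln (second_zero n j - x)) / real n \<le> field_bound r"
      using l by (intro P.average_le) (auto simp: abs_le_iff)
    then have "- P.p x \<le> field_bound r" by (simp add: P.p_def sum_negf)
    ultimately show ?thesis by (simp add: abs_le_iff)
  qed
  interpret F: extremal_field "a 1" r "max 1 (r - a 1)" "field_bound r" "weight_fun \<mu> n" \<sigma>
  proof
    have "continuous_on {a 1..r} (\<lambda>x. - P.p x)" by (intro continuous_intros P.p_continuous)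
    then show "continuous_on {a 1..r} (external_field (weight_fun \<mu> n))"
      by (rule continuous_on_eq) (simp add: Q)
    show "\<bar>external_field (weight_fun \<mu> n) x\<bar> \<le> field_bound r" if "x \<in> {a 1..r}" for x
      using Q[OF that] pb[OF that] by simp
  qed (use r \<sigma> in auto)
  have int: "integral {c..d} (external_field (weight_fun \<mu> n)) = - integral {c..d} P.p"
    if "a 1 \<le> c" "d \<le> r" for c d
  proof -
    have "integral {c..d} (external_field (weight_fun \<mu> n)) = integral {c..d} (\<lambda>x. - P.p x)"
      using that by (intro integral_cong Q) auto
    then show ?thesis by simp
  qed
  have "equilibrium n (second_zero n) (a 1) r (a 2) (b 2) \<sigma> (min hi r) F.level"
  proof (intro equilibrium.intro equilibrium_axioms.intro P.point_field_axioms)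
    show "prob_space \<sigma>" "sets \<sigma> = sets borel" "AE t in \<sigma>. t \<in> {a 1..r}"
      by (rule F.prob_space_sigma F.sets_sigma F.AE_sigma)+
    fix c d :: real
    show "(LINT t|\<sigma>. log_mean c d t) + integral {c..d} P.p / (d - c) \<le> F.level" if "a 1 \<le> c" "c < d" "d \<le> r"
      using F.mean_potential_upper[OF that] int[OF that(1,3)] by simp
    show "(LINT t|\<sigma>. log_mean c d t) + integral {c..d} P.p / (d - c) \<ge> F.level" if "a 1 \<le> c" "c < d" "d \<le> min hi r"
      using F.mean_potential_lower[of c d] int[of c d] that \<sigma>(2) by simp
  qed simp
  moreover have "\<forall>c d. c < d \<longrightarrow> (measure \<sigma> {c..d})\<^sup>2 * (ln (max 1 (r - a 1)) - ln (d - c)) \<le> energy_bound r"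
    using F.interval_mass by (simp add: energy_bound_def)
  ultimately show ?thesis by blast
qed

text \<open>The square of the product of \<open>T\<close> and the minimising polynomial for the Christoffel function has degree
  at most \<open>2 n - 2\<close> and is admissible in the bound for the weights.\<close>
lemma quad_weight_le_christoffel:
  assumes n: "n \<ge> 2" and j: "j \<in> {1..n}" and T: "degree T \<le> n div 2" "poly T (mop_zero \<mu> n j) \<noteq> 0"
    and peak: "\<And>x. x \<in> {a 1..b 1} \<Longrightarrow> (poly T x)\<^sup>2 * q_fun \<mu> n x \<le>
      c * ((poly T (mop_zero \<mu> n j))\<^sup>2 * q_fun \<mu> n (mop_zero \<mu> n j))" and "b 1 < a 2"
  shows "quad_weight \<mu> 1 n j \<le> c * christoffel (\<mu> 1) (n div 2) (mop_zero \<mu> n j)"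
proof -
  interpret interval_measure "\<mu> 1" "a 1" "b 1" by (rule interval_measure) simp
  define x0 where "x0 = mop_zero \<mu> n j"
  define m where "m = n div 2"
  have m: "m \<ge> 1" "2 * m \<le> n" using n by (auto simp: m_def)
  obtain S where S: "degree S < m" "poly S x0 = 1" "(LINT t|\<mu> 1. (poly S t)\<^sup>2) = christoffel (\<mu> 1) m x0"
    using christoffel_attained[OF m(1)] by blast
  define R where "R = S ^ 2 * T ^ 2"
  have R: "poly R x = (poly S x)\<^sup>2 * (poly T x)\<^sup>2" for x by (simp add: R_def)
  have "degree R \<le> 2 * degree S + 2 * degree T"
    unfolding R_def using degree_mult_le[of "S ^ 2" "T ^ 2"] degree_power_le[of S 2] degree_power_le[of T 2] by linarith
  also have "\<dots> \<le> 2 * n - 1" using S(1) T(1) m n unfolding m_def[symmetric] by linarith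
  finally have degR: "degree R \<le> 2 * n - 1" .
  have x0: "x0 \<in> {a 1<..<b 1}" unfolding x0_def by (rule mop_zero_first[OF j])
  define w where "w = (poly T x0)\<^sup>2 * q_fun \<mu> n x0"
  have w: "w > 0" using T(2) q_fun_pos[of x0 n] x0 assms(6) unfolding w_def x0_def[symmetric] by (auto intro!: mult_pos_pos)
  have qm: "continuous_on UNIV (\<lambda>x. q_fun \<mu> n x * poly R x)"
    unfolding q_fun_def by (intro continuous_intros)
  have "quad_weight \<mu> 1 n j * w = quad_weight \<mu> 1 n j * q_fun \<mu> n x0 * poly R x0"
    by (simp add: R S(2) w_def)
  also have "\<dots> \<le> (LINT x|\<mu> 1. q_fun \<mu> n x * poly R x)"
    unfolding x0_def using n j degR by (intro quad_weight_bound) (auto simp: R)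
  also have "\<dots> \<le> (LINT x|\<mu> 1. c * w * (poly S x)\<^sup>2)"
  proof (intro integral_mono_AE eventually_mono[OF AE_interval])
    show "integrable (\<mu> 1) (\<lambda>x. q_fun \<mu> n x * poly R x)" by (rule integrable_continuous[OF qm])
    show "integrable (\<mu> 1) (\<lambda>x. c * w * (poly S x)\<^sup>2)" by (intro integrable_continuous continuous_intros)
    fix x assume "x \<in> {a 1..b 1}"
    then have "(poly T x)\<^sup>2 * q_fun \<mu> n x \<le> c * w" using peak unfolding w_def x0_def by blast
    then have "((poly T x)\<^sup>2 * q_fun \<mu> n x) * (poly S x)\<^sup>2 \<le> c * w * (poly S x)\<^sup>2" by (intro mult_right_mono) auto
    then show "q_fun \<mu> n x * poly R x \<le> c * w * (poly S x)\<^sup>2" by (simp add: R mult_ac)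
  qed
  also have "\<dots> = c * christoffel (\<mu> 1) m x0 * w" using S(3) by simp
  finally show ?thesis using w unfolding x0_def m_def by simp
qed

text \<open>The compact set \<open>K\<close> has a positive distance from both ends, which gives room for a gap of fixed
  length around each node in \<open>K\<close>.\<close>
lemma quad_weight_asymptotic_bound:
  assumes r: "b 1 < r" "r < a 2"
    and ext: "\<forall>\<^sub>F n in sequentially. has_extremal_support {a 1..r} (weight_fun \<mu> n) {a 1..bn n}"
    and bn: "bn \<longlonglongrightarrow> bstar" and K: "compact K" "K \<subseteq> {a 1<..<bstar}"
  shows "\<exists>\<epsilon> :: nat \<Rightarrow> real. \<epsilon> \<longlonglongrightarrow> 0 \<and>
     (\<forall>\<^sub>F n in sequentially. \<forall>j\<in>{1..n}. mop_zero \<mu> n j \<in> K \<longrightarrow>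
        quad_weight \<mu> 1 n j \<le> (1 + \<epsilon> n) * christoffel (\<mu> 1) (n div 2) (mop_zero \<mu> n j))"
proof (cases "K = {}")
  case True
  then show ?thesis by (intro exI[of _ "\<lambda>_. 0"]) auto
next
  case False
  have "bounded K" using K(1) by (rule compact_imp_bounded)
  then have bdd: "bdd_below K" "bdd_above K"
    by (rule bounded_imp_bdd_below, rule bounded_imp_bdd_above)
  have InfSup: "Inf K \<in> K" "Sup K \<in> K"
    using closed_contains_Inf closed_contains_Sup False bdd K(1) compact_imp_closed by blast+
  define \<delta> where "\<delta> = min (min (Inf K - a 1) ((bstar - Sup K) / 2)) (r - b 1)"
  have \<delta>: "\<delta> > 0" "\<delta> \<le> r - b 1" using InfSup K(2) r by (auto simp: \<delta>_def)
  have K\<delta>: "a 1 \<le> x - \<delta>" "x + 2 * \<delta> \<le> bstar" if "x \<in> K" for x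
  proof -
    have "Inf K \<le> x" "x \<le> Sup K" using that bdd cInf_lower cSup_upper by blast+
    moreover have "\<delta> \<le> Inf K - a 1" "\<delta> \<le> (bstar - Sup K) / 2" unfolding \<delta>_def by linarith+
    ultimately show "a 1 \<le> x - \<delta>" "x + 2 * \<delta> \<le> bstar" by auto
  qed
  have ar: "a 1 < r" using intervals r by linarith
  have L0: "0 < max 1 (r - a 1)" by simp
  obtain C n0 where C: "\<And>n y \<sigma> hi \<Phi> x0. n \<ge> n0 \<Longrightarrow> equilibrium n y (a 1) r (a 2) (b 2) \<sigma> hi \<Phi> \<Longrightarrow>
    (\<forall>c d. c < d \<longrightarrow> (measure \<sigma> {c..d})\<^sup>2 * (ln (max 1 (r - a 1)) - ln (d - c)) \<le> energy_bound r) \<Longrightarrow>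
    a 1 \<le> x0 - \<delta> \<Longrightarrow> x0 + \<delta> \<le> hi \<Longrightarrow>
    (\<exists>T. degree T \<le> n div 2 \<and> poly T x0 \<noteq> 0 \<and>
      (\<forall>x\<in>{a 1..b 1}. (poly T x)\<^sup>2 * exp (\<Sum>j<n. ln (y j - x)) \<le>
         exp (C / real n) * ((poly T x0)\<^sup>2 * exp (\<Sum>j<n. ln (y j - x0)))))"
    using peak_polynomials_exist[OF ar r less_imp_le[OF intervals(3)] \<delta>(1) L0, of "energy_bound r"] by blast
  define \<epsilon> where "\<epsilon> n = exp (C / real n) - 1" for n
  have "(\<lambda>n. exp (C / real n) - 1) \<longlonglongrightarrow> exp 0 - 1"
    by (intro tendsto_intros tendsto_divide_0[OF tendsto_const] filterlim_real_sequentially filterlim_at_top_imp_at_infinity)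
  then have lim: "\<epsilon> \<longlonglongrightarrow> 0" by (simp add: \<epsilon>_def[abs_def])
  have "\<forall>\<^sub>F n in sequentially. bn n > bstar - \<delta>"
    using order_tendstoD(1)[OF bn, of "bstar - \<delta>"] \<delta> by simp
  then have "\<forall>\<^sub>F n in sequentially. \<forall>j\<in>{1..n}. mop_zero \<mu> n j \<in> K \<longrightarrow>
        quad_weight \<mu> 1 n j \<le> (1 + \<epsilon> n) * christoffel (\<mu> 1) (n div 2) (mop_zero \<mu> n j)"
    using ext eventually_ge_at_top[of "max n0 2"]
  proof eventually_elim
    case (elim n)
    obtain \<sigma> \<Phi> where eq: "equilibrium n (second_zero n) (a 1) r (a 2) (b 2) \<sigma> (min (bn n) r) \<Phi>"
      and mass: "\<forall>c d. c < d \<longrightarrow> (measure \<sigma> {c..d})\<^sup>2 * (ln (max 1 (r - a 1)) - ln (d - c)) \<le> energy_bound r"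
      using equilibrium_of_extremal_support[OF _ ar r(2) elim(2)] elim(3) by auto
    show ?case
    proof (intro ballI impI)
      fix j assume j: "j \<in> {1..n}" and inK: "mop_zero \<mu> n j \<in> K"
      define x0 where "x0 = mop_zero \<mu> n j"
      have x0: "x0 < b 1" using mop_zero_first[OF j] by (simp add: x0_def)
      have "a 1 \<le> x0 - \<delta>" "x0 + \<delta> \<le> min (bn n) r"
        using K\<delta>[OF inK] elim(1) \<delta>(2) x0 by (auto simp: x0_def)
      then obtain T where T: "degree T \<le> n div 2" "poly T x0 \<noteq> 0"
        "\<forall>x\<in>{a 1..b 1}. (poly T x)\<^sup>2 * exp (\<Sum>j<n. ln (second_zero n j - x)) \<le>
         exp (C / real n) * ((poly T x0)\<^sup>2 * exp (\<Sum>j<n. ln (second_zero n j - x0)))"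
        using C[OF _ eq mass] elim(3) by auto
      have "quad_weight \<mu> 1 n j \<le> exp (C / real n) * christoffel (\<mu> 1) (n div 2) (mop_zero \<mu> n j)"
      proof (rule quad_weight_le_christoffel[OF _ j T(1)])
        show "2 \<le> n" using elim(3) by simp
        show "poly T (mop_zero \<mu> n j) \<noteq> 0" using T(2) by (simp add: x0_def)
        show "b 1 < a 2" using r by simp
        fix x assume x: "x \<in> {a 1..b 1}"
        have q: "q_fun \<mu> n x = exp (\<Sum>j<n. ln (second_zero n j - x))"
          "q_fun \<mu> n x0 = exp (\<Sum>j<n. ln (second_zero n j - x0))"
          using x x0 r by (auto intro!: q_fun_eq_exp)
        show "(poly T x)\<^sup>2 * q_fun \<mu> n x \<le> exp (C / real n) * ((poly T (mop_zero \<mu> n j))\<^sup>2 * q_fun \<mu> n (mop_zero \<mu> n j))"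
          using T(3) x unfolding x0_def[symmetric] q by blast
      qed
      then show "quad_weight \<mu> 1 n j \<le> (1 + \<epsilon> n) * christoffel (\<mu> 1) (n div 2) (mop_zero \<mu> n j)"
        by (simp add: \<epsilon>_def)
    qed
  qed
  with lim show ?thesis by blast
qed

lemma quad_weight_order_bound:
  assumes r: "b 1 < r" "r < a 2"
    and ext: "\<forall>\<^sub>F n in sequentially. has_extremal_support {a 1..r} (weight_fun \<mu> n) {a 1..bn n}"
    and bn: "bn \<longlonglongrightarrow> bstar" and cd: "a 1 < c" "d < bstar"
    and U: "open U" "{c..d} \<subseteq> U" "abs_continuous_on (\<mu> 1) U" "is_ac_density (\<mu> 1) f"
    and M: "M > 0" "AE x in lborel. x \<in> U \<longrightarrow> f x \<le> M"
  shows "\<exists>C2>0. \<forall>n\<ge>1. \<forall>j\<in>{1..n}. mop_zero \<mu> n j \<in> {c..d} \<longrightarrow> quad_weight \<mu> 1 n j \<le> C2 / real n"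
proof -
  interpret interval_measure "\<mu> 1" "a 1" "b 1" by (rule interval_measure) simp
  obtain \<epsilon> where \<epsilon>: "\<epsilon> \<longlonglongrightarrow> 0" "\<forall>\<^sub>F n in sequentially. \<forall>j\<in>{1..n}. mop_zero \<mu> n j \<in> {c..d} \<longrightarrow>
        quad_weight \<mu> 1 n j \<le> (1 + \<epsilon> n) * christoffel (\<mu> 1) (n div 2) (mop_zero \<mu> n j)"
    using quad_weight_asymptotic_bound[OF r ext bn, of "{c..d}"] cd by fastforce
  obtain C where C: "C > 0" "\<And>m x. m \<ge> 1 \<Longrightarrow> x \<in> {c..min d (b 1)} \<Longrightarrow> christoffel (\<mu> 1) m x \<le> C / real m"
    using christoffel_upper_bound[of U c "min d (b 1)" f M] U M cd intervals(1) by fastforce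
  have "\<forall>\<^sub>F n in sequentially. \<epsilon> n < 1" using order_tendstoD(2)[OF \<epsilon>(1), of 1] by simp
  then have "\<forall>\<^sub>F n in sequentially. \<forall>j\<in>{1..n}. mop_zero \<mu> n j \<in> {c..d} \<longrightarrow> quad_weight \<mu> 1 n j \<le> 8 * C / real n"
    using \<epsilon>(2) eventually_ge_at_top[of 2]
  proof eventually_elim
    case (elim n)
    show ?case
    proof (intro ballI impI)
      fix j assume j: "j \<in> {1..n}" "mop_zero \<mu> n j \<in> {c..d}"
      let ?x = "mop_zero \<mu> n j"
      have x: "?x \<in> {c..min d (b 1)}" using j(2) mop_zero_first[OF j(1)] by auto
      have ch0: "christoffel (\<mu> 1) (n div 2) ?x \<ge> 0" by (simp add: christoffel_def sum_nonneg)
      have "quad_weight \<mu> 1 n j \<le> (1 + \<epsilon> n) * christoffel (\<mu> 1) (n div 2) ?x" using elim(2) j by blast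
      also have "\<dots> \<le> 2 * christoffel (\<mu> 1) (n div 2) ?x" using elim(1) ch0 by (intro mult_right_mono) auto
      also have "\<dots> \<le> 2 * (C / real (n div 2))"
      proof -
        have "1 \<le> n div 2" using elim(3) by linarith
        from C(2)[OF this x] show ?thesis by (rule mult_left_mono) simp
      qed
      also have "\<dots> \<le> 2 * (C / (real n / 4))"
      proof -
        have "n \<le> 4 * (n div 2)" using elim(3) by linarith
        then have "real n / 4 \<le> real (n div 2)" by linarith
        then show ?thesis using C(1) elim(3) by (intro mult_left_mono divide_left_mono) auto
      qed
      finally show "quad_weight \<mu> 1 n j \<le> 8 * C / real n" by simp
    qed
  qed
  then obtain n1 where n1: "\<And>n j. n \<ge> n1 \<Longrightarrow> j \<in> {1..n} \<Longrightarrow> mop_zero \<mu> n j \<in> {c..d} \<Longrightarrow>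
      quad_weight \<mu> 1 n j \<le> 8 * C / real n"
    unfolding eventually_sequentially by blast
  \<comment> \<open>takes care of the finitely many \<open>n\<close> below \<open>n1\<close>\<close>
  define A where "A = (\<Sum>n<n1. \<Sum>j\<in>{1..n}. \<bar>real n * quad_weight \<mu> 1 n j\<bar>)"
  have "A \<ge> 0" by (auto simp: A_def intro!: sum_nonneg)
  show ?thesis
  proof (intro exI[of _ "8 * C + A"] conjI allI ballI impI)
    show "0 < 8 * C + A" using C(1) \<open>A \<ge> 0\<close> by simp
    fix n j assume n: "1 \<le> n" and j: "j \<in> {1..n}" "mop_zero \<mu> n j \<in> {c..d}"
    show "quad_weight \<mu> 1 n j \<le> (8 * C + A) / real n"
    proof (cases "n \<ge> n1")
      case True
      have "quad_weight \<mu> 1 n j \<le> 8 * C / real n" by (rule n1[OF True j])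
      also have "\<dots> \<le> (8 * C + A) / real n" using \<open>A \<ge> 0\<close> by (intro divide_right_mono) auto
      finally show ?thesis .
    next
      case False
      have "real n * quad_weight \<mu> 1 n j \<le> \<bar>real n * quad_weight \<mu> 1 n j\<bar>" by simp
      also have "\<dots> \<le> (\<Sum>j\<in>{1..n}. \<bar>real n * quad_weight \<mu> 1 n j\<bar>)"
        by (rule member_le_sum[OF j(1)]) auto
      also have "\<dots> \<le> A" unfolding A_def
        using False by (intro member_le_sum[of n "{..<n1}"]) (auto intro!: sum_nonneg)
      finally have "real n * quad_weight \<mu> 1 n j \<le> 8 * C + A" using C(1) by simp
      then show ?thesis using n by (simp add: pos_le_divide_eq mult.commute)
    qed
  qed
qed

end

theorem proposition2p6:
  fixes a b :: "nat \<Rightarrow> real" and \<mu> :: "nat \<Rightarrow> real measure"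
    and r bstar :: real and bn :: "nat \<Rightarrow> real"
  assumes "angelesco_system a b \<mu>"
    and "b 1 < a 2" and "b 1 < r" and "r < a 2"
    and "\<forall>\<^sub>F n in sequentially. has_extremal_support {a 1..r} (weight_fun \<mu> n) {a 1..bn n}"
    and "bn \<longlonglongrightarrow> bstar"
  shows
    "(\<forall>K. compact K \<and> K \<subseteq> {a 1<..<bstar} \<longrightarrow>
        (\<exists>\<epsilon> :: nat \<Rightarrow> real. \<epsilon> \<longlonglongrightarrow> 0 \<and>
          (\<forall>\<^sub>F n in sequentially. \<forall>j\<in>{1..n}. mop_zero \<mu> n j \<in> K \<longrightarrow>
             quad_weight \<mu> 1 n j \<le> (1 + \<epsilon> n) * christoffel (\<mu> 1) (n div 2) (mop_zero \<mu> n j))))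
     \<and>
     (\<forall>c d U f M. a 1 < c \<and> c \<le> d \<and> d < bstar \<and>
        open U \<and> {c..d} \<subseteq> U \<and> abs_continuous_on (\<mu> 1) U \<and>
        is_ac_density (\<mu> 1) f \<and> M > 0 \<and> (AE x in lborel. x \<in> U \<longrightarrow> f x \<le> M) \<longrightarrow>
        (\<exists>C2>0. \<forall>n\<ge>1. \<forall>j\<in>{1..n}. mop_zero \<mu> n j \<in> {c..d} \<longrightarrow>
           quad_weight \<mu> 1 n j \<le> C2 / real n))"
proof -
  interpret angelesco a b \<mu> using assms(1) by unfold_locales
  show ?thesis
  proof (intro conjI allI impI)
    fix K assume "compact K \<and> K \<subseteq> {a 1<..<bstar}"
    then show "\<exists>\<epsilon> :: nat \<Rightarrow> real. \<epsilon> \<longlonglongrightarrow> 0 \<and>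
          (\<forall>\<^sub>F n in sequentially. \<forall>j\<in>{1..n}. mop_zero \<mu> n j \<in> K \<longrightarrow>
             quad_weight \<mu> 1 n j \<le> (1 + \<epsilon> n) * christoffel (\<mu> 1) (n div 2) (mop_zero \<mu> n j))"
      by (intro quad_weight_asymptotic_bound[OF assms(3-6)]) auto
  next
    fix c d :: real and U :: "real set" and f M
    assume "a 1 < c \<and> c \<le> d \<and> d < bstar \<and> open U \<and> {c..d} \<subseteq> U \<and> abs_continuous_on (\<mu> 1) U \<and>
        is_ac_density (\<mu> 1) f \<and> M > 0 \<and> (AE x in lborel. x \<in> U \<longrightarrow> f x \<le> M)"
    then show "\<exists>C2>0. \<forall>n\<ge>1. \<forall>j\<in>{1..n}. mop_zero \<mu> n j \<in> {c..d} \<longrightarrow> quad_weight \<mu> 1 n j \<le> C2 / real n"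
      by (intro quad_weight_order_bound[OF assms(3-6)]) auto
  qed
qed

end
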